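(* Let $q,r\ge2$, $\alpha\in(0,1)$ and $t\ge\rho(P_\alpha)=2\sqrt{\alpha(1-\alpha)}$. The Martin compactification of $\mathrm{DL}(q,r)$ with respect to $P_\alpha$ and eigenvalue $t$ is the geometric compactification $\widehat{\mathrm{DL}}(q,r)$ when $t=\rho(P_\alpha)$, and the horocyclic compactification $\widetilde{\mathrm{DL}}(q,r)$ when $t>\rho(P_\alpha)$.
   Context: Trees. For an integer $p\ge2$, $\mathbb T_p$ is the homogeneous tree in which every vertex has $p+1$ neighbours. An end is an equivalence class of one-sided infinite geodesic rays, two rays being equivalent if their symmetric difference is finite; $\partial\mathbb T_p$ is the set of ends and $\widehat{\mathbb T}_p=\mathbb T_p\cup\partial\mathbb T_p$. For distinct $w,z\in\widehat{\mathbb T}_p$, $\overline{w\,z}$ is the geodesic connecting them. Fix a root $o$ and a reference end $\omega$; put $\partial^*\mathbb T_p=\partial\mathbb T_p\setminus\{\omega\}$. The confluent $c=w\wedge z$ with respect to $o$ is defined by $\overline{o\,w}\cap\overline{o\,z}=\overline{o\,c}$. The end topology on $\widehat{\mathbb T}_p$ is induced by the metric $\theta(z,w)=p^{-d(z\wedge w,o)}$ for $z\ne w$, $\theta(z,z)=0$. For vertices $x,y$, $x\curlywedge y$ is the vertex $b$ with $\overline{x\,\omega}\cap\overline{y\,\omega}=\overline{b\,\omega}$, and $\mathfrak h(x)=d(x,o\curlywedge x)-d(o,o\curlywedge x)$. Each vertex $x$ has exactly one neighbour $x^-$ with $\mathfrak h(x^-)=\mathfrak h(x)-1$; its $p$ other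 neighbours $y$ satisfy $y^-=x$. Let $\overline{\mathbb Z}=\mathbb Z\cup\{\pm\infty\}$. Replacing the end $\omega$ by new points $\omega^k$, $k\in\overline{\mathbb Z}$, put $\widetilde{\mathbb T}_p=\mathbb T_p\cup\partial^*\mathbb T_p\cup\{\omega^k:k\in\overline{\mathbb Z}\}$, $\mathfrak h(\omega^k)=k$, $\mathfrak h(\xi)=+\infty$ for $\xi\in\partial^*\mathbb T_p$, with the topology of the metric $\theta_h(z,w)=\theta(z,w)+\left|\frac{\mathfrak h(z)}{1+|\mathfrak h(z)|}-\frac{\mathfrak h(w)}{1+|\mathfrak h(w)|}\right|$, where in $\theta$ each $\omega^k$ is treated as the end $\omega$, and $\frac{\pm\infty}{1+\infty}=\pm1$. Diestel-Leader graph. Let $\mathbb T_q,\mathbb T_r$ have roots $o_1,o_2$ and reference ends $\omega_1,\omega_2$. The vertex set is $\mathrm{DL}(q,r)=\{x_1x_2\in\mathbb T_q\times\mathbb T_r:\mathfrak h(x_1)+\mathfrak h(x_2)=0\}$, with $x_1x_2\sim y_1y_2$ iff $x_1\sim y_1$ and $x_2\sim y_2$; reference point $o=o_1o_2$. The geometric compactification $\widehat{\mathrm{DL}}(q,r)$ is the closure of $\mathrm{DL}(q,r)$ in $\widehat{\mathbb T}_q\times\widehat{\mathbb T}_r$, and the horocyclic compactification $\widetilde{\mathrm{DL}}(q,r)$ is its closure in $\widetilde{\mathbb T}_q\times\widetilde{\mathbb T}_r$. Random walk. $P_\alpha$ on $\mathrm{DL}(q,r)$ has transition probabilities $p_\alpha(x,y)=\alpha/q$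 if $y_1^-=x_1$ and $y_2=x_2^-$; $(1-\alpha)/r$ if $y_1=x_1^-$ and $y_2^-=x_2$; and $0$ otherwise. Its spectral radius is $\rho(P_\alpha)=\limsup_n p_\alpha^{(n)}(x,y)^{1/n}=2\sqrt{\alpha(1-\alpha)}$. Martin compactification with eigenvalue $t\geq\rho(P_\alpha)$. Put $G(x,y|t)=\sum_{n\ge0}p^{(n)}_\alpha(x,y)/t^n$ and $K(x,y|t)=G(x,y|t)/G(o,y|t)$. The Martin compactification with respect to $P_\alpha$ and eigenvalue $t$ is the smallest metrizable compactification of $\mathrm{DL}(q,r)$ containing $\mathrm{DL}(q,r)$ as a discrete dense subset to which all functions $K(x,\cdot|t)$, $x\in\mathrm{DL}(q,r)$, extend continuously. Compactifications are identified when the identity on $\mathrm{DL}(q,r)$ extends to a homeomorphism. *)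

theory Defs
  imports "HOL-Analysis.Analysis" "HOL-Library.Extended"
begin

section \<open>Homogeneous trees and their ends\<close>

definition gdist :: "('a \<Rightarrow> 'a \<Rightarrow> bool) \<Rightarrow> 'a \<Rightarrow> 'a \<Rightarrow> nat" where
  "gdist E x y = (LEAST n. (E ^^ n) x y)"

definition is_tree :: "('a \<Rightarrow> 'a \<Rightarrow> bool) \<Rightarrow> bool" where
  "is_tree E \<longleftrightarrow> symp E \<and> irreflp E \<and> (\<forall>x y. E\<^sup>*\<^sup>* x y) \<and>
     (\<nexists>xs. length xs \<ge> 3 \<and> distinct xs \<and> successively E xs \<and> E (last xs) (hd xs))"

text \<open>The vertex set is the whole type.\<close>

definition homogeneous_tree :: "nat \<Rightarrow> ('a \<Rightarrow> 'a \<Rightarrow> bool) \<Rightarrow> bool" where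
  "homogeneous_tree p E \<longleftrightarrow> is_tree E \<and> (\<forall>x. finite {y. E x y} \<and> card {y. E x y} = p + 1)"

definition rays :: "('a \<Rightarrow> 'a \<Rightarrow> bool) \<Rightarrow> (nat \<Rightarrow> 'a) set" where
  "rays E = {\<pi>. \<forall>m n. m \<le> n \<longrightarrow> gdist E (\<pi> m) (\<pi> n) = n - m}"

definition ray_equiv :: "('a \<Rightarrow> 'a \<Rightarrow> bool) \<Rightarrow> ((nat \<Rightarrow> 'a) \<times> (nat \<Rightarrow> 'a)) set" where
  "ray_equiv E = {(\<pi>, \<sigma>). \<pi> \<in> rays E \<and> \<sigma> \<in> rays E \<and>
     finite ((range \<pi> - range \<sigma>) \<union> (range \<sigma> - range \<pi>))}"

type_synonym 'a tree_end = "(nat \<Rightarrow> 'a) set"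

definition ends :: "('a \<Rightarrow> 'a \<Rightarrow> bool) \<Rightarrow> 'a tree_end set" where
  "ends E = rays E // ray_equiv E"

text \<open>A tree together with its root \<open>o\<close> and its reference end \<open>\<omega>\<close>.\<close>

record 'a pointed_tree =
  adj :: "'a \<Rightarrow> 'a \<Rightarrow> bool"
  origin :: 'a
  refend :: "'a tree_end"

definition pointed_homogeneous_tree :: "nat \<Rightarrow> 'a pointed_tree \<Rightarrow> bool" where
  "pointed_homogeneous_tree p T \<longleftrightarrow> homogeneous_tree p (adj T) \<and> refend T \<in> ends (adj T)"

datatype 'a hat_point = Vert 'a | End "'a tree_end"

definition hat_tree :: "'a pointed_tree \<Rightarrow> 'a hat_point set" where
  "hat_tree T = range Vert \<union> End ` ends (adj T)"

text \<open>The vertices on the geodesic from a vertex to a vertex or an end. In a tree, each end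
  contains exactly one ray starting at a given vertex.\<close>

fun geodesic :: "'a pointed_tree \<Rightarrow> 'a \<Rightarrow> 'a hat_point \<Rightarrow> 'a set" where
  "geodesic T x (Vert y) =
     {v. gdist (adj T) x v + gdist (adj T) v y = gdist (adj T) x y}"
| "geodesic T x (End \<xi>) = (\<Union>\<pi>\<in>{\<pi> \<in> \<xi>. \<pi> 0 = x}. range \<pi>)"

text \<open>The confluent \<open>w \<and> z\<close> with respect to the root (used for \<open>w \<noteq> z\<close> only, where it is
  a vertex).\<close>

definition confluent :: "'a pointed_tree \<Rightarrow> 'a hat_point \<Rightarrow> 'a hat_point \<Rightarrow> 'a" where
  "confluent T w z =
     (THE c. geodesic T (origin T) w \<inter> geodesic T (origin T) z = geodesic T (origin T) (Vert c))"

definition end_dist :: "nat \<Rightarrow> 'a pointed_tree \<Rightarrow> 'a hat_point \<Rightarrow> 'a hat_point \<Rightarrow> real" where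
  "end_dist p T z w =
     (if z = w then 0 else 1 / real p ^ gdist (adj T) (confluent T z w) (origin T))"

definition hat_topology :: "nat \<Rightarrow> 'a pointed_tree \<Rightarrow> 'a hat_point topology" where
  "hat_topology p T = Metric_space.mtopology (hat_tree T) (end_dist p T)"

section \<open>Horocycles\<close>

definition ref_confluent :: "'a pointed_tree \<Rightarrow> 'a \<Rightarrow> 'a \<Rightarrow> 'a" where
  "ref_confluent T x y =
     (THE b. geodesic T x (End (refend T)) \<inter> geodesic T y (End (refend T)) =
             geodesic T b (End (refend T)))"

definition height :: "'a pointed_tree \<Rightarrow> 'a \<Rightarrow> int" where
  "height T x = (let b = ref_confluent T (origin T) x
                 in int (gdist (adj T) x b) - int (gdist (adj T) (origin T) b))"

definition father :: "'a pointed_tree \<Rightarrow> 'a \<Rightarrow> 'a" where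
  "father T x = (THE y. adj T x y \<and> height T y = height T x - 1)"

text \<open>\<open>HOmega k\<close> is the point \<open>\<omega>\<^sup>k\<close>, where \<open>k\<close> is an integer (\<open>Fin\<close>) or \<open>\<plusminus>\<infinity>\<close> (\<open>Pinf\<close>, \<open>Minf\<close>).\<close>

datatype 'a tilde_point = HVert 'a | HEnd "'a tree_end" | HOmega "int extended"

definition tilde_tree :: "'a pointed_tree \<Rightarrow> 'a tilde_point set" where
  "tilde_tree T = range HVert \<union> HEnd ` (ends (adj T) - {refend T}) \<union> range HOmega"

fun tilde_to_hat :: "'a pointed_tree \<Rightarrow> 'a tilde_point \<Rightarrow> 'a hat_point" where
  "tilde_to_hat T (HVert x) = Vert x"
| "tilde_to_hat T (HEnd \<xi>) = End \<xi>"
| "tilde_to_hat T (HOmega k) = End (refend T)"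

fun tilde_height :: "'a pointed_tree \<Rightarrow> 'a tilde_point \<Rightarrow> int extended" where
  "tilde_height T (HVert x) = Fin (height T x)"
| "tilde_height T (HEnd \<xi>) = Pinf"
| "tilde_height T (HOmega k) = k"

text \<open>The map \<open>k \<mapsto> k / (1 + \<bar>k\<bar>)\<close> on the extended integers.\<close>

fun squash :: "int extended \<Rightarrow> real" where
  "squash (Fin k) = of_int k / (1 + \<bar>of_int k\<bar>)"
| "squash Pinf = 1"
| "squash Minf = -1"

definition tilde_dist :: "nat \<Rightarrow> 'a pointed_tree \<Rightarrow> 'a tilde_point \<Rightarrow> 'a tilde_point \<Rightarrow> real" where
  "tilde_dist p T z w = end_dist p T (tilde_to_hat T z) (tilde_to_hat T w)
     + \<bar>squash (tilde_height T z) - squash (tilde_height T w)\<bar>"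

definition tilde_topology :: "nat \<Rightarrow> 'a pointed_tree \<Rightarrow> 'a tilde_point topology" where
  "tilde_topology p T = Metric_space.mtopology (tilde_tree T) (tilde_dist p T)"

section \<open>Diestel-Leader graphs\<close>

text \<open>Only the vertex set is needed: adjacency is not used by the random walk or by the
  compactifications.\<close>

definition DL :: "'a pointed_tree \<Rightarrow> 'b pointed_tree \<Rightarrow> ('a \<times> 'b) set" where
  "DL T1 T2 = {(x1, x2). height T1 x1 + height T2 x2 = 0}"

definition DL_root :: "'a pointed_tree \<Rightarrow> 'b pointed_tree \<Rightarrow> 'a \<times> 'b" where
  "DL_root T1 T2 = (origin T1, origin T2)"

definition hat_embed :: "'a \<times> 'b \<Rightarrow> 'a hat_point \<times> 'b hat_point" where
  "hat_embed = map_prod Vert Vert"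

definition tilde_embed :: "'a \<times> 'b \<Rightarrow> 'a tilde_point \<times> 'b tilde_point" where
  "tilde_embed = map_prod HVert HVert"

definition geometric_compactification ::
  "nat \<Rightarrow> nat \<Rightarrow> 'a pointed_tree \<Rightarrow> 'b pointed_tree \<Rightarrow> ('a hat_point \<times> 'b hat_point) topology" where
  "geometric_compactification q r T1 T2 =
     (let X = prod_topology (hat_topology q T1) (hat_topology r T2)
      in subtopology X (X closure_of (hat_embed ` DL T1 T2)))"

definition horocyclic_compactification ::
  "nat \<Rightarrow> nat \<Rightarrow> 'a pointed_tree \<Rightarrow> 'b pointed_tree \<Rightarrow> ('a tilde_point \<times> 'b tilde_point) topology" where
  "horocyclic_compactification q r T1 T2 =
     (let X = prod_topology (tilde_topology q T1) (tilde_topology r T2)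
      in subtopology X (X closure_of (tilde_embed ` DL T1 T2)))"

definition DL_walk ::
  "nat \<Rightarrow> nat \<Rightarrow> 'a pointed_tree \<Rightarrow> 'b pointed_tree \<Rightarrow> real \<Rightarrow> 'a \<times> 'b \<Rightarrow> 'a \<times> 'b \<Rightarrow> real" where
  "DL_walk q r T1 T2 \<alpha> x y =
     (if father T1 (fst y) = fst x \<and> snd y = father T2 (snd x) then \<alpha> / real q
      else if fst y = father T1 (fst x) \<and> father T2 (snd y) = snd x then (1 - \<alpha>) / real r
      else 0)"

section \<open>Markov kernels and the Martin compactification\<close>

primrec nstep :: "'v set \<Rightarrow> ('v \<Rightarrow> 'v \<Rightarrow> real) \<Rightarrow> nat \<Rightarrow> 'v \<Rightarrow> 'v \<Rightarrow> real" where
  "nstep V P 0 x y = of_bool (x = y)"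
| "nstep V P (Suc n) x y = (\<Sum>\<^sub>\<infinity>z\<in>V. P x z * nstep V P n z y)"

text \<open>For an irreducible kernel the value does not depend on \<open>x\<close> and \<open>y\<close>.\<close>

definition spectral_radius :: "'v set \<Rightarrow> ('v \<Rightarrow> 'v \<Rightarrow> real) \<Rightarrow> 'v \<Rightarrow> 'v \<Rightarrow> ereal" where
  "spectral_radius V P x y = limsup (\<lambda>n. ereal (root n (nstep V P n x y)))"

definition Green :: "'v set \<Rightarrow> ('v \<Rightarrow> 'v \<Rightarrow> real) \<Rightarrow> real \<Rightarrow> 'v \<Rightarrow> 'v \<Rightarrow> real" where
  "Green V P t x y = (\<Sum>n. nstep V P n x y / t ^ n)"

definition Martin_kernel ::
  "'v set \<Rightarrow> ('v \<Rightarrow> 'v \<Rightarrow> real) \<Rightarrow> 'v \<Rightarrow> real \<Rightarrow> 'v \<Rightarrow> 'v \<Rightarrow> real" where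
  "Martin_kernel V P x0 t x y = Green V P t x y / Green V P t x0 y"

text \<open>\<open>X\<close> is a metrizable compactification, via the embedding \<open>e\<close>, of the set \<open>V\<close> with its
  discrete topology.\<close>

definition discrete_compactification :: "'v set \<Rightarrow> 'c topology \<Rightarrow> ('v \<Rightarrow> 'c) \<Rightarrow> bool" where
  "discrete_compactification V X e \<longleftrightarrow>
     compact_space X \<and> metrizable_space X \<and>
     inj_on e V \<and> e ` V \<subseteq> topspace X \<and> X closure_of (e ` V) = topspace X \<and>
     subtopology X (e ` V) = discrete_topology (e ` V)"

definition extends_continuously ::
  "'v set \<Rightarrow> 'c topology \<Rightarrow> ('v \<Rightarrow> 'c) \<Rightarrow> ('v \<Rightarrow> real) \<Rightarrow> bool" where
  "extends_continuously V X e f \<longleftrightarrow>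
     (\<exists>F. continuous_map X euclideanreal F \<and> (\<forall>y\<in>V. F (e y) = f y))"

text \<open>\<open>X\<close> is smaller than \<open>Y\<close> if the identity on \<open>V\<close> extends to a continuous map from \<open>Y\<close>
  to \<open>X\<close>.\<close>

definition smaller_compactification ::
  "'v set \<Rightarrow> 'c topology \<Rightarrow> ('v \<Rightarrow> 'c) \<Rightarrow> 'd topology \<Rightarrow> ('v \<Rightarrow> 'd) \<Rightarrow> bool" where
  "smaller_compactification V X e Y e' \<longleftrightarrow>
     (\<exists>g. continuous_map Y X g \<and> (\<forall>y\<in>V. g (e' y) = e y))"

text \<open>The competing compactifications \<open>Y\<close> range over all topologies on subsets of a type
  \<open>'d\<close>. As HOL cannot quantify over types inside a formula, this type is a parameter;
  a theorem for arbitrary \<open>'d\<close> asserts minimality among all metrizable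
  compactifications. Minimality determines \<open>X\<close> up to a homeomorphism extending the
  identity on \<open>V\<close>.\<close>

definition is_Martin_compactification ::
  "'d itself \<Rightarrow> 'v set \<Rightarrow> ('v \<Rightarrow> 'v \<Rightarrow> real) \<Rightarrow> 'v \<Rightarrow> real \<Rightarrow> 'c topology \<Rightarrow> ('v \<Rightarrow> 'c) \<Rightarrow> bool" where
  "is_Martin_compactification _ V P x0 t X e \<longleftrightarrow>
     discrete_compactification V X e \<and>
     (\<forall>x\<in>V. extends_continuously V X e (Martin_kernel V P x0 t x)) \<and>
     (\<forall>(Y :: 'd topology) e'.
        discrete_compactification V Y e' \<and>
        (\<forall>x\<in>V. extends_continuously V Y e' (Martin_kernel V P x0 t x)) \<longrightarrow>
        smaller_compactification V X e Y e')"

end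

theory Submission
  imports Defs
begin

text \<open>Write \<open>t = c \<rho>\<close> with \<open>\<rho> = 2 \<surd>(\<alpha> (1 - \<alpha>))\<close>. Conjugation by a power of \<open>\<surd>((1 - \<alpha>) / \<alpha>)\<close>
  reduces \<open>P\<^sub>\<alpha>\<close> to a multiple of the operator \<open>Q\<close>, twice the walk with \<open>\<alpha> = 1 / 2\<close>. Its Green
  function at \<open>x, y\<close> depends only on the heights \<open>i, k\<close> of \<open>x\<^sub>1, y\<^sub>1\<close> and on the heights
  \<open>m\<^sub>0, M\<^sub>0\<close> of the confluents in the two trees. Summing over the minimal and maximal height \<open>m \<le> m\<^sub>0\<close>,
  \<open>M \<ge> M\<^sub>0\<close> of a path gives a double series whose terms \<open>q\<^sup>m r\<^sup>-\<^sup>M D(m, M, i, k)\<close> come from walks on an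
  interval of integers, so they are explicit in Chebyshev-like polynomials \<open>S\<close>; one verifies directly
  that this series is harmonic for \<open>Q\<close> off \<open>y\<close>.

  If \<open>y\<close> leaves every finite set and \<open>y\<^sub>1\<close> tends to a point other than \<open>\<omega>\<^sub>1\<close>, then \<open>y\<^sub>2\<close> tends to
  \<open>\<omega>\<^sub>2\<close>; by dominated convergence the Martin kernels converge, and at fixed height the limit is
  strictly increasing in the height of the confluent of \<open>x\<^sub>1\<close> with the limit point, which
  determines that point. If \<open>y\<^sub>1 \<rightarrow> \<omega>\<^sub>1\<close> and \<open>y\<^sub>2 \<rightarrow> \<omega>\<^sub>2\<close>, each term of the series has quotient tending
  to the same limit, a convex combination of \<open>e\<^sup>i\<close> and \<open>e\<^sup>-\<^sup>i\<close> with \<open>e = c + \<surd>(c\<^sup>2 - 1)\<close> and weights depending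
  on the limit of the height \<open>k\<close>. For \<open>c > 1\<close> these weights distinguish all horocycle indices; for \<open>c = 1\<close>
  the limit is constant and the indices collapse to a single point. Finally, a compactification
  is the Martin compactification once the kernels extend to it and separate its boundary points.\<close>

section \<open>Geodesics and ends of trees\<close>

text \<open>The height of a \<open>Q\<close>-path is a walk with weight 1 for each step up or down.
  If its minimum is m, the path has visited the ancestor of x1 at height m, and its last vertex, at
  height k, is uniform among the q^(k-m) descendants of that ancestor; it can be y1 only if m \<le>
  m0. The second tree contributes r^(k-M) independently. This is the weight q^m r^(-M), up to a
  factor depending on k alone. For paths confined to the interval from m to M, the operator 2c minus
  both unit shifts has Green function S(i-m+1) S(M+1-k) / S(M-m+2), i \<le> k. Its second difference
  in m and M isolates the paths with exactly these extremes; by \<open>S_prod\<close> it is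
  \<open>D\<close>. Path counting stays heuristic: the closed form is checked against the equation
  2c u = Q u + source. Such an equation has other solutions too, so the remainder of the Neumann
  series must be controlled. For c > 1 boundedness of the candidate suffices; c = 1 is reached from
  the right by monotonicity and continuity in c.\<close>

locale tree_graph =
  fixes E :: "'a \<Rightarrow> 'a \<Rightarrow> bool"
  assumes tree: "is_tree E"
begin

abbreviation d :: "'a \<Rightarrow> 'a \<Rightarrow> nat" where "d \<equiv> gdist E"

lemma adj_sym: "E x y \<Longrightarrow> E y x"
  using tree by (auto simp: is_tree_def dest: sympD)

lemma adj_irrefl: "\<not> E x x"
  using tree by (auto simp: is_tree_def dest: irreflpD)

lemma relpow_gdist: "(E ^^ d x y) x y"
proof -
  have "E\<^sup>*\<^sup>* x y" using tree by (simp add: is_tree_def)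
  then obtain n where "(E ^^ n) x y" by (auto dest: rtranclp_imp_relpowp)
  then show ?thesis unfolding gdist_def by (rule LeastI)
qed

lemma gdist_le: "(E ^^ n) x y \<Longrightarrow> d x y \<le> n"
  unfolding gdist_def by (rule Least_le)

lemma gdist_self [simp]: "d x x = 0"
  using gdist_le[of 0 x x] by simp

lemma gdist_eq_0 [simp]: "d x y = 0 \<longleftrightarrow> x = y"
  using relpow_gdist[of x y] by (cases "d x y = 0") auto

lemma gdist_triangle: "d x z \<le> d x y + d y z"
  using relpow_gdist[of x y] relpow_gdist[of y z]
  by (intro gdist_le) (auto simp: relpowp_add)

lemma gdist_commute: "d x y = d y x"
proof -
  have "(E ^^ n) y x" if "(E ^^ n) x y" for n x y
    using that
  proof (induction n arbitrary: x)
    case (Suc n)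
    from relpowp_Suc_D2[OF Suc.prems] obtain z where "E x z" "(E ^^ n) z y" by blast
    with Suc.IH[of z] adj_sym[of x z] show ?case by (auto intro!: relpowp_Suc_I)
  qed auto
  from this[OF relpow_gdist] show ?thesis by (intro antisym gdist_le)
qed

lemma gdist_adj: "E x y \<Longrightarrow> d x y = 1"
  using gdist_le[of 1 x y] gdist_eq_0[of x y] adj_irrefl[of x] by (cases "d x y") auto

lemma adj_iff_gdist: "E x y \<longleftrightarrow> d x y = 1"
  using gdist_adj relpow_gdist[of x y] by auto

lemma gdist_adj_le: "E y z \<Longrightarrow> d x z \<le> d x y + 1"
  using gdist_triangle[of x z y] gdist_adj[of y z] by simp

lemma gdist_Suc_obtain:
  assumes "d x z = Suc n"
  obtains y where "E y z" "d x y = n"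
proof -
  from relpow_gdist[of x z] assms obtain y where y: "(E ^^ n) x y" "E y z"
    by (auto elim: relpowp_Suc_E)
  with gdist_le[OF y(1)] gdist_adj_le[OF y(2), of x] assms show ?thesis
    by (intro that[of y]) auto
qed

lemma distinct_path:
  assumes "R\<^sup>*\<^sup>* x y"
  shows "\<exists>xs. xs \<noteq> [] \<and> hd xs = x \<and> last xs = y \<and> distinct xs \<and> successively R xs"
  using assms
proof (induction rule: rtranclp_induct)
  case base
  then show ?case by (intro exI[of _ "[x]"]) auto
next
  case (step y z)
  then obtain xs where xs: "xs \<noteq> []" "hd xs = x" "last xs = y" "distinct xs" "successively R xs"
    by blast
  show ?case
  proof (cases "z \<in> set xs")
    case True
    then obtain us vs where "xs = us @ z # vs" by (auto dest: split_list)
    with xs show ?thesis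
      by (intro exI[of _ "us @ [z]"]) (auto simp: successively_append_iff hd_append split: if_splits)
  next
    case False
    with xs step show ?thesis
      by (intro exI[of _ "xs @ [z]"]) (auto simp: successively_append_iff)
  qed
qed

text \<open>Otherwise a simple path from \<open>y\<close> to \<open>y'\<close> that misses
  \<open>x\<close>, closed up through \<open>x\<close>, is a cycle with at least three vertices. All
  later uses of acyclicity go through this lemma.\<close>

lemma no_detour:
  assumes "E x y" "E x y'" "(\<lambda>a b. E a b \<and> a \<noteq> x \<and> b \<noteq> x)\<^sup>*\<^sup>* y y'"
  shows "y = y'"
proof (rule ccontr)
  assume ne: "y \<noteq> y'"
  from distinct_path[OF assms(3)] obtain xs where xs: "xs \<noteq> []" "hd xs = y" "last xs = y'"
    "distinct xs" "successively (\<lambda>a b. E a b \<and> a \<noteq> x \<and> b \<noteq> x) xs" by blast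
  obtain zs z1 z2 where xs': "xs = z1 # z2 # zs" using xs ne by (cases xs rule: remdups_adj.cases) auto
  have "z \<noteq> x" if "z \<in> set xs" for z
  proof -
    have "z \<in> set ws \<Longrightarrow> successively (\<lambda>a b. E a b \<and> a \<noteq> x \<and> b \<noteq> x) (w # w' # ws) \<Longrightarrow> z \<noteq> x"
      for w w' ws by (induction ws arbitrary: w w') auto
    with xs(5) that show ?thesis unfolding xs' by auto
  qed
  then have "x \<notin> set xs" by blast
  moreover have "successively E xs" using xs(5) by (rule successively_mono) auto
  ultimately have "length (x # xs) \<ge> 3 \<and> distinct (x # xs) \<and> successively E (x # xs)
      \<and> E (last (x # xs)) (hd (x # xs))"
    using xs assms(1,2) adj_sym[of x y'] xs' by (auto simp: successively_Cons)
  with tree show False unfolding is_tree_def by blast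
qed

text \<open>Every vertex after \<open>y\<close> on a shortest path to \<open>o'\<close> is strictly
  closer to \<open>o'\<close> than \<open>y\<close>, hence than \<open>x\<close>.\<close>

lemma avoiding_path:
  assumes "y \<noteq> x" "d o' y \<le> d o' x"
  shows "(\<lambda>a b. E a b \<and> a \<noteq> x \<and> b \<noteq> x)\<^sup>*\<^sup>* y o'"
  using assms
proof (induction "d o' y" arbitrary: y)
  case 0
  then show ?case by simp
next
  case (Suc n)
  from Suc.hyps(2)[symmetric] obtain z where z: "E z y" "d o' z = n" by (rule gdist_Suc_obtain)
  have "z \<noteq> x" using z Suc by auto
  with Suc.hyps(1)[of z] z Suc have "(\<lambda>a b. E a b \<and> a \<noteq> x \<and> b \<noteq> x)\<^sup>*\<^sup>* z o'" by auto
  with z \<open>z \<noteq> x\<close> Suc.prems adj_sym show ?case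
    by (intro converse_rtranclp_into_rtranclp[of _ y z]) auto
qed

text \<open>Both neighbours reach \<open>o'\<close> without passing through \<open>x\<close>, so
  they are joined by a path avoiding \<open>x\<close>. The inequalities are weak in order to rule
  out a second neighbour at the same distance as \<open>x\<close>, as
  \<open>nonbacktracking_gdist\<close> requires.\<close>

lemma unique_closer:
  assumes "E x y" "E x y'" "d o' y \<le> d o' x" "d o' y' \<le> d o' x"
  shows "y = y'"
proof (rule no_detour[OF assms(1,2)])
  let ?R = "\<lambda>a b. E a b \<and> a \<noteq> x \<and> b \<noteq> x"
  have "y \<noteq> x" "y' \<noteq> x" using assms adj_irrefl by auto
  then have 1: "?R\<^sup>*\<^sup>* y o'" and 2: "?R\<^sup>*\<^sup>* y' o'" using assms by (auto intro: avoiding_path)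
  have "symp ?R" by (auto intro!: sympI simp: adj_sym)
  then have "symp ?R\<^sup>*\<^sup>*" by (rule symp_rtranclp)
  then have "?R\<^sup>*\<^sup>* o' y'" using 2 by (rule sympD)
  with 1 show "?R\<^sup>*\<^sup>* y y'" by (rule rtranclp_trans)
qed

text \<open>The induction carries two consecutive distances: a step that failed to move away from
  the start would have to return to the unique neighbour closer to it.\<close>

lemma nonbacktracking_gdist:
  assumes "\<And>n. E (\<pi> n) (\<pi> (Suc n))" "\<And>n. \<pi> (Suc (Suc n)) \<noteq> \<pi> n"
  shows "d (\<pi> 0) (\<pi> n) = n"
proof -
  have "d (\<pi> 0) (\<pi> n) = n \<and> d (\<pi> 0) (\<pi> (Suc n)) = Suc n"
  proof (induction n)
    case 0
    show ?case using assms(1)[of 0] gdist_adj by simp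
  next
    case (Suc n)
    have "d (\<pi> 0) (\<pi> (Suc (Suc n))) \<le> Suc (Suc n)"
      using Suc gdist_adj_le[OF assms(1), of "\<pi> 0" "Suc n"] by simp
    moreover have "\<not> d (\<pi> 0) (\<pi> (Suc (Suc n))) \<le> Suc n"
    proof
      assume "d (\<pi> 0) (\<pi> (Suc (Suc n))) \<le> Suc n"
      then have "\<pi> (Suc (Suc n)) = \<pi> n"
        using Suc assms(1) adj_sym by (intro unique_closer[of "\<pi> (Suc n)" _ _ "\<pi> 0"]) auto
      with assms(2) show False by blast
    qed
    ultimately show ?case using Suc by auto
  qed
  then show ?thesis ..
qed

text \<open>A local test for rays, which makes it easy to prepend a vertex or to drop the first
  one.\<close>

lemma rays_iff:
  "\<pi> \<in> rays E \<longleftrightarrow> (\<forall>n. E (\<pi> n) (\<pi> (Suc n))) \<and> (\<forall>n. \<pi> (Suc (Suc n)) \<noteq> \<pi> n)"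
proof
  assume \<pi>: "\<pi> \<in> rays E"
  then have *: "d (\<pi> m) (\<pi> n) = n - m" if "m \<le> n" for m n using that by (auto simp: rays_def)
  show "(\<forall>n. E (\<pi> n) (\<pi> (Suc n))) \<and> (\<forall>n. \<pi> (Suc (Suc n)) \<noteq> \<pi> n)"
  proof (intro conjI allI notI)
    show "E (\<pi> n) (\<pi> (Suc n))" for n using *[of n "Suc n"] by (simp add: adj_iff_gdist)
    show False if "\<pi> (Suc (Suc n)) = \<pi> n" for n using *[of n "Suc (Suc n)"] that by simp
  qed
next
  assume a: "(\<forall>n. E (\<pi> n) (\<pi> (Suc n))) \<and> (\<forall>n. \<pi> (Suc (Suc n)) \<noteq> \<pi> n)"
  have "d (\<pi> m) (\<pi> n) = n - m" if "m \<le> n" for m n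
    using nonbacktracking_gdist[of "\<lambda>k. \<pi> (m + k)" "n - m"] a that by simp
  then show "\<pi> \<in> rays E" by (auto simp: rays_def)
qed

lemma ray_gdist: "\<pi> \<in> rays E \<Longrightarrow> m \<le> n \<Longrightarrow> d (\<pi> m) (\<pi> n) = n - m"
  by (auto simp: rays_def)

lemma ray_inj: "\<pi> \<in> rays E \<Longrightarrow> inj \<pi>"
proof (rule injI)
  fix m n assume \<pi>: "\<pi> \<in> rays E" "\<pi> m = \<pi> n"
  show "m = n"
  proof (cases "m \<le> n")
    case True
    from ray_gdist[OF \<pi>(1) True] \<pi>(2) True show ?thesis by simp
  next
    case False
    with ray_gdist[OF \<pi>(1), of n m] \<pi>(2) show ?thesis by simp
  qed
qed

text \<open>Descending from a common vertex far out to the common starting point, the two rays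
  agree because every vertex has only one neighbour closer to that starting point.\<close>

lemma ray_agree_down:
  assumes "\<pi> \<in> rays E" "\<sigma> \<in> rays E" "\<pi> 0 = \<sigma> 0" "\<pi> n = \<sigma> n" "m \<le> n"
  shows "\<pi> m = \<sigma> m"
  using assms(4,5)
proof (induction n)
  case (Suc n)
  have "\<pi> n = \<sigma> n"
  proof (rule unique_closer[of "\<pi> (Suc n)" _ _ "\<pi> 0"])
    show "E (\<pi> (Suc n)) (\<pi> n)" "E (\<pi> (Suc n)) (\<sigma> n)"
      using assms(1,2) adj_sym Suc.prems unfolding rays_iff by metis+
    show "d (\<pi> 0) (\<pi> n) \<le> d (\<pi> 0) (\<pi> (Suc n))" "d (\<pi> 0) (\<sigma> n) \<le> d (\<pi> 0) (\<pi> (Suc n))"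
      using ray_gdist[OF assms(1), of 0] ray_gdist[OF assms(2), of 0] assms(3) by auto
  qed
  with Suc show ?case by (cases "m = Suc n") auto
qed auto

section \<open>Ends as classes of rays\<close>

lemma ray_equiv_trans:
  assumes "(\<pi>, \<sigma>) \<in> ray_equiv E" "(\<sigma>, \<tau>) \<in> ray_equiv E"
  shows "(\<pi>, \<tau>) \<in> ray_equiv E"
proof -
  have "finite (((range \<pi> - range \<sigma>) \<union> (range \<sigma> - range \<pi>)) \<union> ((range \<sigma> - range \<tau>) \<union> (range \<tau> - range \<sigma>)))"
    using assms by (auto simp: ray_equiv_def)
  then have "finite ((range \<pi> - range \<tau>) \<union> (range \<tau> - range \<pi>))"
    by (rule finite_subset[rotated]) blast
  with assms show ?thesis by (auto simp: ray_equiv_def)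
qed

lemma ray_equiv_sym: "(\<pi>, \<sigma>) \<in> ray_equiv E \<Longrightarrow> (\<sigma>, \<pi>) \<in> ray_equiv E"
  by (auto simp: ray_equiv_def Un_commute)

lemma ray_equiv_refl: "\<pi> \<in> rays E \<Longrightarrow> (\<pi>, \<pi>) \<in> ray_equiv E"
  by (auto simp: ray_equiv_def)

lemma end_equiv: "\<xi> \<in> ends E \<Longrightarrow> \<pi> \<in> \<xi> \<Longrightarrow> \<sigma> \<in> \<xi> \<longleftrightarrow> (\<pi>, \<sigma>) \<in> ray_equiv E"
  unfolding ends_def by (auto elim!: quotientE intro: ray_equiv_trans ray_equiv_sym)

lemma end_rays: "\<xi> \<in> ends E \<Longrightarrow> \<pi> \<in> \<xi> \<Longrightarrow> \<pi> \<in> rays E"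
  unfolding ends_def by (auto elim!: quotientE simp: ray_equiv_def)

lemma end_nonempty: "\<xi> \<in> ends E \<Longrightarrow> \<exists>\<pi>. \<pi> \<in> \<xi>"
  unfolding ends_def by (auto elim!: quotientE intro: ray_equiv_refl)

lemma end_of_ray: "\<pi> \<in> rays E \<Longrightarrow> ray_equiv E `` {\<pi>} \<in> ends E \<and> \<pi> \<in> ray_equiv E `` {\<pi>}"
  unfolding ends_def by (auto intro: quotientI ray_equiv_refl)

lemma end_eqI: "\<xi> \<in> ends E \<Longrightarrow> \<xi>' \<in> ends E \<Longrightarrow> \<pi> \<in> \<xi> \<Longrightarrow> \<pi> \<in> \<xi>' \<Longrightarrow> \<xi> = \<xi>'"
  using end_equiv by blast

text \<open>The two shifts allow tails to be matched after different numbers of initial vertices, as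
  happens when the starting point moves along an edge.\<close>

lemma end_tailI:
  assumes "\<xi> \<in> ends E" "\<pi> \<in> \<xi>" "\<sigma> \<in> rays E" "\<And>n. \<pi> (a + n) = \<sigma> (b + n)"
  shows "\<sigma> \<in> \<xi>"
proof -
  have "range \<pi> - range \<sigma> \<subseteq> \<pi> ` {..<a}"
  proof clarify
    fix n assume "\<pi> n \<notin> range \<sigma>"
    then have "n < a" using assms(4)[of "n - a"] by (cases "n < a") auto
    then show "\<pi> n \<in> \<pi> ` {..<a}" by auto
  qed
  moreover have "range \<sigma> - range \<pi> \<subseteq> \<sigma> ` {..<b}"
  proof clarify
    fix n assume "\<sigma> n \<notin> range \<pi>"
    then have "n < b" using assms(4)[of "n - b"] by (cases "n < b") (auto, metis rangeI)
    then show "\<sigma> n \<in> \<sigma> ` {..<b}" by auto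
  qed
  ultimately have "finite ((range \<pi> - range \<sigma>) \<union> (range \<sigma> - range \<pi>))"
    by (meson finite_Un finite_imageI finite_lessThan finite_subset)
  then show ?thesis using assms(1-3) end_rays[OF assms(1,2)] end_equiv[OF assms(1,2)]
    by (auto simp: ray_equiv_def)
qed

lemma end_eventually_common:
  assumes "\<xi> \<in> ends E" "\<pi> \<in> \<xi>" "\<sigma> \<in> \<xi>"
  shows "\<forall>\<^sub>F n in sequentially. \<pi> n \<in> range \<sigma>"
proof -
  have "finite (range \<pi> - range \<sigma>)" using end_equiv[OF assms(1,2)] assms(3)
    by (auto simp: ray_equiv_def)
  then have "finite (\<pi> -` (range \<pi> - range \<sigma>))"
    using ray_inj[OF end_rays[OF assms(1,2)]] by (intro finite_vimageI) auto
  moreover have "\<pi> -` (range \<pi> - range \<sigma>) = {n. \<pi> n \<notin> range \<sigma>}" by auto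
  ultimately show ?thesis
    by (auto simp: cofinite_eq_sequentially[symmetric] eventually_cofinite)
qed

lemma end_ray_unique:
  assumes "\<xi> \<in> ends E" "\<pi> \<in> \<xi>" "\<sigma> \<in> \<xi>" "\<pi> 0 = \<sigma> 0"
  shows "\<pi> = \<sigma>"
proof
  fix m
  note r = end_rays[OF assms(1,2)] end_rays[OF assms(1,3)]
  have "\<forall>\<^sub>F n in sequentially. m \<le> n \<and> \<pi> n \<in> range \<sigma>"
    by (rule eventually_conj[OF eventually_ge_at_top end_eventually_common[OF assms(1-3)]])
  then obtain n where "m \<le> n" "\<pi> n \<in> range \<sigma>"
    by (auto simp: eventually_sequentially)
  then obtain n' where n': "\<pi> n = \<sigma> n'" by auto
  have "n = n'" using ray_gdist[OF r(1), of 0 n] ray_gdist[OF r(2), of 0 n'] n' assms(4) by simp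
  with n' \<open>m \<le> n\<close> show "\<pi> m = \<sigma> m" using ray_agree_down[OF r assms(4)] by simp
qed

text \<open>Moving the starting point along an edge either drops the first vertex of the ray, if
  this edge is its first one, or prepends the new vertex.\<close>

lemma end_ray_exists:
  assumes "\<xi> \<in> ends E"
  shows "\<exists>\<pi>\<in>\<xi>. \<pi> 0 = x"
proof -
  obtain \<sigma> where \<sigma>: "\<sigma> \<in> \<xi>" using end_nonempty[OF assms] by blast
  have "E\<^sup>*\<^sup>* (\<sigma> 0) x" using tree by (simp add: is_tree_def)
  then show ?thesis
  proof (induction rule: rtranclp_induct)
    case base
    then show ?case using \<sigma> by blast
  next
    case (step y z)
    then obtain \<pi> where \<pi>: "\<pi> \<in> \<xi>" "\<pi> 0 = y" by blast
    note r = end_rays[OF assms \<pi>(1)]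
    show ?case
    proof (cases "\<pi> 1 = z")
      case True
      have "(\<lambda>n. \<pi> (Suc n)) \<in> rays E" using r by (auto simp: rays_iff)
      then have "(\<lambda>n. \<pi> (Suc n)) \<in> \<xi>"
        by (rule end_tailI[OF assms \<pi>(1), where a = 1 and b = 0]) simp
      with True show ?thesis by (intro bexI[of _ "\<lambda>n. \<pi> (Suc n)"]) auto
    next
      case False
      let ?\<tau> = "case_nat z \<pi>"
      have "?\<tau> \<in> rays E" unfolding rays_iff
      proof (intro conjI allI)
        show "E (?\<tau> n) (?\<tau> (Suc n))" for n
          using r step(2) \<pi>(2) adj_sym by (cases n) (auto simp: rays_iff)
        show "?\<tau> (Suc (Suc n)) \<noteq> ?\<tau> n" for n
          using r False by (cases n) (auto simp: rays_iff)
      qed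
      then have "?\<tau> \<in> \<xi>" by (rule end_tailI[OF assms \<pi>(1), where a = 0 and b = 1]) simp
      then show ?thesis by (intro bexI[of _ ?\<tau>]) auto
    qed
  qed
qed

definition eray :: "'a tree_end \<Rightarrow> 'a \<Rightarrow> nat \<Rightarrow> 'a" where
  "eray \<xi> x = (THE \<pi>. \<pi> \<in> \<xi> \<and> \<pi> 0 = x)"

lemma eray_eqI: "\<xi> \<in> ends E \<Longrightarrow> \<pi> \<in> \<xi> \<Longrightarrow> \<pi> 0 = x \<Longrightarrow> eray \<xi> x = \<pi>"
  unfolding eray_def by (rule the_equality, blast, metis end_ray_unique)

lemma
  assumes "\<xi> \<in> ends E"
  shows eray_in: "eray \<xi> x \<in> \<xi>" and eray_0 [simp]: "eray \<xi> x 0 = x"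
proof -
  obtain \<pi> where \<pi>: "\<pi> \<in> \<xi>" "\<pi> 0 = x" using end_ray_exists[OF assms, of x] by blast
  show "eray \<xi> x \<in> \<xi>" "eray \<xi> x 0 = x" using \<pi> eray_eqI[OF assms \<pi>] by simp_all
qed

lemma eray_rays: "\<xi> \<in> ends E \<Longrightarrow> eray \<xi> x \<in> rays E"
  by (meson eray_in end_rays)

lemma geodesic_End: "\<xi> \<in> ends E \<Longrightarrow> (\<Union>\<pi>\<in>{\<pi> \<in> \<xi>. \<pi> 0 = x}. range \<pi>) = range (eray \<xi> x)"
proof -
  assume "\<xi> \<in> ends E"
  then have "{\<pi> \<in> \<xi>. \<pi> 0 = x} = {eray \<xi> x}"
    using eray_in[of \<xi> x] eray_0[of \<xi> x] eray_eqI[of \<xi> _ x] by (intro set_eqI) (metis (mono_tags) mem_Collect_eq singletonD singletonI)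
  then show ?thesis by simp
qed

lemma eray_tail: "\<xi> \<in> ends E \<Longrightarrow> eray \<xi> (eray \<xi> x 1) = (\<lambda>n. eray \<xi> x (Suc n))"
proof (rule eray_eqI)
  assume \<xi>: "\<xi> \<in> ends E"
  have "(\<lambda>n. eray \<xi> x (Suc n)) \<in> rays E" using eray_rays[OF \<xi>] by (auto simp: rays_iff)
  then show "(\<lambda>n. eray \<xi> x (Suc n)) \<in> \<xi>"
    by (rule end_tailI[OF \<xi> eray_in[OF \<xi>], where a = 1 and b = 0]) simp
qed auto

text \<open>The tail of a ray is the ray from its second vertex, so an end is encoded by a single
  map, the first step toward it. For the reference end this is the father map.\<close>

lemma eray_funpow: "\<xi> \<in> ends E \<Longrightarrow> eray \<xi> x n = ((\<lambda>y. eray \<xi> y 1) ^^ n) x"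
proof (induction n arbitrary: x)
  case (Suc n)
  have "eray \<xi> x (Suc n) = eray \<xi> (eray \<xi> x 1) n"
    using fun_cong[OF eray_tail[OF Suc.prems, of x], of n] by simp
  also have "\<dots> = ((\<lambda>y. eray \<xi> y 1) ^^ n) (eray \<xi> x 1)"
    by (rule Suc.IH[OF Suc.prems])
  finally show ?case by (simp only: funpow_Suc_right comp_def)
qed simp

lemma eray_common:
  assumes "\<xi> \<in> ends E"
  shows "\<exists>m n. eray \<xi> x m = eray \<xi> y n"
  using eventually_happens[OF end_eventually_common[OF assms eray_in[OF assms] eray_in[OF assms], of x y]]
  by auto

end

section \<open>Horocycles\<close>

text \<open>What the Green function needs of a tree with a reference end: father map and height,
  without adjacency. \<open>common_ancestor\<close> takes the place of connectedness.\<close>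

locale horo =
  fixes f :: "'a \<Rightarrow> 'a" and h :: "'a \<Rightarrow> int" and p :: nat
  assumes h_f [simp]: "h (f x) = h x - 1"
    and finite_children: "finite {y. f y = x}"
    and card_children: "card {y. f y = x} = p"
    and p_ge_2: "p \<ge> 2"
    and common_ancestor: "\<exists>m n. (f ^^ m) x = (f ^^ n) y"
begin

lemma h_funpow [simp]: "h ((f ^^ n) x) = h x - int n"
  by (induction n) auto

text \<open>For \<open>l\<close> above \<open>h x\<close> the truncation by \<open>nat\<close>
  returns \<open>x\<close> itself, so \<open>le_con\<close> has to require \<open>l\<close> to be at
  most both heights.\<close>

definition anc :: "int \<Rightarrow> 'a \<Rightarrow> 'a" where
  "anc l x = (f ^^ nat (h x - l)) x"

text \<open>The height of the confluent of \<open>x\<close> and \<open>y\<close> with respect to the reference end.\<close>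

definition con :: "'a \<Rightarrow> 'a \<Rightarrow> int" where
  "con x y = h x - int (LEAST n. \<exists>m. (f ^^ n) x = (f ^^ m) y)"

lemma h_anc [simp]: "l \<le> h x \<Longrightarrow> h (anc l x) = l"
  by (simp add: anc_def)

lemma anc_self [simp]: "anc (h x) x = x"
  by (simp add: anc_def)

lemma anc_f: "l < h x \<Longrightarrow> anc l (f x) = anc l x"
proof -
  assume "l < h x"
  then have "nat (h x - l) = Suc (nat (h (f x) - l))" by simp
  then show ?thesis unfolding anc_def by (simp only: funpow_Suc_right comp_def)
qed

lemma f_anc: "l \<le> h x \<Longrightarrow> f (anc l x) = anc (l - 1) x"
proof -
  assume "l \<le> h x"
  then have "nat (h x - (l - 1)) = Suc (nat (h x - l))" by simp
  then show ?thesis by (simp add: anc_def)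
qed

text \<open>Equalities between confluent heights are proved below by comparing the integers under
  them, which this lemma describes completely.\<close>

lemma le_con: "l \<le> con x y \<longleftrightarrow> l \<le> h x \<and> l \<le> h y \<and> anc l x = anc l y"
proof -
  define n where "n = (LEAST n. \<exists>m. (f ^^ n) x = (f ^^ m) y)"
  have "\<exists>m. (f ^^ n) x = (f ^^ m) y"
    unfolding n_def by (rule LeastI_ex) (rule common_ancestor)
  then obtain m where m: "(f ^^ n) x = (f ^^ m) y" by blast
  then have hm: "h x - int n = h y - int m" using h_funpow by metis
  have con: "con x y = h x - int n" by (simp add: con_def n_def)
  show ?thesis
  proof
    assume l: "l \<le> con x y"
    then have 1: "nat (h x - l) = nat (h x - int n - l) + n" "nat (h y - l) = nat (h x - int n - l) + m"
      using hm con by auto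
    have "anc l x = anc l y" unfolding anc_def 1 by (simp add: funpow_add m)
    then show "l \<le> h x \<and> l \<le> h y \<and> anc l x = anc l y" using l con hm by auto
  next
    assume l: "l \<le> h x \<and> l \<le> h y \<and> anc l x = anc l y"
    then have "n \<le> nat (h x - l)" unfolding n_def anc_def by (intro Least_le) auto
    then show "l \<le> con x y" using con l by auto
  qed
qed

lemma con_le1: "con x y \<le> h x" and con_le2: "con x y \<le> h y"
  and anc_con: "l \<le> con x y \<Longrightarrow> anc l x = anc l y"
  using le_con[of "con x y" x y] le_con[of l x y] by auto

lemma con_commute: "con x y = con y x"
proof -
  have "l \<le> con x y \<longleftrightarrow> l \<le> con y x" for l by (auto simp: le_con)
  then show ?thesis by (intro antisym) blast+
qed

lemma con_self [simp]: "con x x = h x"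
  using con_le1[of x x] le_con[of "h x" x x] by auto

lemma con_ultra: "l \<le> con x y \<Longrightarrow> l \<le> con y z \<Longrightarrow> l \<le> con x z"
  by (simp add: le_con)

text \<open>The isosceles property of an ultrametric.\<close>

lemma con_eq_min: "con x y \<noteq> con y z \<Longrightarrow> con x z = min (con x y) (con y z)"
proof -
  assume ne: "con x y \<noteq> con y z"
  have "con y z \<le> con x y \<Longrightarrow> con y z \<le> con x z" "con x y \<le> con y z \<Longrightarrow> con x y \<le> con x z"
    using con_ultra[of _ x y z] by auto
  moreover have "l \<le> con x y \<Longrightarrow> l \<le> con x z \<Longrightarrow> l \<le> con y z" for l
    using con_ultra[of l y x z] by (simp only: con_commute[of y x])
  moreover have "l \<le> con x z \<Longrightarrow> l \<le> con y z \<Longrightarrow> l \<le> con x y" for l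
    using con_ultra[of l x z y] by (simp only: con_commute[of z y])
  ultimately show ?thesis using ne by (smt (verit, best))
qed

lemma con_eqI: "con x y < con y z \<Longrightarrow> con x z = con x y"
proof -
  assume *: "con x y < con y z"
  then have "con x y \<noteq> con y z" by simp
  from con_eq_min[OF this] * show ?thesis by simp
qed

lemma con_f: "con (f x) y = min (con x y) (h x - 1)"
proof -
  have "l \<le> con (f x) y \<longleftrightarrow> l \<le> min (con x y) (h x - 1)" for l
    by (auto simp: le_con anc_f)
  then show ?thesis by (intro antisym) blast+
qed

lemma con_eq_h: "con x y = h x \<longleftrightarrow> h x \<le> h y \<and> anc (h x) y = x"
proof -
  have "con x y = h x \<longleftrightarrow> h x \<le> con x y" using con_le1[of x y] by linarith
  also have "\<dots> \<longleftrightarrow> h x \<le> h y \<and> anc (h x) y = x" unfolding le_con[of "h x"] by auto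
  finally show ?thesis .
qed

lemma con_child_lt: "f z = x \<Longrightarrow> con x y < h x \<Longrightarrow> con z y = con x y"
  using con_f[of z y] h_f[of z] by auto

lemma con_child_eq:
  assumes "f z = x" "con x y = h x" "h x < h y"
  shows "con z y = (if z = anc (h x + 1) y then h x + 1 else h x)"
proof -
  have hz: "h z = h x + 1" using assms(1) h_f[of z] by simp
  have 1: "h x \<le> con z y" "con z y \<le> h z" using con_f[of z y] assms con_le1[of z y] by auto
  moreover have "h z \<le> con z y \<longleftrightarrow> z = anc (h x + 1) y"
    using le_con[of "h z" z y] anc_self[of z] assms hz by auto
  ultimately show ?thesis using hz by auto
qed

lemma con_child_self: "f z = x \<Longrightarrow> con z x = h x"
  using con_f[of z z] h_f[of z] con_commute[of x z] by auto

lemma con_child_ge: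
  assumes "f z = x" "con x y = h x" "h y = h x" shows "con z y = h x"
  using assms con_child_self con_eq_h[of x y] by (metis anc_self)

lemma f_anc_Suc: "h x < h y \<Longrightarrow> con x y = h x \<Longrightarrow> f (anc (h x + 1) y) = x"
  using f_anc[of "h x + 1" y] con_eq_h[of x y] by auto

lemma children_nonempty: "\<exists>y. f y = x"
  using card_children[of x] p_ge_2 by (metis (mono_tags, lifting) Collect_empty_eq card.empty not_numeral_le_zero)

lemma sibling: "\<exists>x'. x' \<noteq> x \<and> f x' = f x"
proof (rule ccontr)
  assume "\<not> ?thesis"
  then have "{y. f y = f x} = {x}" by auto
  then show False using card_children[of "f x"] p_ge_2 by simp
qed

lemma exists_height: "\<exists>x. h x = l"
proof -
  fix x0 :: 'a
  have up: "\<exists>x. h x = h x0 + int n" for n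
  proof (induction n)
    case (Suc n)
    then obtain x where "h x = h x0 + int n" by blast
    moreover obtain y where "f y = x" using children_nonempty by blast
    ultimately show ?case using h_f[of y] by (intro exI[of _ y]) auto
  qed auto
  show ?thesis
  proof (cases "l \<le> h x0")
    case True then show ?thesis by (intro exI[of _ "anc l x0"]) simp
  next
    case False then show ?thesis using up[of "nat (l - h x0)"] by simp
  qed
qed

lemma sum_children_const:
  "(\<And>z. f z = x \<Longrightarrow> u z = c) \<Longrightarrow> (\<Sum>z\<in>{z. f z = x}. u z) = real p * c"
  by (simp add: card_children)

lemma sum_children_split:
  assumes "f z0 = x" "\<And>z. f z = x \<Longrightarrow> z \<noteq> z0 \<Longrightarrow> u z = c"
  shows "(\<Sum>z\<in>{z. f z = x}. u z) = u z0 + (real p - 1) * c"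
proof -
  have "(\<Sum>z\<in>{z. f z = x}. u z) = u z0 + (\<Sum>z\<in>{z. f z = x} - {z0}. u z)"
    using assms by (intro sum.remove finite_children) auto
  also have "(\<Sum>z\<in>{z. f z = x} - {z0}. u z) = (\<Sum>z\<in>{z. f z = x} - {z0}. c)"
    using assms by (intro sum.cong) auto
  also have "\<dots> = (real p - 1) * c"
    using assms p_ge_2 by (simp add: card_Diff_singleton card_children)
  finally show ?thesis .
qed

lemma finite_descendants: "finite {z. (f ^^ n) z = x}"
proof (induction n arbitrary: x)
  case (Suc n)
  have "{z. (f ^^ Suc n) z = x} = (\<Union>w\<in>{w. f w = x}. {z. (f ^^ n) z = w})" by auto
  then show ?case using Suc finite_children by simp
qed simp

end

locale horo_tree = horo f h p + tree_graph E
  for f :: "'a \<Rightarrow> 'a" and h p and E :: "'a \<Rightarrow> 'a \<Rightarrow> bool" +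
  assumes adj_iff: "E x y \<longleftrightarrow> f x = y \<or> f y = x"
begin

text \<open>The right-hand side changes by at most one along an edge, so it is at most the distance.
  Conversely some neighbour of \<open>x\<close> lowers it by one: the child toward \<open>y\<close>
  if \<open>x\<close> is an ancestor of \<open>y\<close>, and the father otherwise.\<close>

lemma gdist_con: "int (d x y) = h x + h y - 2 * con x y"
proof -
  define D where "D = (\<lambda>x y. h x + h y - 2 * con x y)"
  have step: "D x' y \<le> D x y + 1" if "E x x'" for x x'
  proof -
    have "con x' y = min (con x y) (h x - 1) \<and> h x' = h x - 1
        \<or> con x y = min (con x' y) (h x' - 1) \<and> h x = h x' - 1"
      using that con_f[of x y] con_f[of x' y] h_f[of x] h_f[of x'] by (auto simp: adj_iff)
    then show ?thesis using con_le1[of x y] con_le1[of x' y] by (auto simp: D_def min_def split: if_splits)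
  qed
  have "D x y \<le> int n" if "d y x = n" for n x
    using that
  proof (induction n arbitrary: x)
    case 0
    then show ?case by (auto simp: D_def)
  next
    case (Suc n)
    then obtain x' where "E x' x" "d y x' = n" by (auto elim: gdist_Suc_obtain)
    with Suc.IH[of x'] step[of x' x] show ?case by auto
  qed
  then have 1: "D x y \<le> int (d x y)" by (metis gdist_commute)
  have "int (d x y) \<le> D x y" if "nat (D x y) = n" for n x
    using that
  proof (induction n arbitrary: x)
    case 0
    then have "con x y = h x" "h x = h y" using con_le1[of x y] con_le2[of x y] by (auto simp: D_def)
    then have "x = y" using con_eq_h[of x y] by (metis anc_self)
    then show ?case by (simp add: D_def)
  next
    case (Suc n)
    have "\<exists>x'. E x x' \<and> D x' y = D x y - 1"
    proof (cases "con x y = h x")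
      case True
      with Suc have "h x < h y" by (auto simp: D_def)
      with True show ?thesis
        using con_child_eq[OF f_anc_Suc True] f_anc_Suc
        by (intro exI[of _ "anc (h x + 1) y"]) (auto simp: D_def adj_iff)
    next
      case False
      then have "con x y < h x" using con_le1[of x y] by auto
      then show ?thesis using con_f[of x y]
        by (intro exI[of _ "f x"]) (auto simp: D_def adj_iff)
    qed
    then obtain x' where x': "E x x'" "D x' y = D x y - 1" by blast
    with Suc have "int (d x' y) \<le> D x' y" by (intro Suc.IH) auto
    moreover have "d x y \<le> d x' y + 1"
      using gdist_triangle[of x y x'] gdist_adj[OF x'(1)] by simp
    ultimately show ?case using x' by auto
  qed
  with 1 show ?thesis unfolding D_def by (meson antisym)
qed

end

section \<open>Father map and height of a pointed tree\<close>

declare geodesic.simps [simp del]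

locale pointed =
  fixes T :: "'a pointed_tree" and p :: nat
  assumes pointed: "pointed_homogeneous_tree p T" and p2: "p \<ge> 2"
begin

sublocale tree_graph "adj T"
  using pointed by unfold_locales (simp add: pointed_homogeneous_tree_def homogeneous_tree_def)

lemma refend_in: "refend T \<in> ends (adj T)"
  using pointed by (simp add: pointed_homogeneous_tree_def)

text \<open>\<open>father\<close> is defined through heights, and heights are computed by iterating
  this map; \<open>father_eq\<close> identifies the two afterwards.\<close>

definition fa :: "'a \<Rightarrow> 'a" where "fa x = eray (refend T) x 1"

lemma eray_refend: "eray (refend T) x n = (fa ^^ n) x"
  unfolding fa_def[abs_def] by (rule eray_funpow[OF refend_in])

lemma geodesic_refend: "geodesic T x (End (refend T)) = range (\<lambda>n. (fa ^^ n) x)"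
  using geodesic_End[OF refend_in, of x] by (simp add: geodesic.simps eray_refend[abs_def])

lemma fa_funpow_inj: "(fa ^^ m) x = (fa ^^ n) x \<longleftrightarrow> m = n"
  using ray_inj[OF eray_rays[OF refend_in], of x] by (auto simp: eray_refend[abs_def] dest: injD)

lemma gdist_fa_funpow: "d x ((fa ^^ n) x) = n"
  using ray_gdist[OF eray_rays[OF refend_in], of 0 n x] by (simp add: eray_refend)

text \<open>The two rays to the reference end coincide from their first meeting on, so any common
  vertex yields the height.\<close>

lemma height_eq:
  assumes "(fa ^^ m) x = (fa ^^ n) (origin T)"
  shows "height T x = int m - int n"
proof -
  let ?o = "origin T"
  define m0 where "m0 = (LEAST m. \<exists>n. (fa ^^ m) x = (fa ^^ n) ?o)"
  have "\<exists>n. (fa ^^ m0) x = (fa ^^ n) ?o" unfolding m0_def by (rule LeastI) (use assms in blast)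
  then obtain n0 where n0: "(fa ^^ m0) x = (fa ^^ n0) ?o" by blast
  let ?G = "\<lambda>x. geodesic T x (End (refend T))"
  have shift: "(fa ^^ (k + m0)) x = (fa ^^ (k + n0)) ?o" for k by (simp add: funpow_add n0)
  have "?G ?o \<inter> ?G x = ?G ((fa ^^ n0) ?o)"
  proof (intro equalityI subsetI)
    fix z assume "z \<in> ?G ?o \<inter> ?G x"
    then obtain i j where z: "z = (fa ^^ i) ?o" "z = (fa ^^ j) x"
      unfolding geodesic_refend by blast
    then have "m0 \<le> j" unfolding m0_def by (intro Least_le) metis
    then have "j - m0 + m0 = j" by simp
    then have "z = (fa ^^ (j - m0 + n0)) ?o" using z shift[of "j - m0"] by metis
    then have "z = (fa ^^ (j - m0)) ((fa ^^ n0) ?o)" by (simp only: funpow_add comp_apply)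
    then show "z \<in> ?G ((fa ^^ n0) ?o)" by (auto simp: geodesic_refend)
  next
    fix z assume "z \<in> ?G ((fa ^^ n0) ?o)"
    then obtain k where "z = (fa ^^ (k + n0)) ?o" by (auto simp: geodesic_refend funpow_add)
    then show "z \<in> ?G ?o \<inter> ?G x" using shift[of k] unfolding geodesic_refend by (metis IntI rangeI)
  qed
  moreover have "b = b'" if "?G b = ?G b'" for b b'
  proof -
    have self: "c \<in> ?G c" for c unfolding geodesic_refend by (rule range_eqI[of _ _ 0]) simp
    have "b \<in> ?G b'" "b' \<in> ?G b" using that self[of b] self[of b'] by simp_all
    then obtain i j where ij: "b = (fa ^^ i) b'" "b' = (fa ^^ j) b"
      unfolding geodesic_refend by blast
    \<comment> \<open>A ray never returns to its starting point, hence
      \<open>i + j = 0\<close>.\<close>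
    then have "(fa ^^ (i + j)) b = (fa ^^ 0) b" by (metis funpow_0 funpow_add comp_apply)
    then have "i + j = 0" by (simp only: fa_funpow_inj)
    then show ?thesis using ij by simp
  qed
  ultimately have rc: "ref_confluent T ?o x = (fa ^^ n0) ?o"
    unfolding ref_confluent_def by (intro the_equality) auto
  have "m0 \<le> m" unfolding m0_def by (intro Least_le) (use assms in blast)
  then have "(fa ^^ n) ?o = (fa ^^ (m - m0 + n0)) ?o" using assms shift[of "m - m0"] by simp
  then have "n = m - m0 + n0" by (simp only: fa_funpow_inj)
  then show ?thesis using \<open>m0 \<le> m\<close> gdist_fa_funpow[of x m0] n0 gdist_fa_funpow[of ?o n0]
    unfolding height_def rc Let_def by simp
qed

lemma fa_common: "\<exists>m n. (fa ^^ m) x = (fa ^^ n) y"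
  using eray_common[OF refend_in, of x y] by (simp add: eray_refend)

lemma height_fa: "height T (fa x) = height T x - 1"
proof -
  obtain m n where mn: "(fa ^^ m) x = (fa ^^ n) (origin T)" using fa_common by blast
  have "(fa ^^ m) (fa x) = (fa ^^ Suc m) x" by (simp only: funpow_Suc_right comp_def)
  then have "(fa ^^ m) (fa x) = (fa ^^ Suc n) (origin T)" using mn by simp
  from height_eq[OF this] height_eq[OF mn] show ?thesis by simp
qed

lemma height_origin [simp]: "height T (origin T) = 0"
  using height_eq[of 0 "origin T" 0] by simp

lemma adj_fa: "adj T x (fa x)"
  using eray_rays[OF refend_in, of x] by (auto simp: rays_iff fa_def eray_0[OF refend_in] dest: spec[of _ 0])

text \<open>If a neighbour \<open>y\<close> of \<open>x\<close> is not its father, prepending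
  \<open>y\<close> to the ray from \<open>x\<close> gives a ray of the same end, which is therefore
  the ray from \<open>y\<close>.\<close>

lemma adj_fa_iff: "adj T x y \<longleftrightarrow> fa x = y \<or> fa y = x"
proof
  assume xy: "adj T x y"
  show "fa x = y \<or> fa y = x"
  proof (cases "fa x = y")
    case False
    let ?\<pi> = "eray (refend T) x"
    let ?\<tau> = "case_nat y ?\<pi>"
    have "?\<tau> \<in> rays (adj T)" unfolding rays_iff
    proof (intro conjI allI)
      show "adj T (?\<tau> n) (?\<tau> (Suc n))" for n
        using eray_rays[OF refend_in, of x] xy adj_sym
        by (cases n) (auto simp: rays_iff eray_0[OF refend_in])
      show "?\<tau> (Suc (Suc n)) \<noteq> ?\<tau> n" for n
        using eray_rays[OF refend_in, of x] False
        by (cases n) (auto simp: rays_iff fa_def)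
    qed
    then have "?\<tau> \<in> refend T"
      by (rule end_tailI[OF refend_in eray_in[OF refend_in, of x], where a = 0 and b = 1]) simp
    then have "eray (refend T) y = ?\<tau>" by (rule eray_eqI[OF refend_in]) simp
    then have "fa y = x" by (simp add: fa_def eray_0[OF refend_in])
    then show ?thesis ..
  qed simp
qed (use adj_fa adj_sym in auto)

lemma father_eq: "father T x = fa x"
  unfolding father_def
proof (rule the_equality)
  show "adj T x (fa x) \<and> height T (fa x) = height T x - 1" using adj_fa height_fa by auto
  show "y = fa x" if "adj T x y \<and> height T y = height T x - 1" for y
    using that height_fa[of x] height_fa[of y] by (auto simp: adj_fa_iff)
qed

lemma children_fa: "finite {y. fa y = x} \<and> card {y. fa y = x} = p"
proof -
  have fin: "finite {y. adj T x y}" "card {y. adj T x y} = p + 1"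
    using pointed by (auto simp: pointed_homogeneous_tree_def homogeneous_tree_def)
  have eq: "{y. adj T x y} = insert (fa x) {y. fa y = x}" by (auto simp: adj_fa_iff)
  have "fa x \<notin> {y. fa y = x}" using height_fa[of "fa x"] height_fa[of x] by auto
  moreover from fin eq have f: "finite {y. fa y = x}" by simp
  ultimately show ?thesis using fin eq by (simp add: card_insert_disjoint)
qed

sublocale horo_tree fa "height T" p "adj T"
  using height_fa children_fa p2 fa_common adj_fa_iff by unfold_locales auto

end

section \<open>Walks on intervals of integers\<close>

text \<open>The Chebyshev polynomial of the second kind of degree \<open>n - 1\<close>. For
  \<open>c = 1\<close> it is \<open>n\<close>, and for \<open>c = cosh s\<close> with
  \<open>s > 0\<close> it is \<open>sinh (n s) / sinh s\<close>.\<close>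

fun cs :: "real \<Rightarrow> nat \<Rightarrow> real" where
  "cs c 0 = 0"
| "cs c (Suc 0) = 1"
| "cs c (Suc (Suc n)) = 2 * c * cs c (Suc n) - cs c n"

text \<open>The odd extension satisfies the recursion at all integers, so \<open>D\<close> can also
  be evaluated just outside its interval.\<close>

definition S :: "real \<Rightarrow> int \<Rightarrow> real" where
  "S c j = (if j \<ge> 0 then cs c (nat j) else - cs c (nat (- j)))"

lemma S_of_nat [simp]: "S c (int n) = cs c n"
  by (simp add: S_def)

lemma S_0 [simp]: "S c 0 = 0" and S_1 [simp]: "S c 1 = 1"
  by (simp_all add: S_def)

lemma S_minus [simp]: "S c (- j) = - S c j"
  by (auto simp: S_def)

lemma S_rec: "S c (j + 1) = 2 * c * S c j - S c (j - 1)"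
proof -
  have nonneg: "S c (int n + 1) = 2 * c * S c (int n) - S c (int n - 1)" for n
  proof (cases n)
    case 0
    then show ?thesis using S_minus[of c 1] by simp
  next
    case (Suc k)
    then have "int n + 1 = int (Suc (Suc k))" "int n - 1 = int k" by simp_all
    then show ?thesis using Suc by (simp only: S_of_nat cs.simps)
  qed
  show ?thesis
  proof (cases "j \<ge> 0")
    case True
    then show ?thesis using nonneg[of "nat j"] by simp
  next
    case False
    then have "S c (- j + 1) = 2 * c * S c (- j) - S c (- j - 1)"
      using nonneg[of "nat (- j)"] by simp
    moreover have "- j + 1 = - (j - 1)" "- j - 1 = - (j + 1)" by simp_all
    ultimately show ?thesis by (simp only: S_minus)
  qed
qed

text \<open>A Casorati determinant: it is unchanged when \<open>a\<close> and \<open>b\<close> move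
  together, and at \<open>a = 0\<close> it is \<open>S c b\<close>.\<close>

lemma S_prod: "S c (a + 1) * S c b - S c a * S c (b + 1) = S c (b - a)"
proof (induction a arbitrary: b rule: int_induct[where k = 0])
  case base
  then show ?case by simp
next
  case (step1 a)
  have "S c (a + 1 + 1) * S c b - S c (a + 1) * S c (b + 1)
      = S c (a + 1) * S c (b - 1) - S c a * S c (b - 1 + 1)"
  proof -
    have r: "S c (a + 1 + 1) = 2 * c * S c (a + 1) - S c a" "S c (b + 1) = 2 * c * S c b - S c (b - 1)"
      using S_rec[of c "a + 1"] S_rec[of c b] by simp_all
    show ?thesis unfolding r by (simp add: algebra_simps)
  qed
  also have "\<dots> = S c (b - 1 - a)" by (rule step1.IH)
  finally show ?case by (simp add: algebra_simps)
next
  case (step2 a)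
  have "S c (a - 1 + 1) * S c b - S c (a - 1) * S c (b + 1)
      = S c (a + 1) * S c (b + 1) - S c a * S c (b + 1 + 1)"
  proof -
    have r: "S c (b + 1 + 1) = 2 * c * S c (b + 1) - S c b" "S c (a + 1) = 2 * c * S c a - S c (a - 1)"
      using S_rec[of c "b + 1"] S_rec[of c a] by simp_all
    show ?thesis unfolding r by (simp add: algebra_simps)
  qed
  also have "\<dots> = S c (b + 1 - a)" by (rule step2.IH)
  finally show ?case by (simp add: algebra_simps)
qed

text \<open>For \<open>c \<ge> 1\<close> the larger root of \<open>z * z - 2 * c * z + 1\<close>,
  which governs the growth of \<open>S\<close>. At \<open>c = 1\<close> it is 1 and \<open>S\<close>
  grows linearly.\<close>

definition ex :: "real \<Rightarrow> real" where "ex c = c + sqrt (c\<^sup>2 - 1)"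

section \<open>Growth of \<open>S\<close> for \<open>c\<close> at least 1\<close>

context
  fixes c :: real
  assumes c: "c \<ge> 1"
begin

lemma ex_ge_1: "ex c \<ge> 1"
  using c by (auto simp: ex_def intro: add_increasing2)

lemma ex_pos: "ex c > 0"
  using ex_ge_1 by linarith

lemma ex_quadratic: "ex c * ex c = 2 * c * ex c - 1"
proof -
  have "sqrt (c\<^sup>2 - 1) * sqrt (c\<^sup>2 - 1) = c\<^sup>2 - 1" using c by (simp add: one_le_power)
  then show ?thesis by (simp add: ex_def algebra_simps power2_eq_square)
qed

lemma ex_add_inverse: "ex c + inverse (ex c) = 2 * c"
  using ex_quadratic ex_pos by (simp add: field_simps)

text \<open>Splitting off the larger root leaves a power of the smaller root
  \<open>inverse (ex c)\<close>.\<close>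

lemma cs_step: "cs c (Suc n) = ex c * cs c n + inverse (ex c) ^ n"
proof (induction n)
  case (Suc n)
  have "cs c (Suc (Suc n)) = (ex c + inverse (ex c)) * cs c (Suc n) - cs c n"
    by (simp add: ex_add_inverse)
  also have "\<dots> = ex c * cs c (Suc n) + inverse (ex c) * (cs c (Suc n) - ex c * cs c n)"
    using ex_pos by (simp add: field_simps)
  also have "\<dots> = ex c * cs c (Suc n) + inverse (ex c) ^ Suc n" using Suc.IH by simp
  finally show ?case .
qed simp

lemma cs_mult_ex: "ex c * cs c n \<le> cs c (Suc n)"
  using cs_step[of n] ex_pos by simp

lemma cs_nonneg: "cs c n \<ge> 0"
proof (induction n)
  case (Suc n)
  then show ?case using cs_step[of n] ex_pos by simp
qed simp

lemma cs_Suc_ge: "cs c n \<le> cs c (Suc n)"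
  using cs_mult_ex[of n] mult_right_mono[OF ex_ge_1 cs_nonneg[of n]] by simp

lemma cs_mono: "m \<le> n \<Longrightarrow> cs c m \<le> cs c n"
  by (rule lift_Suc_mono_le[of "cs c"]) (rule cs_Suc_ge)

lemma cs_pos: "n > 0 \<Longrightarrow> cs c n > 0"
  using cs_mono[of 1 n] by simp

text \<open>The linear factor keeps the bound valid at \<open>c = 1\<close>; it is what later
  produces the linear weight in \<open>D_bound\<close>.\<close>

lemma cs_le: "cs c (Suc n) \<le> real (Suc n) * ex c ^ n"
proof (induction n)
  case (Suc n)
  have "inverse (ex c) ^ Suc n \<le> 1" using ex_ge_1 by (intro power_le_one) (auto simp: inverse_le_1_iff)
  also have "1 \<le> ex c ^ Suc n" using ex_ge_1 by (rule one_le_power)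
  finally have "cs c (Suc (Suc n)) \<le> ex c * (real (Suc n) * ex c ^ n) + ex c ^ Suc n"
    unfolding cs_step[of "Suc n"] using ex_pos mult_left_mono[OF Suc.IH, of "ex c"] by linarith
  also have "\<dots> = real (Suc (Suc n)) * ex c ^ Suc n" by (simp add: algebra_simps)
  finally show ?case .
qed simp

lemma cs_ge: "real n \<le> cs c n"
proof -
  have "real n \<le> cs c n \<and> 1 \<le> cs c (Suc n) - cs c n"
  proof (induction n)
    case (Suc n)
    have "2 * 1 * cs c (Suc n) \<le> 2 * c * cs c (Suc n)"
      using c by (intro mult_right_mono cs_nonneg) auto
    then have "2 * cs c (Suc n) \<le> 2 * c * cs c (Suc n)" by simp
    with Suc show ?case unfolding cs.simps by linarith
  qed simp
  then show ?thesis ..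
qed

lemma S_nonneg: "j \<ge> 0 \<Longrightarrow> S c j \<ge> 0"
  by (simp add: S_def cs_nonneg)

lemma S_pos: "j > 0 \<Longrightarrow> S c j > 0"
  by (simp add: S_def cs_pos)

lemma S_ge_1: "j \<ge> 1 \<Longrightarrow> S c j \<ge> 1"
  using cs_mono[of 1 "nat j"] by (simp add: S_def)

lemma S_ge: "j \<ge> 0 \<Longrightarrow> S c j \<ge> of_int j"
  using cs_ge[of "nat j"] by (simp add: S_def)

lemma S_mono: "0 \<le> i \<Longrightarrow> i \<le> j \<Longrightarrow> S c i \<le> S c j"
  by (simp add: S_def cs_mono nat_mono)

lemma S_mult_ex: "j \<ge> 0 \<Longrightarrow> S c j * ex c ^ l \<le> S c (j + int l)"
proof (induction l)
  case (Suc l)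
  have "S c j * ex c ^ Suc l \<le> ex c * S c (j + int l)"
    using Suc ex_pos by (simp add: mult.left_commute)
  also have "\<dots> \<le> S c (j + int l + 1)"
    using cs_mult_ex[of "nat (j + int l)"] Suc.prems by (simp add: S_def nat_add_distrib)
  finally show ?case by (simp add: algebra_simps)
qed simp

lemma S_add_le:
  assumes "a \<ge> 0" "b \<ge> 1" shows "S c (a + b) \<le> S c (a + 1) * S c b"
proof -
  have "S c (a + b) = S c (a + 1) * S c b - S c a * S c (b - 1)"
  proof -
    have 1: "- a - 1 = - (a + 1)" "- a - 1 + 1 = - a" "b - 1 + 1 = b" "b - 1 - (- a - 1) = a + b" by simp_all
    show ?thesis using S_prod[of c "- a - 1" "b - 1"] unfolding 1(2-4) unfolding 1(1) S_minus by simp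
  qed
  then show ?thesis using assms S_nonneg[of a] S_nonneg[of "b - 1"] by simp
qed

lemma S_step: "j \<ge> 0 \<Longrightarrow> S c (j + 1) = ex c * S c j + inverse (ex c) ^ nat j"
  using cs_step[of "nat j"] by (simp add: S_def nat_add_distrib)

lemma filterlim_S:
  assumes "filterlim M at_top F" shows "filterlim (\<lambda>n. S c (M n)) at_top F"
proof (rule filterlim_at_top_mono)
  show "filterlim (\<lambda>n. real_of_int (M n)) at_top F"
    using assms by (rule filterlim_compose[OF filterlim_real_of_int_at_top])
  show "\<forall>\<^sub>F n in F. real_of_int (M n) \<le> S c (M n)"
    using filterlim_at_top[THEN iffD1, OF assms, rule_format, of 0] by eventually_elim (rule S_ge)
qed

text \<open>By \<open>S_step\<close> the quotient differs from \<open>ex c\<close> by at most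
  \<open>1 / S c (M n)\<close>. Since \<open>S\<close> dominates the identity, this tends to 0 also
  at \<open>c = 1\<close>.\<close>

lemma S_shift_ratio1:
  assumes "filterlim M at_top F" shows "((\<lambda>n. S c (M n + 1) / S c (M n)) \<longlongrightarrow> ex c) F"
proof -
  have ev: "\<forall>\<^sub>F n in F. M n \<ge> 1" using filterlim_at_top[THEN iffD1, OF assms] by blast
  have "((\<lambda>n. inverse (ex c) ^ nat (M n) / S c (M n)) \<longlongrightarrow> 0) F"
  proof (rule tendsto_sandwich[of "\<lambda>_. 0" _ _ "\<lambda>n. inverse (S c (M n))"])
    show "\<forall>\<^sub>F n in F. 0 \<le> inverse (ex c) ^ nat (M n) / S c (M n)"
      using ev by eventually_elim (use ex_pos S_nonneg in \<open>auto intro!: divide_nonneg_nonneg\<close>)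
    show "\<forall>\<^sub>F n in F. inverse (ex c) ^ nat (M n) / S c (M n) \<le> inverse (S c (M n))"
      using ev
    proof eventually_elim
      case (elim n)
      have "inverse (ex c) ^ nat (M n) \<le> 1"
        using ex_ge_1 by (intro power_le_one) (auto simp: inverse_le_1_iff)
      then show ?case using S_pos[of "M n"] elim by (simp add: field_simps)
    qed
    show "((\<lambda>n. inverse (S c (M n))) \<longlongrightarrow> 0) F"
      using filterlim_S[OF assms] by (rule tendsto_inverse_0_at_top)
  qed simp
  then have "((\<lambda>n. ex c + inverse (ex c) ^ nat (M n) / S c (M n)) \<longlongrightarrow> ex c + 0) F"
    by (intro tendsto_intros)
  moreover have "\<forall>\<^sub>F n in F. ex c + inverse (ex c) ^ nat (M n) / S c (M n) = S c (M n + 1) / S c (M n)"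
    using ev
  proof eventually_elim
    case (elim n)
    then show ?case using S_pos[of "M n"] S_step[of "M n"] by (simp add: add_divide_distrib)
  qed
  ultimately show ?thesis by (simp add: filterlim_cong)
qed

lemma filterlim_add_int:
  assumes "filterlim M at_top F" shows "filterlim (\<lambda>n. M n + a :: int) at_top F"
  unfolding filterlim_at_top
proof
  fix Z show "\<forall>\<^sub>F n in F. Z \<le> M n + a"
    using filterlim_at_top[THEN iffD1, OF assms, rule_format, of "Z - a"] by eventually_elim simp
qed

lemma S_shift_ratio:
  assumes M: "filterlim M at_top F"
  shows "((\<lambda>n. S c (M n + a) / S c (M n + b)) \<longlongrightarrow> ex c powi (a - b)) F"
proof -
  have *: "((\<lambda>n. S c (M n + int l) / S c (M n)) \<longlongrightarrow> ex c ^ l) F" if "filterlim M at_top F" for M l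
  proof (induction l)
    case 0
    have "\<forall>\<^sub>F n in F. M n \<ge> 1" using filterlim_at_top[THEN iffD1, OF that] by blast
    then have "\<forall>\<^sub>F n in F. S c (M n + int 0) / S c (M n) = ex c ^ 0"
    proof eventually_elim
      case (elim n)
      then show ?case using S_pos[of "M n"] by simp
    qed
    then show ?case by (rule tendsto_eventually)
  next
    case (Suc l)
    have ev: "\<forall>\<^sub>F n in F. M n \<ge> 1" using filterlim_at_top[THEN iffD1, OF that] by blast
    from S_shift_ratio1[OF filterlim_add_int[OF that, of "int l"]] Suc
    have "((\<lambda>n. S c (M n + int l + 1) / S c (M n + int l) * (S c (M n + int l) / S c (M n)))
       \<longlongrightarrow> ex c * ex c ^ l) F" by (rule tendsto_mult)
    moreover have "\<forall>\<^sub>F n in F. S c (M n + int l + 1) / S c (M n + int l) * (S c (M n + int l) / S c (M n))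
       = S c (M n + int (Suc l)) / S c (M n)"
      using ev
    proof eventually_elim
      case (elim n)
      then show ?case using S_pos[of "M n + int l"] by (simp add: algebra_simps)
    qed
    ultimately have "((\<lambda>n. S c (M n + int (Suc l)) / S c (M n)) \<longlongrightarrow> ex c * ex c ^ l) F"
      by (rule Lim_transform_eventually)
    then show ?case by simp
  qed
  show ?thesis
  proof (cases "a \<ge> b")
    case True
    then show ?thesis using *[OF filterlim_add_int[OF M, of b], of "nat (a - b)"]
      by (simp add: power_int_def)
  next
    case False
    then have "((\<lambda>n. inverse (S c (M n + b) / S c (M n + a))) \<longlongrightarrow> inverse (ex c ^ nat (b - a))) F"
      using *[OF filterlim_add_int[OF M, of a], of "nat (b - a)"] ex_pos
      by (intro tendsto_inverse) auto
    with False show ?thesis by (simp add: power_int_def power_inverse)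
  qed
qed

end

lemma continuous_cs: "isCont (\<lambda>c. cs c n) a"
  by (induction a n rule: cs.induct) auto

lemma continuous_S: "isCont (\<lambda>c. S c j) a"
  by (cases "j \<ge> 0") (simp_all add: S_def[abs_def] continuous_cs continuous_minus)

text \<open>Up to a constant and an exponential factor, \<open>D c m M i k\<close> is the Green function of nearest
  neighbour random walk on the integers, restricted to the paths from \<open>i\<close> to \<open>k\<close> with minimum
  \<open>m\<close> and maximum \<open>M\<close>.\<close>

definition D :: "real \<Rightarrow> int \<Rightarrow> int \<Rightarrow> int \<Rightarrow> int \<Rightarrow> real" where
  "D c m M i k = (if m = M then 1 / (2 * c) else
     (S c (M + 1 - k) * S c (i - m) + S c (M - i) * S c (k - m + 1))
       / (S c (M - m) * S c (M - m + 1) * S c (M - m + 2)))"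

text \<open>Exchanging the two trees reverses all heights and turns maxima into minima.\<close>

lemma D_reflect: "D c m M i k = D c (- M) (- m) (- i) (- k)"
proof -
  have "- m + 1 - - k = k - m + 1" "- i - - M = M - i" "- m - - i = i - m" "- k - - M + 1 = M + 1 - k"
    "- m - - M = M - m" by simp_all
  then show ?thesis unfolding D_def by (simp only: neg_equal_iff_equal) (auto simp: algebra_simps)
qed

lemma D_harmonic: "m \<noteq> M \<Longrightarrow> 2 * c * D c m M i k = D c m M (i + 1) k + D c m M (i - 1) k"
proof -
  assume "m \<noteq> M"
  have 1: "S c (i + 1 - m) = 2 * c * S c (i - m) - S c (i - 1 - m)"
    using S_rec[of c "i - m"] by (simp add: algebra_simps)
  have 2: "S c (M - (i - 1)) = 2 * c * S c (M - i) - S c (M - (i + 1))"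
    using S_rec[of c "M - i"] by (simp add: algebra_simps)
  have "2 * c * (S c (M + 1 - k) * S c (i - m) + S c (M - i) * S c (k - m + 1)) =
     (S c (M + 1 - k) * S c (i + 1 - m) + S c (M - (i + 1)) * S c (k - m + 1))
     + (S c (M + 1 - k) * S c (i - 1 - m) + S c (M - (i - 1)) * S c (k - m + 1))"
    unfolding 1 2 by (simp add: algebra_simps)
  with \<open>m \<noteq> M\<close> show ?thesis unfolding D_def
    by (simp only: if_False add_divide_distrib[symmetric] times_divide_eq_right)
qed

context
  fixes c :: real
  assumes c: "c \<ge> 1"
begin

lemma D_nonneg: "m \<le> i \<Longrightarrow> i \<le> M \<Longrightarrow> m \<le> k \<Longrightarrow> k \<le> M \<Longrightarrow> 0 \<le> D c m M i k"
  unfolding D_def using c by (auto intro!: divide_nonneg_nonneg mult_nonneg_nonneg add_nonneg_nonneg S_nonneg)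

lemma D_pos: "m \<le> i \<Longrightarrow> i \<le> M \<Longrightarrow> m \<le> k \<Longrightarrow> k \<le> M \<Longrightarrow> 0 < D c m M i k"
proof -
  assume a: "m \<le> i" "i \<le> M" "m \<le> k" "k \<le> M"
  show ?thesis
  proof (cases "m = M")
    case False
    then consider "m < i" | "i < M" using a by linarith
    then have "0 < S c (M + 1 - k) * S c (i - m) + S c (M - i) * S c (k - m + 1)"
    proof cases
      case 1
      then show ?thesis using a c
        by (intro add_pos_nonneg mult_pos_pos mult_nonneg_nonneg S_pos S_nonneg) auto
    next
      case 2
      then show ?thesis using a c
        by (intro add_nonneg_pos mult_pos_pos mult_nonneg_nonneg S_pos S_nonneg) auto
    qed
    with False a c show ?thesis
      by (auto simp: D_def intro!: divide_pos_pos mult_pos_pos S_pos)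
  qed (use c in \<open>simp add: D_def\<close>)
qed

lemma D_le: "m \<le> i \<Longrightarrow> i \<le> M \<Longrightarrow> m \<le> k \<Longrightarrow> k \<le> M \<Longrightarrow> D c m M i k \<le> 2"
proof (cases "m = M")
  case False
  assume a: "m \<le> i" "i \<le> M" "m \<le> k" "k \<le> M"
  let ?n = "M - m"
  have pos: "S c ?n \<ge> 1" "S c (?n + 1) \<ge> 1" "S c (?n + 2) \<ge> 1"
    using a False c by (auto intro: S_ge_1)
  have "S c (M + 1 - k) * S c (i - m) \<le> S c (?n + 1) * S c ?n"
    using a c by (intro mult_mono S_mono S_nonneg) auto
  moreover have "S c (M - i) * S c (k - m + 1) \<le> S c ?n * S c (?n + 1)"
    using a c by (intro mult_mono S_mono S_nonneg) auto
  ultimately have "S c (M + 1 - k) * S c (i - m) + S c (M - i) * S c (k - m + 1) \<le> 2 * (S c ?n * S c (?n + 1))"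
    by (simp add: algebra_simps)
  also have "\<dots> \<le> 2 * (S c ?n * S c (?n + 1) * S c (?n + 2))"
    using pos mult_left_mono[OF pos(3), of "S c ?n * S c (?n + 1)"] by simp
  finally show ?thesis using pos False by (simp add: D_def divide_le_eq)
qed (use c in \<open>simp add: D_def field_simps\<close>)

text \<open>A path that starts at its maximum \<open>i\<close> steps to \<open>i - 1\<close>, and
  the rest has maximum \<open>i\<close> or \<open>i - 1\<close>. The formula for maximum
  \<open>i\<close>, continued to \<open>i + 1\<close>, supplies the second contribution to the
  harmonic equation at \<open>i\<close>. It is absent if \<open>k = i\<close>, because the path then
  has to return to \<open>i\<close>.\<close>

lemma D_edge:
  assumes "m < i" "m \<le> k" "k \<le> i"
  shows "D c m i (i + 1) k = (if k < i then D c m (i - 1) (i - 1) k else 0)"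
proof -
  let ?n = "i - m"
  have pos: "S c ?n > 0" "S c (?n + 1) > 0" "S c (?n + 2) > 0" using assms c by (auto intro: S_pos)
  have "S c (i + 1 - k) * S c (i + 1 - m) + S c (i - (i + 1)) * S c (k - m + 1)
      = S c (i - k + 1) * S c (?n + 1) - S c (k - m + 1)"
    using S_minus[of c 1] by (simp add: algebra_simps)
  also have "\<dots> = S c (i - k) * S c (?n + 2)"
    using S_prod[of c "i - k" "?n + 1"] by (simp add: algebra_simps)
  finally have 1: "D c m i (i + 1) k = S c (i - k) / (S c ?n * S c (?n + 1))"
    using pos assms by (simp add: D_def)
  show ?thesis
  proof (cases "k < i")
    case True
    show ?thesis
    \<comment> \<open>Then the smaller interval is a single point, where \<open>D\<close> has its
      special value \<open>1 / (2 * c)\<close>.\<close>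
    proof (cases "m = i - 1")
      case True
      with \<open>k < i\<close> assms have "k = i - 1" "?n = 1" by auto
      have "S c 2 = 2 * c" using S_rec[of c 1] by simp
      with 1 \<open>k < i\<close> True show ?thesis unfolding \<open>?n = 1\<close> unfolding \<open>k = i - 1\<close> by (simp add: D_def)
    next
      case False
      then have "S c (i - 1 - m) > 0" using assms c by (intro S_pos) auto
      with 1 True False pos show ?thesis by (simp add: D_def algebra_simps)
    qed
  qed (use 1 assms in simp)
qed

end

section \<open>The double series over minimal and maximal heights\<close>

lemma summable_powi_atMost:
  fixes q :: real assumes "q > 1" shows "(\<lambda>m. q powi m) summable_on {..m0}"
proof -
  have "(\<lambda>l::nat. inverse q ^ l) summable_on UNIV"
    using assms by (intro summable_nonneg_imp_summable_on summable_geometric)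
      (auto simp: inverse_less_1_iff)
  then have "(\<lambda>l::nat. q powi m0 * inverse q ^ l) summable_on UNIV"
    by (rule summable_on_cmult_right)
  also have "(\<lambda>l::nat. q powi m0 * inverse q ^ l) = (\<lambda>l. q powi (m0 - int l))"
    using assms by (simp add: power_int_diff power_inverse divide_inverse)
  also have "\<dots> summable_on UNIV \<longleftrightarrow> (\<lambda>m. q powi m) summable_on {..m0}"
    by (rule summable_on_reindex_bij_witness[where i = "\<lambda>m. nat (m0 - m)" and j = "\<lambda>l. m0 - int l"]) auto
  finally show ?thesis .
qed

lemma summable_powi_atLeast:
  fixes r :: real assumes "r > 1" shows "(\<lambda>M. r powi (- M)) summable_on {M0..}"
proof -
  have "(\<lambda>m. r powi m) summable_on {..- M0}" using assms by (rule summable_powi_atMost)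
  also have "?this \<longleftrightarrow> (\<lambda>M. r powi (- M)) summable_on {M0..}"
    by (rule summable_on_reindex_bij_witness[where i = uminus and j = uminus]) auto
  finally show ?thesis .
qed

lemma summable_on_times:
  fixes f :: "'i \<Rightarrow> real" and g :: "'j \<Rightarrow> real"
  assumes "f summable_on A" "g summable_on B" "\<And>x. x \<in> A \<Longrightarrow> f x \<ge> 0" "\<And>y. y \<in> B \<Longrightarrow> g y \<ge> 0"
  shows "(\<lambda>(x, y). f x * g y) summable_on A \<times> B"
proof (rule summable_on_SigmaI)
  show "((\<lambda>y. case (x, y) of (x, y) \<Rightarrow> f x * g y) has_sum f x * infsum g B) B" for x
    using assms(2) by (auto intro: has_sum_cmult_right)
  show "(\<lambda>x. f x * infsum g B) summable_on A" using assms(1) by (rule summable_on_cmult_left)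
qed (use assms in auto)

text \<open>The parameters \<open>q\<close> and \<open>r\<close> are real and unconstrained so that
  \<open>Psi_reflect\<close> may exchange them.\<close>

definition Psi :: "real \<Rightarrow> real \<Rightarrow> real \<Rightarrow> int \<Rightarrow> int \<Rightarrow> int \<Rightarrow> int \<Rightarrow> real" where
  "Psi c q r k i m0 M0 = (\<Sum>\<^sub>\<infinity>(m, M)\<in>{..m0} \<times> {M0..}. q powi m * r powi (- M) * D c m M i k)"

lemma Psi_reflect: "Psi c q r k i m0 M0 = Psi c r q (- k) (- i) (- M0) (- m0)"
  unfolding Psi_def
proof (rule infsum_reindex_bij_witness[where i = "\<lambda>(m, M). (- M, - m)" and j = "\<lambda>(m, M). (- M, - m)"])
  fix z assume "z \<in> {..m0} \<times> {M0..}"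
  show "(case case z of (m, M) \<Rightarrow> (- M, - m) of (m, M) \<Rightarrow> r powi m * q powi (- M) * D c m M (- i) (- k))
      = (case z of (m, M) \<Rightarrow> q powi m * r powi (- M) * D c m M i k)"
    using D_reflect[of c "fst z" "snd z" i k] by (auto simp: case_prod_unfold)
qed auto

context
  fixes c q r :: real
  assumes c: "c \<ge> 1" and q: "q > 1" and r: "r > 1"
begin

abbreviation (input) wD :: "int \<Rightarrow> int \<Rightarrow> int \<times> int \<Rightarrow> real" where
  "wD i k \<equiv> \<lambda>(m, M). q powi m * r powi (- M) * D c m M i k"

lemma weight_summable: "(\<lambda>(m, M). q powi m * r powi (- M)) summable_on {..m0} \<times> {M0..}"
  using summable_on_times[OF summable_powi_atMost[OF q] summable_powi_atLeast[OF r]] q r by simp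

lemma wD_summable:
  assumes "m0 \<le> i" "m0 \<le> k" "i \<le> M0" "k \<le> M0" "A \<subseteq> {..m0} \<times> {M0..}"
  shows "wD i k summable_on A"
proof -
  have "wD i k summable_on {..m0} \<times> {M0..}"
  proof (rule summable_on_comparison_test)
    show "(\<lambda>z. (case z of (m, M) \<Rightarrow> q powi m * r powi (- M)) * 2) summable_on {..m0} \<times> {M0..}"
      by (rule summable_on_cmult_left[OF weight_summable])
    show "wD i k z \<le> (case z of (m, M) \<Rightarrow> q powi m * r powi (- M)) * 2" if "z \<in> {..m0} \<times> {M0..}" for z
      using that assms q r by (auto intro!: mult_left_mono D_le[OF c])
    show "0 \<le> wD i k z" if "z \<in> {..m0} \<times> {M0..}" for z
      using that assms q r by (auto intro!: mult_nonneg_nonneg D_nonneg[OF c])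
  qed
  then show ?thesis by (rule summable_on_subset) (use assms in auto)
qed

lemma wD_harmonic: "fst z \<noteq> snd z \<Longrightarrow> 2 * c * wD i k z = wD (i + 1) k z + wD (i - 1) k z"
proof -
  assume "fst z \<noteq> snd z"
  then have "m \<noteq> M" if "z = (m, M)" for m M using that by simp
  then have "2 * c * (w * D c m M i k) = w * D c m M (i + 1) k + w * D c m M (i - 1) k"
    if "z = (m, M)" for m M w
    using that arg_cong[OF D_harmonic[of m M c i k], of "\<lambda>x. w * x"] by (simp add: algebra_simps)
  then show ?thesis by (cases z) auto
qed

lemma Psi_pos:
  assumes "m0 \<le> i" "m0 \<le> k" "i \<le> M0" "k \<le> M0"
  shows "0 < Psi c q r k i m0 M0"
proof -
  have "0 < wD i k (m0, M0)" using assms q r by (auto intro!: mult_pos_pos D_pos[OF c])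
  also have "\<dots> = infsum (wD i k) {(m0, M0)}" by simp
  also have "\<dots> \<le> Psi c q r k i m0 M0"
    unfolding Psi_def
    by (rule infsum_mono2)
       (use assms q r in \<open>auto intro!: wD_summable mult_nonneg_nonneg D_nonneg[OF c]\<close>)
  finally show ?thesis .
qed

text \<open>The neighbours of \<open>i\<close> use the same index set, and every index pair has
  \<open>m < M\<close>, so the harmonicity of \<open>D\<close> can be summed term by term.\<close>

lemma Psi_interior:
  assumes "m0 < i" "i < M0" "m0 \<le> k" "k \<le> M0"
  shows "2 * c * Psi c q r k i m0 M0 = Psi c q r k (i + 1) m0 M0 + Psi c q r k (i - 1) m0 M0"
proof -
  have "2 * c * Psi c q r k i m0 M0 = (\<Sum>\<^sub>\<infinity>z\<in>{..m0} \<times> {M0..}. wD (i + 1) k z + wD (i - 1) k z)"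
    unfolding Psi_def infsum_cmult_right'[symmetric]
  proof (rule infsum_cong)
    fix z assume z: "z \<in> {..m0} \<times> {M0..}"
    then have "fst z \<noteq> snd z" using assms by auto
    then show "2 * c * wD i k z = wD (i + 1) k z + wD (i - 1) k z"
      by (rule wD_harmonic)
  qed
  also have "\<dots> = Psi c q r k (i + 1) m0 M0 + Psi c q r k (i - 1) m0 M0"
    unfolding Psi_def
    by (rule infsum_add; rule wD_summable[where ?m0.0 = m0 and ?M0.0 = M0]) (use assms in auto)
  finally show ?thesis .
qed

text \<open>At the upper end of the range of \<open>i\<close>, the harmonic continuation of the summands with \<open>M = i\<close>
  to \<open>i + 1\<close> is what distinguishes the vertex below \<open>y\<close> from its siblings.\<close>

lemma Psi_upper:
  assumes "m0 < i" "m0 \<le> k" "k \<le> i"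
  shows "2 * c * Psi c q r k i m0 i = Psi c q r k (i + 1) m0 (i + 1) + Psi c q r k (i - 1) m0 i
     + (if k < i then (Psi c q r k (i - 1) m0 (i - 1) - Psi c q r k (i - 1) m0 i) / r else 0)"
proof -
  have split: "{..m0} \<times> {j..} = {..m0} \<times> {j} \<union> {..m0} \<times> {j + 1..}" for j :: int by auto
  define X where "X = (if k < i then (Psi c q r k (i - 1) m0 (i - 1) - Psi c q r k (i - 1) m0 i) / r else 0)"
  \<comment> \<open>By \<open>D_edge\<close> the terms with \<open>M = i\<close>, continued to
    \<open>i + 1\<close>, are the terms with \<open>M = i - 1\<close> at \<open>i - 1\<close>, up to
    the factor \<open>1 / r\<close> caused by the shift of \<open>M\<close>. Summing those isolates
    the difference of two values of \<open>Psi\<close>.\<close>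
  have edge: "(wD (i + 1) k has_sum X) ({..m0} \<times> {i})"
  proof (cases "k < i")
    case True
    have s: "wD (i - 1) k summable_on {..m0} \<times> {i - 1}" "wD (i - 1) k summable_on {..m0} \<times> {i..}"
      using assms True wD_summable[of m0 "i - 1" k "i - 1" "{..m0} \<times> {i - 1}"]
       wD_summable[of m0 "i - 1" k i] by auto
    have "Psi c q r k (i - 1) m0 (i - 1) = infsum (wD (i - 1) k) ({..m0} \<times> {i - 1}) + Psi c q r k (i - 1) m0 i"
      unfolding Psi_def split[of "i - 1"] using s by (subst infsum_Un_disjoint) auto
    then have "X = infsum (wD (i - 1) k) ({..m0} \<times> {i - 1}) / r" using True by (simp add: X_def)
    then have "((\<lambda>z. wD (i - 1) k z / r) has_sum X) ({..m0} \<times> {i - 1})"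
      using has_sum_cmult_left[OF has_sum_infsum[OF s(1)], of "inverse r"] by (simp add: divide_inverse)
    also have "?this \<longleftrightarrow> ?thesis"
    proof (rule has_sum_reindex_bij_witness[where i = "\<lambda>(m, M). (m, M - 1)" and j = "\<lambda>(m, M). (m, M + 1)"])
      fix z assume "z \<in> {..m0} \<times> {i - 1}"
      then obtain m where z: "z = (m, i - 1)" "m \<le> m0" by auto
      have "r powi (- i) = r powi (1 - i) / r"
        using r power_int_diff[of r "1 - i" 1] by simp
      then show "wD (i + 1) k (case z of (m, M) \<Rightarrow> (m, M + 1)) = wD (i - 1) k z / r"
        using z assms True D_edge[OF c, of m i k] by simp
    qed auto
    finally show ?thesis .
  next
    case False
    then have "X = 0" by (simp add: X_def)
    moreover have "(wD (i + 1) k has_sum 0) ({..m0} \<times> {i})"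
      using assms False D_edge[OF c, of _ i k] by (intro has_sum_0) auto
    ultimately show ?thesis by simp
  qed
  have up: "(wD (i + 1) k has_sum Psi c q r k (i + 1) m0 (i + 1)) ({..m0} \<times> {i + 1..})"
    unfolding Psi_def by (intro has_sum_infsum wD_summable[where ?m0.0 = m0 and ?M0.0 = "i + 1"]) (use assms in auto)
  have down: "(wD (i - 1) k has_sum Psi c q r k (i - 1) m0 i) ({..m0} \<times> {i..})"
    unfolding Psi_def by (intro has_sum_infsum wD_summable[where ?m0.0 = m0 and ?M0.0 = i]) (use assms in auto)
  have "(wD (i + 1) k has_sum (X + Psi c q r k (i + 1) m0 (i + 1))) ({..m0} \<times> {i..})"
    unfolding split[of i] by (rule has_sum_Un_disjoint[OF edge up]) auto
  from has_sum_add[OF this down]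
  have "((\<lambda>z. wD (i + 1) k z + wD (i - 1) k z) has_sum
     (X + Psi c q r k (i + 1) m0 (i + 1) + Psi c q r k (i - 1) m0 i)) ({..m0} \<times> {i..})" .
  also have "?this \<longleftrightarrow> ((\<lambda>z. 2 * c * wD i k z) has_sum
     (X + Psi c q r k (i + 1) m0 (i + 1) + Psi c q r k (i - 1) m0 i)) ({..m0} \<times> {i..})"
  proof (rule has_sum_cong)
    fix z assume z: "z \<in> {..m0} \<times> {i..}"
    then have "fst z \<noteq> snd z" using assms by auto
    then show "wD (i + 1) k z + wD (i - 1) k z = 2 * c * wD i k z"
      by (rule wD_harmonic[symmetric])
  qed
  finally have "2 * c * Psi c q r k i m0 i = X + Psi c q r k (i + 1) m0 (i + 1) + Psi c q r k (i - 1) m0 i"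
    unfolding Psi_def infsum_cmult_right'[symmetric] by (rule infsumI)
  then show ?thesis by (simp add: X_def)
qed

text \<open>Only the index pair \<open>(k, k)\<close> violates the harmonic equation of
  \<open>D\<close>. Its term is the weight times \<open>1 / (2 * c)\<close>, which becomes the
  source.\<close>

lemma Psi_diagonal:
  "2 * c * Psi c q r k k k k = Psi c q r k (k + 1) k (k + 1) + Psi c q r k (k - 1) (k - 1) k
     + q powi k * r powi (- k)"
proof -
  let ?A = "{..k} \<times> {k..} - {(k, k)}"
  have *: "wD k k summable_on {..k} \<times> {k..}" by (rule wD_summable[of k k k k]) auto
  have 1: "Psi c q r k k k k = q powi k * r powi (- k) / (2 * c) + infsum (wD k k) ?A"
  proof -
    have "{..k} \<times> {k..} = {(k, k)} \<union> ?A" by auto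
    then have "Psi c q r k k k k = infsum (wD k k) ({(k, k)} \<union> ?A)" by (simp add: Psi_def)
    also have "\<dots> = infsum (wD k k) {(k, k)} + infsum (wD k k) ?A"
      by (rule infsum_Un_disjoint) (auto intro: summable_on_subset[OF *])
    finally show ?thesis by (simp add: D_def)
  qed
  \<comment> \<open>The neighbour sums run over smaller index sets. Extending them by 0 agrees with
    extending \<open>D\<close>, because \<open>D_edge\<close> makes \<open>D\<close> vanish at the
    added indices.\<close>
  have up: "((\<lambda>z. if snd z = k then 0 else wD (k + 1) k z) has_sum Psi c q r k (k + 1) k (k + 1)) ?A"
  proof -
    have "(wD (k + 1) k has_sum Psi c q r k (k + 1) k (k + 1)) ({..k} \<times> {k + 1..})"
      unfolding Psi_def by (intro has_sum_infsum wD_summable[where ?m0.0 = k and ?M0.0 = "k + 1"]) auto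
    then show ?thesis by (rule has_sum_cong_neutral[THEN iffD1, rotated -1]) auto
  qed
  have down: "((\<lambda>z. if fst z = k then 0 else wD (k - 1) k z) has_sum Psi c q r k (k - 1) (k - 1) k) ?A"
  proof -
    have "(wD (k - 1) k has_sum Psi c q r k (k - 1) (k - 1) k) ({..k - 1} \<times> {k..})"
      unfolding Psi_def by (intro has_sum_infsum wD_summable[where ?m0.0 = "k - 1" and ?M0.0 = k]) auto
    then show ?thesis by (rule has_sum_cong_neutral[THEN iffD1, rotated -1]) auto
  qed
  have "((\<lambda>z. 2 * c * wD k k z) has_sum (Psi c q r k (k + 1) k (k + 1) + Psi c q r k (k - 1) (k - 1) k)) ?A"
  proof (rule has_sum_cong[THEN iffD1, OF _ has_sum_add[OF up down]])
    fix z assume z: "z \<in> ?A"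
    then obtain m M where mM: "z = (m, M)" "m \<le> k" "k \<le> M" "m \<noteq> M"
      by (cases z) fastforce
    have "D c m M (k + 1) k = 0" if "M = k"
      using D_edge[OF c, of m k k] mM that by auto
    moreover have "D c m M (k - 1) k = 0" if "m = k"
      using D_edge[OF c, of "- M" "- k" "- k"] D_reflect[of c m M "k - 1" k] mM that
      by (auto simp: algebra_simps)
    ultimately show "(if snd z = k then 0 else wD (k + 1) k z) + (if fst z = k then 0 else wD (k - 1) k z)
       = 2 * c * wD k k z"
      using wD_harmonic[of z k k] mM by auto
  qed
  then have "2 * c * infsum (wD k k) ?A = Psi c q r k (k + 1) k (k + 1) + Psi c q r k (k - 1) (k - 1) k"
    unfolding infsum_cmult_right'[symmetric] by (rule infsumI)
  then show ?thesis using 1 c by (simp add: algebra_simps)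
qed

end

text \<open>A finite part of \<open>A\<close> carries all but \<open>e / 3\<close> of the dominating
  sum, which controls the tails of \<open>f n\<close> and of \<open>g\<close> alike. The filter is
  general because the lemma serves both sequences and \<open>at_right 1\<close>.\<close>

lemma infsum_dominated_convergence:
  fixes f :: "'n \<Rightarrow> 'i \<Rightarrow> real"
  assumes lim: "\<And>x. x \<in> A \<Longrightarrow> ((\<lambda>n. f n x) \<longlongrightarrow> g x) F"
    and bound: "\<forall>\<^sub>F n in F. \<forall>x\<in>A. \<bar>f n x\<bar> \<le> B x"
    and B: "B summable_on A"
  shows "((\<lambda>n. infsum (f n) A) \<longlongrightarrow> infsum g A) F"
proof (cases "F = bot")
  case False
  have bound_x: "\<forall>\<^sub>F n in F. \<bar>f n x\<bar> \<le> B x" if "x \<in> A" for x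
    using bound by eventually_elim (use that in blast)
  have g: "\<bar>g x\<bar> \<le> B x" if "x \<in> A" for x
    by (rule tendsto_upperbound[OF tendsto_rabs[OF lim[OF that]] bound_x[OF that] False])
  have abs: "(\<lambda>x. norm (u x)) summable_on A" if "\<And>x. x \<in> A \<Longrightarrow> \<bar>u x\<bar> \<le> B x" for u
    using B by (rule summable_on_comparison_test) (use that in auto)
  have tail: "\<bar>infsum u A - sum u X\<bar> \<le> infsum B A - sum B X"
    if u: "\<And>x. x \<in> A \<Longrightarrow> \<bar>u x\<bar> \<le> B x" and X: "finite X" "X \<subseteq> A" for u X
  proof -
    have s: "u summable_on A" by (rule abs_summable_summable[OF abs[OF u]])
    have d: "infsum v A - sum v X = infsum v (A - X)" if "v summable_on A" for v :: "'i \<Rightarrow> real"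
      using infsum_Un_disjoint[of v X "A - X"] X that summable_on_subset[OF that, of "A - X"]
      by (simp add: Un_absorb1)
    have "\<bar>infsum u (A - X)\<bar> \<le> infsum (\<lambda>x. \<bar>u x\<bar>) (A - X)"
      using norm_infsum_bound[of u "A - X"] summable_on_subset[OF abs[OF u], of "A - X"] by auto
    also have "\<dots> \<le> infsum B (A - X)"
      using summable_on_subset[OF abs[OF u], of "A - X"] summable_on_subset[OF B, of "A - X"] u
      by (intro infsum_mono) auto
    finally show ?thesis by (simp only: d[OF s] d[OF B])
  qed
  show ?thesis
  proof (rule tendstoI)
    fix e :: real assume e: "e > 0"
    obtain X where X: "finite X" "X \<subseteq> A" "infsum B A - sum B X < e / 3"
      using infsum_finite_approximation[OF B, of "e / 6"] e
      by (auto simp: dist_real_def abs_less_iff) (smt (verit) divide_pos_pos field_sum_of_halves)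
    have "((\<lambda>n. sum (f n) X) \<longlongrightarrow> sum g X) F" by (rule tendsto_sum) (use X lim in auto)
    then have "\<forall>\<^sub>F n in F. dist (sum (f n) X) (sum g X) < e / 3" using e by (intro tendstoD) auto
    with bound show "\<forall>\<^sub>F n in F. dist (infsum (f n) A) (infsum g A) < e"
    proof eventually_elim
      case (elim n)
      have "\<bar>infsum (f n) A - sum (f n) X\<bar> < e / 3" "\<bar>infsum g A - sum g X\<bar> < e / 3"
        using tail[of "f n" X] tail[of g X] elim g X by (auto intro: le_less_trans)
      with elim(2) show ?case unfolding dist_real_def by linarith
    qed
  qed
qed simp

context
  fixes c q r :: real
  assumes c: "c \<ge> 1" and q: "q > 1" and r: "r > 1"
begin

lemma Psi_lower:
  assumes "i < M0" "i \<le> k" "k \<le> M0"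
  shows "2 * c * Psi c q r k i i M0 = Psi c q r k (i - 1) (i - 1) M0 + Psi c q r k (i + 1) i M0
     + (if i < k then (Psi c q r k (i + 1) (i + 1) M0 - Psi c q r k (i + 1) i M0) / q else 0)"
  using Psi_upper[OF c r q, of "- M0" "- i" "- k"] assms
  by (simp add: Psi_reflect[of c r q] algebra_simps)

text \<open>The bound depends on \<open>k\<close> only, hence is uniform in the starting point; this
  makes the candidate for the Green function bounded.\<close>

lemma Psi_le_bound:
  assumes "m0 \<le> i" "m0 \<le> k" "i \<le> M0" "k \<le> M0"
  shows "Psi c q r k i m0 M0 \<le> 2 * infsum (\<lambda>(m, M). q powi m * r powi (- M)) ({..k} \<times> {k..})"
  unfolding Psi_def infsum_cmult_right'[symmetric]
proof (rule infsum_mono_neutral)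
  show "(\<lambda>z. 2 * (case z of (m, M) \<Rightarrow> q powi m * r powi - M)) summable_on {..k} \<times> {k..}"
    by (rule summable_on_cmult_right[OF weight_summable[OF c q r]])
  fix z assume z: "z \<in> {..m0} \<times> {M0..} \<inter> {..k} \<times> {k..}"
  then obtain m M where mM: "z = (m, M)" "m \<le> m0" "M0 \<le> M" by auto
  have "(q powi m * r powi - M) * D c m M i k \<le> (q powi m * r powi - M) * 2"
    using mM assms q r by (intro mult_left_mono D_le[OF c]) auto
  then show "(case z of (m, M) \<Rightarrow> q powi m * r powi - M * D c m M i k)
      \<le> 2 * (case z of (m, M) \<Rightarrow> q powi m * r powi - M)" using mM by simp
qed (use assms q r in \<open>auto intro!: wD_summable[OF c q r] simp: zero_le_mult_iff\<close>)

end

lemma D_continuous_at_1: "((\<lambda>c. D c m M i k) \<longlongrightarrow> D 1 m M i k) (at_right 1)" if "m \<le> M"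
proof (cases "m = M")
  case False
  have S: "((\<lambda>c. S c j) \<longlongrightarrow> S 1 j) (at_right 1)" for j
    by (rule tendsto_mono[OF at_le[OF subset_UNIV] isContD[OF continuous_S]])
  have "S 1 (M - m) > 0" "S 1 (M - m + 1) > 0" "S 1 (M - m + 2) > 0"
    using False that by (auto intro: S_pos)
  then show ?thesis using False unfolding D_def by (simp) (intro tendsto_intros S; simp)
qed (auto simp: D_def intro!: tendsto_eq_intros)

lemma Psi_continuous_at_1:
  assumes q: "q > 1" and r: "r > 1" and a: "m0 \<le> i" "m0 \<le> k" "i \<le> M0" "k \<le> M0"
  shows "((\<lambda>c. Psi c q r k i m0 M0) \<longlongrightarrow> Psi 1 q r k i m0 M0) (at_right 1)"
  unfolding Psi_def
proof (rule infsum_dominated_convergence)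
  show "(\<lambda>z. (case z of (m, M) \<Rightarrow> q powi m * r powi - M) * 2) summable_on {..m0} \<times> {M0..}"
    by (rule summable_on_cmult_left[OF weight_summable[OF order_refl q r]])
  have "\<forall>\<^sub>F c::real in at_right 1. c \<ge> 1" by (rule eventually_mono[OF eventually_at_right_less]) simp
  then show "\<forall>\<^sub>F c in at_right 1. \<forall>z\<in>{..m0} \<times> {M0..}. \<bar>case z of (m, M) \<Rightarrow> q powi m * r powi - M * D c m M i k\<bar>
      \<le> (case z of (m, M) \<Rightarrow> q powi m * r powi - M) * 2"
  proof eventually_elim
    case (elim c)
    show ?case
    proof
      fix z assume "z \<in> {..m0} \<times> {M0..}"
      then obtain m M where z: "z = (m, M)" "m \<le> m0" "M0 \<le> M" by auto
      then have "0 \<le> D c m M i k" "D c m M i k \<le> 2"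
        using a by (auto intro!: D_nonneg[OF elim] D_le[OF elim])
      then have "\<bar>D c m M i k\<bar> \<le> 2" by simp
      then show "\<bar>case z of (m, M) \<Rightarrow> q powi m * r powi - M * D c m M i k\<bar>
          \<le> (case z of (m, M) \<Rightarrow> q powi m * r powi - M) * 2"
        using q r z by (simp add: abs_mult)
    qed
  qed
  show "((\<lambda>c. case z of (m, M) \<Rightarrow> q powi m * r powi - M * D c m M i k)
     \<longlongrightarrow> (case z of (m, M) \<Rightarrow> q powi m * r powi - M * D 1 m M i k)) (at_right 1)"
    if "z \<in> {..m0} \<times> {M0..}" for z
    using that a by (auto intro!: tendsto_mult_left D_continuous_at_1)
qed

section \<open>The Green function\<close>

locale horocyclic_product = A: horo f1 h1 q + B: horo f2 h2 r
  for f1 :: "'a \<Rightarrow> 'a" and h1 q and f2 :: "'b \<Rightarrow> 'b" and h2 r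
begin

definition V :: "('a \<times> 'b) set" where "V = {(x1, x2). h1 x1 + h2 x2 = 0}"

lemma V_h2: "x \<in> V \<Longrightarrow> h2 (snd x) = - h1 (fst x)"
  by (auto simp: V_def)

abbreviation "ht x \<equiv> h1 (fst x)"

definition Q :: "('a \<times> 'b \<Rightarrow> real) \<Rightarrow> 'a \<times> 'b \<Rightarrow> real" where
  "Q u x = (\<Sum>z\<in>{z. f1 z = fst x}. u (z, f2 (snd x))) / real q
     + (\<Sum>z\<in>{z. f2 z = snd x}. u (f1 (fst x), z)) / real r"

definition m0 :: "'a \<times> 'b \<Rightarrow> 'a \<times> 'b \<Rightarrow> int" where "m0 x y = A.con (fst x) (fst y)"
definition M0 :: "'a \<times> 'b \<Rightarrow> 'a \<times> 'b \<Rightarrow> int" where "M0 x y = - B.con (snd x) (snd y)"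

definition PsiV :: "real \<Rightarrow> 'a \<times> 'b \<Rightarrow> 'a \<times> 'b \<Rightarrow> real" where
  "PsiV c y x = Psi c (real q) (real r) (ht y) (ht x) (m0 x y) (M0 x y)"

lemma q1: "real q > 1" and r1: "real r > 1"
  using A.p_ge_2 B.p_ge_2 by auto

lemma range:
  assumes "x \<in> V" "y \<in> V"
  shows "m0 x y \<le> ht x" "m0 x y \<le> ht y" "ht x \<le> M0 x y" "ht y \<le> M0 x y"
  using assms A.con_le1[of "fst x" "fst y"] A.con_le2[of "fst x" "fst y"]
    B.con_le1[of "snd x" "snd y"] B.con_le2[of "snd x" "snd y"]
  by (auto simp: m0_def M0_def V_h2)

lemma up_in_V: "x \<in> V \<Longrightarrow> f1 z = fst x \<Longrightarrow> (z, f2 (snd x)) \<in> V"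
  using A.h_f[of z] by (auto simp: V_def)

lemma down_in_V: "x \<in> V \<Longrightarrow> f2 z = snd x \<Longrightarrow> (f1 (fst x), z) \<in> V"
  using B.h_f[of z] by (auto simp: V_def)

text \<open>Going to a child in the first tree means going to the father in the second, which
  replaces \<open>M0\<close> by its maximum with the new height. In the first tree the confluent
  changes only if \<open>fst x\<close> is a proper ancestor of \<open>fst y\<close>, and then for
  exactly one of the \<open>q\<close> children.\<close>

lemma up_average:
  assumes x: "x \<in> V" and y: "y \<in> V"
  shows "(\<Sum>z\<in>{z. f1 z = fst x}. PsiV c y (z, f2 (snd x))) / real q =
    Psi c q r (ht y) (ht x + 1) (m0 x y) (max (M0 x y) (ht x + 1)) +
    (if m0 x y = ht x \<and> ht x < ht y then (Psi c q r (ht y) (ht x + 1) (ht x + 1) (max (M0 x y) (ht x + 1))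
      - Psi c q r (ht y) (ht x + 1) (ht x) (max (M0 x y) (ht x + 1))) / real q else 0)"
proof -
  let ?M = "max (M0 x y) (ht x + 1)"
  have "M0 (z, f2 (snd x)) y = ?M" for z
    using x B.con_f[of "snd x" "snd y"] by (simp add: M0_def V_h2)
  moreover have "h1 z = ht x + 1" if "f1 z = fst x" for z using A.h_f[of z] that by simp
  ultimately have Psi: "PsiV c y (z, f2 (snd x)) = Psi c q r (ht y) (ht x + 1) (A.con z (fst y)) ?M"
    if "f1 z = fst x" for z using that by (simp add: PsiV_def m0_def)
  show ?thesis
  proof (cases "m0 x y = ht x \<and> ht x < ht y")
    case True
    let ?z = "A.anc (ht x + 1) (fst y)"
    from True have con: "A.con (fst x) (fst y) = h1 (fst x)" by (simp add: m0_def)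
    have z: "f1 ?z = fst x" by (rule A.f_anc_Suc) (use True con in auto)
    have "(\<Sum>z\<in>{z. f1 z = fst x}. PsiV c y (z, f2 (snd x)))
      = Psi c q r (ht y) (ht x + 1) (ht x + 1) ?M + (real q - 1) * Psi c q r (ht y) (ht x + 1) (ht x) ?M"
      using A.sum_children_split[OF z, of "\<lambda>z. PsiV c y (z, f2 (snd x))"] True con
        A.con_child_eq[OF _ con] Psi z by simp
    then show ?thesis using True q1 by (simp add: field_simps)
  next
    case False
    have "A.con z (fst y) = m0 x y" if z: "f1 z = fst x" for z
    proof (cases "m0 x y = ht x")
      case True
      with False have "h1 (fst y) = h1 (fst x)" using range[OF x y] by linarith
      with True show ?thesis using A.con_child_ge[OF z] by (simp add: m0_def)
    next
      case False
      then have "A.con (fst x) (fst y) < h1 (fst x)" using range[OF x y] by (simp add: m0_def)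
      then show ?thesis using A.con_child_lt[OF z] by (simp add: m0_def)
    qed
    then have "(\<Sum>z\<in>{z. f1 z = fst x}. PsiV c y (z, f2 (snd x))) = real q * Psi c q r (ht y) (ht x + 1) (m0 x y) ?M"
      using Psi by (intro A.sum_children_const) auto
    then show ?thesis using False q1 by auto
  qed
qed

lemma down_average:
  assumes x: "x \<in> V" and y: "y \<in> V"
  shows "(\<Sum>z\<in>{z. f2 z = snd x}. PsiV c y (f1 (fst x), z)) / real r =
    Psi c q r (ht y) (ht x - 1) (min (m0 x y) (ht x - 1)) (M0 x y) +
    (if M0 x y = ht x \<and> ht y < ht x then (Psi c q r (ht y) (ht x - 1) (min (m0 x y) (ht x - 1)) (ht x - 1)
      - Psi c q r (ht y) (ht x - 1) (min (m0 x y) (ht x - 1)) (ht x)) / real r else 0)"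
proof -
  let ?m = "min (m0 x y) (ht x - 1)"
  have Psi: "PsiV c y (f1 (fst x), z) = Psi c q r (ht y) (ht x - 1) ?m (- B.con z (snd y))" for z
    using A.con_f[of "fst x" "fst y"] by (simp add: PsiV_def m0_def M0_def)
  show ?thesis
  proof (cases "M0 x y = ht x \<and> ht y < ht x")
    case True
    let ?z = "B.anc (h2 (snd x) + 1) (snd y)"
    from True have con: "B.con (snd x) (snd y) = h2 (snd x)" using x by (simp add: M0_def V_h2)
    have lt: "h2 (snd x) < h2 (snd y)" using True x y by (simp add: V_h2)
    have z: "f2 ?z = snd x" by (rule B.f_anc_Suc) (use lt con in auto)
    have "(\<Sum>z\<in>{z. f2 z = snd x}. PsiV c y (f1 (fst x), z))
      = Psi c q r (ht y) (ht x - 1) ?m (ht x - 1) + (real r - 1) * Psi c q r (ht y) (ht x - 1) ?m (ht x)"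
      using B.sum_children_split[OF z, of "\<lambda>z. PsiV c y (f1 (fst x), z)"]
        B.con_child_eq[OF _ con lt] Psi z x by (simp add: V_h2)
    then show ?thesis using True r1 by (simp add: field_simps)
  next
    case False
    have "B.con z (snd y) = - M0 x y" if z: "f2 z = snd x" for z
    proof (cases "M0 x y = ht x")
      case True
      with False have "h2 (snd y) = h2 (snd x)" using range[OF x y] x y by (simp add: V_h2)
      with True show ?thesis using B.con_child_ge[OF z] x by (simp add: M0_def V_h2)
    next
      case False
      then have "B.con (snd x) (snd y) < h2 (snd x)" using range[OF x y] x by (simp add: M0_def V_h2)
      then show ?thesis using B.con_child_lt[OF z] by (simp add: M0_def)
    qed
    then have "(\<Sum>z\<in>{z. f2 z = snd x}. PsiV c y (f1 (fst x), z)) = real r * Psi c q r (ht y) (ht x - 1) ?m (M0 x y)"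
      using Psi by (intro B.sum_children_const) auto
    then show ?thesis using False r1 by auto
  qed
qed

lemma V_eq_iff:
  assumes "x \<in> V" "y \<in> V"
  shows "m0 x y = ht x \<and> M0 x y = ht x \<longleftrightarrow> x = y"
proof
  assume a: "m0 x y = ht x \<and> M0 x y = ht x"
  then have "ht y = ht x" using range[OF assms] by auto
  moreover have "h2 (snd y) = h2 (snd x)" using calculation assms by (simp add: V_h2)
  moreover have "A.con (fst x) (fst y) = h1 (fst x)" "B.con (snd x) (snd y) = h2 (snd x)"
    using a assms by (simp_all add: m0_def M0_def V_h2)
  ultimately have "fst x = fst y" "snd x = snd y"
    by (metis A.con_eq_h A.anc_self, metis B.con_eq_h B.anc_self)
  then show "x = y" by (rule prod_eqI)
qed (use assms in \<open>auto simp: m0_def M0_def V_h2\<close>)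

text \<open>The four cases say in which of the trees \<open>x\<close> is an ancestor of
  \<open>y\<close>. If this holds in both, opposite heights force \<open>x = y\<close>, and the
  source appears.\<close>

lemma Q_PsiV:
  assumes c: "c \<ge> 1" and x: "x \<in> V" and y: "y \<in> V"
  shows "2 * c * PsiV c y x = Q (PsiV c y) x
    + (if x = y then real q powi ht y * real r powi (- ht y) else 0)"
proof -
  note rg = range[OF x y]
  have Q: "Q (PsiV c y) x = (\<Sum>z\<in>{z. f1 z = fst x}. PsiV c y (z, f2 (snd x))) / real q
    + (\<Sum>z\<in>{z. f2 z = snd x}. PsiV c y (f1 (fst x), z)) / real r" by (simp add: Q_def)
  consider "m0 x y < ht x" "ht x < M0 x y" | "m0 x y < ht x" "M0 x y = ht x"
    | "m0 x y = ht x" "ht x < M0 x y" | "m0 x y = ht x" "M0 x y = ht x" using rg by linarith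
  then show ?thesis
  proof cases
    case 1
    moreover have "x \<noteq> y" using V_eq_iff[OF x y] 1 by auto
    moreover have "max (M0 x y) (ht x + 1) = M0 x y" "min (m0 x y) (ht x - 1) = m0 x y" using 1 by auto
    ultimately show ?thesis unfolding Q up_average[OF x y] down_average[OF x y]
      using Psi_interior[OF c q1 r1 1 rg(2,4)] by (simp add: PsiV_def)
  next
    case 2
    moreover have "x \<noteq> y" using V_eq_iff[OF x y] 2 by auto
    moreover have "max (M0 x y) (ht x + 1) = ht x + 1" "min (m0 x y) (ht x - 1) = m0 x y" using 2 by auto
    ultimately show ?thesis unfolding Q up_average[OF x y] down_average[OF x y]
      using Psi_upper[OF c q1 r1 2(1) rg(2)] rg by (auto simp: PsiV_def)
  next
    case 3
    moreover have "x \<noteq> y" using V_eq_iff[OF x y] 3 by auto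
    moreover have "max (M0 x y) (ht x + 1) = M0 x y" "min (m0 x y) (ht x - 1) = ht x - 1" using 3 by auto
    ultimately show ?thesis unfolding Q up_average[OF x y] down_average[OF x y]
      using Psi_lower[OF c q1 r1 3(2)] rg by (auto simp: PsiV_def)
  next
    case 4
    then have eq: "x = y" using V_eq_iff[OF x y] by auto
    with 4 have mM: "m0 y y = ht y" "M0 y y = ht y" by auto
    show ?thesis unfolding Q up_average[OF x y] down_average[OF x y]
      using Psi_diagonal[OF c q1 r1, of "ht y"] mM by (simp add: PsiV_def eq)
  qed
qed

section \<open>Powers of \<open>Q\<close> and the Green series\<close>

lemma Q_cong: "x \<in> V \<Longrightarrow> (\<And>z. z \<in> V \<Longrightarrow> u z = v z) \<Longrightarrow> Q u x = Q v x"
  unfolding Q_def by (auto intro!: arg_cong2[of _ _ _ _ "(+)"] arg_cong2[of _ _ _ _ "(/)"] sum.cong up_in_V down_in_V)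

lemma Q_mono: "x \<in> V \<Longrightarrow> (\<And>z. z \<in> V \<Longrightarrow> u z \<le> v z) \<Longrightarrow> Q u x \<le> Q v x"
  unfolding Q_def by (auto intro!: add_mono divide_right_mono sum_mono up_in_V down_in_V)

lemma Q_add: "Q (\<lambda>z. u z + v z) x = Q u x + Q v x"
  by (simp add: Q_def sum.distrib add_divide_distrib)

lemma Q_cmult: "Q (\<lambda>z. a * u z) x = a * Q u x"
  by (simp add: Q_def sum_distrib_left[symmetric] distrib_left)

lemma Q_const: "Q (\<lambda>z. a) x = 2 * a"
  using q1 r1 by (simp add: Q_def A.card_children B.card_children)

lemma Qn_cong: "x \<in> V \<Longrightarrow> (\<And>z. z \<in> V \<Longrightarrow> u z = v z) \<Longrightarrow> (Q ^^ n) u x = (Q ^^ n) v x"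
  by (induction n arbitrary: x) (auto intro: Q_cong)

lemma Qn_mono: "x \<in> V \<Longrightarrow> (\<And>z. z \<in> V \<Longrightarrow> u z \<le> v z) \<Longrightarrow> (Q ^^ n) u x \<le> (Q ^^ n) v x"
  by (induction n arbitrary: x) (auto intro: Q_mono)

lemma Qn_add: "(Q ^^ n) (\<lambda>z. u z + v z) x = (Q ^^ n) u x + (Q ^^ n) v x"
  by (induction n arbitrary: x) (auto simp: Q_add[symmetric] intro!: arg_cong[where f = "\<lambda>u. Q u _"])

lemma Qn_cmult: "(Q ^^ n) (\<lambda>z. a * u z) x = a * (Q ^^ n) u x"
  by (induction n arbitrary: x) (auto simp: Q_cmult[symmetric] intro!: arg_cong[where f = "\<lambda>u. Q u _"])

lemma Qn_const: "(Q ^^ n) (\<lambda>z. a) x = 2 ^ n * a"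
proof (induction n arbitrary: x)
  case (Suc n)
  then have "(Q ^^ n) (\<lambda>z. a) = (\<lambda>x. 2 ^ n * a)" by auto
  then show ?case by (simp add: Q_const)
qed simp

abbreviation delta :: "'a \<times> 'b \<Rightarrow> 'a \<times> 'b \<Rightarrow> real" where "delta y \<equiv> \<lambda>x. of_bool (x = y)"

lemma Qn_nonneg: "x \<in> V \<Longrightarrow> (\<And>z. z \<in> V \<Longrightarrow> 0 \<le> u z) \<Longrightarrow> 0 \<le> (Q ^^ n) u x"
  using Qn_mono[of x "\<lambda>_. 0" u n] by (simp add: Qn_const)

lemma Qn_delta_nonneg: "x \<in> V \<Longrightarrow> 0 \<le> (Q ^^ n) (delta y) x"
  by (rule Qn_nonneg) auto

lemma Qn_delta_le: "x \<in> V \<Longrightarrow> (Q ^^ n) (delta y) x \<le> 2 ^ n"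
  using Qn_mono[of x "delta y" "\<lambda>_. 1" n] by (simp add: Qn_const)

text \<open>A single term of the Chapman-Kolmogorov sum.\<close>

lemma Qn_semigroup:
  assumes "x \<in> V" "z \<in> V"
  shows "(Q ^^ n) (delta z) x * (Q ^^ l) (delta y) z \<le> (Q ^^ (n + l)) (delta y) x"
proof -
  have "(Q ^^ n) (\<lambda>w. (Q ^^ l) (delta y) z * delta z w) x \<le> (Q ^^ n) ((Q ^^ l) (delta y)) x"
    using assms by (intro Qn_mono) (auto simp: Qn_delta_nonneg)
  then show ?thesis unfolding Qn_cmult by (simp add: funpow_add mult.commute)
qed

text \<open>The candidate for the sum of \<open>Q ^^ n / (2 * c) ^ n\<close>, formally
  \<open>2 * c\<close> times the inverse of \<open>2 * c - Q\<close>. The denominator is the source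
  in \<open>Q_PsiV\<close>.\<close>

definition g :: "real \<Rightarrow> 'a \<times> 'b \<Rightarrow> 'a \<times> 'b \<Rightarrow> real" where
  "g c y x = 2 * c * PsiV c y x / (real q powi ht y * real r powi (- ht y))"

lemma PsiV_pos: "c \<ge> 1 \<Longrightarrow> x \<in> V \<Longrightarrow> y \<in> V \<Longrightarrow> 0 < PsiV c y x"
  unfolding PsiV_def by (intro Psi_pos q1 r1 range)

lemma g_pos: "c \<ge> 1 \<Longrightarrow> x \<in> V \<Longrightarrow> y \<in> V \<Longrightarrow> 0 < g c y x"
  using q1 r1 by (auto simp: g_def intro!: divide_pos_pos mult_pos_pos PsiV_pos)

lemma divide_step:
  fixes X :: real
  shows "X = Y + inverse w * Z \<Longrightarrow> w \<noteq> 0 \<Longrightarrow> p \<noteq> 0 \<Longrightarrow> X / p = Y / p + Z / (w * p)"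
  by (simp add: field_simps)

text \<open>Iterates the identity that \<open>g\<close> is \<open>delta\<close> plus
  \<open>Q g / (2 * c)\<close>. Whether the remainder vanishes decides if \<open>g\<close> is the
  Green function or differs from it by a harmonic function.\<close>

lemma g_expansion:
  assumes c: "c \<ge> 1" and y: "y \<in> V" and x: "x \<in> V"
  shows "g c y x = (\<Sum>n<N. (Q ^^ n) (delta y) x / (2 * c) ^ n) + (Q ^^ N) (g c y) x / (2 * c) ^ N"
proof (induction N)
  case (Suc N)
  define K where "K = real q powi ht y * real r powi (- ht y)"
  have K: "K > 0" using q1 r1 by (simp add: K_def)
  have step: "g c y z = delta y z + inverse (2 * c) * Q (g c y) z" if "z \<in> V" for z
  proof -
    have "2 * c * PsiV c y z = Q (PsiV c y) z + (if z = y then K else 0)"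
      using Q_PsiV[OF c that y] by (simp add: K_def)
    then have "2 * c * PsiV c y z / K = Q (PsiV c y) z / K + delta y z"
      using K by (auto simp: add_divide_distrib)
    moreover have "Q (g c y) z = 2 * c / K * Q (PsiV c y) z"
      unfolding Q_cmult[symmetric] by (simp add: g_def[abs_def] K_def)
    ultimately show ?thesis using c by (simp add: g_def K_def[symmetric] field_simps)
  qed
  have "(Q ^^ N) (g c y) x = (Q ^^ N) (\<lambda>z. delta y z + inverse (2 * c) * Q (g c y) z) x"
    by (rule Qn_cong[OF x step])
  also have "\<dots> = (Q ^^ N) (delta y) x + inverse (2 * c) * (Q ^^ N) (Q (g c y)) x"
    by (simp only: Qn_add Qn_cmult)
  also have "(Q ^^ N) (Q (g c y)) x = (Q ^^ Suc N) (g c y) x" by (simp only: funpow_Suc_right comp_def)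
  finally have E: "(Q ^^ N) (g c y) x = (Q ^^ N) (delta y) x + inverse (2 * c) * (Q ^^ Suc N) (g c y) x" .
  have "(Q ^^ N) (g c y) x / (2 * c) ^ N = (Q ^^ N) (delta y) x / (2 * c) ^ N
     + (Q ^^ Suc N) (g c y) x / (2 * c) ^ Suc N"
    unfolding power_Suc[of "2 * c" N] by (rule divide_step[OF E]) (use c in auto)
  then show ?case unfolding sum.lessThan_Suc using Suc.IH by linarith
qed simp

text \<open>\<open>g\<close> is bounded and \<open>Q\<close> doubles constants, so the remainder is
  of order \<open>inverse c ^ N\<close>.\<close>

lemma g_sums_gt:
  assumes c: "c > 1" and y: "y \<in> V" and x: "x \<in> V"
  shows "(\<lambda>n. (Q ^^ n) (delta y) x / (2 * c) ^ n) sums g c y x"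
proof -
  have c': "c \<ge> 1" using c by simp
  define K where "K = real q powi ht y * real r powi (- ht y)"
  define B where "B = 2 * c * (2 * infsum (\<lambda>(m, M). real q powi m * real r powi (- M)) ({..ht y} \<times> {ht y..})) / K"
  have K: "K > 0" using q1 r1 by (simp add: K_def)
  have B: "g c y z \<le> B" if "z \<in> V" for z
    unfolding g_def B_def PsiV_def K_def[symmetric]
    using K c by (intro divide_right_mono mult_left_mono Psi_le_bound[OF c' q1 r1 range[OF that y]]) auto
  have "(\<lambda>N. (Q ^^ N) (g c y) x / (2 * c) ^ N) \<longlonglongrightarrow> 0"
  proof (rule tendsto_sandwich[of "\<lambda>_. 0" _ _ "\<lambda>N. inverse c ^ N * B"])
    show "\<forall>\<^sub>F N in sequentially. 0 \<le> (Q ^^ N) (g c y) x / (2 * c) ^ N"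
      using c by (intro always_eventually allI divide_nonneg_nonneg Qn_nonneg x less_imp_le g_pos[OF c' _ y]) auto
    show "\<forall>\<^sub>F N in sequentially. (Q ^^ N) (g c y) x / (2 * c) ^ N \<le> inverse c ^ N * B"
    proof (intro always_eventually allI)
      fix N
      have "(Q ^^ N) (g c y) x \<le> 2 ^ N * B" using Qn_mono[of x "g c y" "\<lambda>_. B" N] x B by (simp add: Qn_const)
      then have "(Q ^^ N) (g c y) x / (2 * c) ^ N \<le> 2 ^ N * B / (2 * c) ^ N"
        using c by (intro divide_right_mono) auto
      also have "\<dots> = inverse c ^ N * B" using c by (simp add: power_mult_distrib power_inverse divide_inverse)
      finally show "(Q ^^ N) (g c y) x / (2 * c) ^ N \<le> inverse c ^ N * B" .
    qed
    show "(\<lambda>N. inverse c ^ N * B) \<longlonglongrightarrow> 0"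
      using c by (intro tendsto_mult_left_zero LIMSEQ_power_zero) (auto simp: inverse_less_1_iff)
  qed simp
  then have "(\<lambda>N. g c y x - (Q ^^ N) (g c y) x / (2 * c) ^ N) \<longlonglongrightarrow> g c y x - 0"
    by (intro tendsto_intros)
  moreover have "g c y x - (Q ^^ N) (g c y) x / (2 * c) ^ N = (\<Sum>n<N. (Q ^^ n) (delta y) x / (2 * c) ^ n)" for N
    using g_expansion[OF c' y x, of N] by linarith
  ultimately show ?thesis by (simp add: sums_def)
qed

text \<open>At the spectral radius the remainder in the expansion is not geometrically small; instead,
  let the eigenvalue decrease to the spectral radius.\<close>

lemma g_sums:
  assumes c: "c \<ge> 1" and y: "y \<in> V" and x: "x \<in> V"
  shows "(\<lambda>n. (Q ^^ n) (delta y) x / (2 * c) ^ n) sums g c y x"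
proof (cases "c = 1")
  case True
  let ?a = "\<lambda>n. (Q ^^ n) (delta y) x / 2 ^ n"
  have a: "?a n \<ge> 0" for n using Qn_delta_nonneg[OF x] by simp
  have part: "(\<Sum>n<N. ?a n) \<le> g 1 y x" for N
  proof -
    have "0 \<le> (Q ^^ N) (g 1 y) x" using g_pos[OF order_refl _ y] by (intro Qn_nonneg x less_imp_le)
    then show ?thesis using g_expansion[OF order_refl y x, of N] by simp
  qed
  have sm: "summable ?a" using a part by (intro summableI_nonneg_bounded[of _ "g 1 y x"]) auto
  have "suminf ?a \<le> g 1 y x" by (rule suminf_le_const[OF sm part])
  \<comment> \<open>For larger \<open>c\<close> each term of the series is smaller and the sum is
    already known to be \<open>g c y x\<close>; right continuity of \<open>g\<close> at 1 carries
    the inequality over.\<close>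
  moreover have "g 1 y x \<le> suminf ?a"
  proof (rule tendsto_upperbound)
    show "((\<lambda>c. g c y x) \<longlongrightarrow> g 1 y x) (at_right 1)"
      unfolding g_def PsiV_def using q1 r1
      by (intro tendsto_intros Psi_continuous_at_1 range[OF x y]) auto
    have "g c y x \<le> suminf ?a" if c: "c > 1" for c
    proof -
      note s = g_sums_gt[OF c y x]
      have "suminf (\<lambda>n. (Q ^^ n) (delta y) x / (2 * c) ^ n) \<le> suminf ?a"
      proof (rule suminf_le[OF _ sums_summable[OF s] sm])
        fix n
        have "(2::real) ^ n \<le> (2 * c) ^ n" using c by (intro power_mono) auto
        then show "(Q ^^ n) (delta y) x / (2 * c) ^ n \<le> ?a n"
          using Qn_delta_nonneg[OF x] c by (intro divide_left_mono) auto
      qed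
      then show ?thesis using sums_unique[OF s] by simp
    qed
    then show "\<forall>\<^sub>F c in at_right 1. g c y x \<le> suminf ?a"
      by (intro eventually_mono[OF eventually_at_right_less]) auto
  qed simp
  ultimately have "suminf ?a = g 1 y x" by simp
  with sm show ?thesis unfolding True by (simp add: sums_iff)
next
  case False
  with c show ?thesis by (intro g_sums_gt y x) auto
qed


section \<open>Reduction of the walk to \<open>Q\<close>\<close>

definition P :: "real \<Rightarrow> 'a \<times> 'b \<Rightarrow> 'a \<times> 'b \<Rightarrow> real" where
  "P \<alpha> x y = (if f1 (fst y) = fst x \<and> snd y = f2 (snd x) then \<alpha> / real q
     else if fst y = f1 (fst x) \<and> f2 (snd y) = snd x then (1 - \<alpha>) / real r else 0)"

lemma infsum_P:
  assumes x: "x \<in> V"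
  shows "(\<Sum>\<^sub>\<infinity>z\<in>V. P \<alpha> x z * u z) =
    \<alpha> * ((\<Sum>z\<in>{z. f1 z = fst x}. u (z, f2 (snd x))) / real q)
    + (1 - \<alpha>) * ((\<Sum>z\<in>{z. f2 z = snd x}. u (f1 (fst x), z)) / real r)"
proof -
  let ?U = "(\<lambda>z. (z, f2 (snd x))) ` {z. f1 z = fst x}" and ?D = "Pair (f1 (fst x)) ` {z. f2 z = snd x}"
  have fin: "finite ?U" "finite ?D" using A.finite_children B.finite_children by auto
  \<comment> \<open>Hence the first test in \<open>P\<close> fails at the downward neighbours, and
    the two kinds of neighbours are disjoint.\<close>
  have down: "f1 (f1 (fst x)) \<noteq> fst x"
  proof
    assume "f1 (f1 (fst x)) = fst x"
    from arg_cong[OF this, of h1] show False by simp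
  qed
  have "(\<Sum>\<^sub>\<infinity>z\<in>V. P \<alpha> x z * u z) = (\<Sum>\<^sub>\<infinity>z\<in>?U \<union> ?D. P \<alpha> x z * u z)"
    by (rule infsum_cong_neutral) (use up_in_V[OF x] down_in_V[OF x] in \<open>auto simp: P_def split: if_splits\<close>)
  also have "\<dots> = (\<Sum>z\<in>?U. P \<alpha> x z * u z) + (\<Sum>z\<in>?D. P \<alpha> x z * u z)"
    using fin down by (subst infsum_finite) (auto intro!: sum.union_disjoint)
  also have "(\<Sum>z\<in>?U. P \<alpha> x z * u z) = (\<Sum>z\<in>{z. f1 z = fst x}. \<alpha> / real q * u (z, f2 (snd x)))"
    by (subst sum.reindex) (auto simp: inj_on_def P_def intro!: sum.cong)
  also have "(\<Sum>z\<in>?D. P \<alpha> x z * u z) = (\<Sum>z\<in>{z. f2 z = snd x}. (1 - \<alpha>) / real r * u (f1 (fst x), z))"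
    by (subst sum.reindex) (auto simp: inj_on_def P_def down intro!: sum.cong)
  finally show ?thesis by (simp add: sum_distrib_left sum_divide_distrib)
qed

text \<open>Each step changes the height by one, so the conjugation multiplies the upward weight and
  divides the downward weight by the same number. With this choice both become
  \<open>sqrt (\<alpha> * (1 - \<alpha>))\<close>.\<close>

lemma nstep_eq:
  assumes \<alpha>: "0 < \<alpha>" "\<alpha> < 1" and x: "x \<in> V"
  shows "nstep V (P \<alpha>) n x y =
    sqrt (\<alpha> * (1 - \<alpha>)) ^ n * sqrt ((1 - \<alpha>) / \<alpha>) powi (ht x - ht y) * (Q ^^ n) (delta y) x"
  using x
proof (induction n arbitrary: x)
  case (Suc n)
  define \<sigma> where "\<sigma> = sqrt (\<alpha> * (1 - \<alpha>))"
  define \<gamma> where "\<gamma> = sqrt ((1 - \<alpha>) / \<alpha>)"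
  have \<gamma>: "\<gamma> > 0" using \<alpha> by (simp add: \<gamma>_def)
  have \<sigma>\<gamma>: "\<alpha> * \<gamma> = \<sigma>" "(1 - \<alpha>) / \<gamma> = \<sigma>"
  proof -
    define a b where "a = sqrt \<alpha>" and "b = sqrt (1 - \<alpha>)"
    have "a > 0" "b > 0" "\<alpha> = a * a" "1 - \<alpha> = b * b" using \<alpha> by (auto simp: a_def b_def)
    moreover have "\<sigma> = a * b" "\<gamma> = b / a"
      by (simp_all add: \<sigma>_def \<gamma>_def a_def b_def real_sqrt_mult real_sqrt_divide)
    ultimately show "\<alpha> * \<gamma> = \<sigma>" "(1 - \<alpha>) / \<gamma> = \<sigma>" by simp_all
  qed
  let ?q = "(Q ^^ n) (delta y)" and ?C = "\<lambda>j. \<sigma> ^ n * \<gamma> powi (j - ht y)"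
  have IH: "nstep V (P \<alpha>) n z y = ?C (ht z) * ?q z" if "z \<in> V" for z
    using Suc.IH[OF that] by (simp add: \<sigma>_def \<gamma>_def)
  have up: "(\<Sum>z\<in>{z. f1 z = fst x}. nstep V (P \<alpha>) n (z, f2 (snd x)) y)
      = ?C (ht x + 1) * (\<Sum>z\<in>{z. f1 z = fst x}. ?q (z, f2 (snd x)))"
    unfolding sum_distrib_left
  proof (rule sum.cong)
    fix z assume "z \<in> {z. f1 z = fst x}"
    then have z: "f1 z = fst x" by simp
    then have "h1 z = ht x + 1" using A.h_f[of z] by simp
    then show "nstep V (P \<alpha>) n (z, f2 (snd x)) y = ?C (ht x + 1) * ?q (z, f2 (snd x))"
      using IH[OF up_in_V[OF Suc.prems z]] by simp
  qed simp
  have down: "(\<Sum>z\<in>{z. f2 z = snd x}. nstep V (P \<alpha>) n (f1 (fst x), z) y)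
      = ?C (ht x - 1) * (\<Sum>z\<in>{z. f2 z = snd x}. ?q (f1 (fst x), z))"
    unfolding sum_distrib_left
  proof (rule sum.cong)
    fix z assume "z \<in> {z. f2 z = snd x}"
    then have z: "f2 z = snd x" by simp
    show "nstep V (P \<alpha>) n (f1 (fst x), z) y = ?C (ht x - 1) * ?q (f1 (fst x), z)"
      using IH[OF down_in_V[OF Suc.prems z]] by simp
  qed simp
  have C: "\<alpha> * ?C (ht x + 1) = \<sigma> ^ Suc n * \<gamma> powi (ht x - ht y)"
    "(1 - \<alpha>) * ?C (ht x - 1) = \<sigma> ^ Suc n * \<gamma> powi (ht x - ht y)"
  proof -
    have e: "ht x + 1 - ht y = ht x - ht y + 1" "ht x - 1 - ht y = ht x - ht y - 1" by simp_all
    have p: "\<gamma> powi (ht x + 1 - ht y) = \<gamma> powi (ht x - ht y) * \<gamma>"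
      "\<gamma> powi (ht x - 1 - ht y) = \<gamma> powi (ht x - ht y) / \<gamma>"
      using \<gamma> unfolding e by (auto simp: power_int_add power_int_diff)
    have "\<alpha> * ?C (ht x + 1) = \<sigma> ^ n * \<gamma> powi (ht x - ht y) * (\<alpha> * \<gamma>)" unfolding p by simp
    then show "\<alpha> * ?C (ht x + 1) = \<sigma> ^ Suc n * \<gamma> powi (ht x - ht y)" unfolding \<sigma>\<gamma> by (simp add: mult_ac)
    have "(1 - \<alpha>) * ?C (ht x - 1) = \<sigma> ^ n * \<gamma> powi (ht x - ht y) * ((1 - \<alpha>) / \<gamma>)" unfolding p by simp
    then show "(1 - \<alpha>) * ?C (ht x - 1) = \<sigma> ^ Suc n * \<gamma> powi (ht x - ht y)" unfolding \<sigma>\<gamma> by (simp add: mult_ac)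
  qed
  have "nstep V (P \<alpha>) (Suc n) x y =
      (\<alpha> * ?C (ht x + 1)) * ((\<Sum>z\<in>{z. f1 z = fst x}. ?q (z, f2 (snd x))) / real q)
      + ((1 - \<alpha>) * ?C (ht x - 1)) * ((\<Sum>z\<in>{z. f2 z = snd x}. ?q (f1 (fst x), z)) / real r)"
    by (simp add: infsum_P[OF Suc.prems] up down)
  also have "\<dots> = \<sigma> ^ Suc n * \<gamma> powi (ht x - ht y) * (Q ^^ Suc n) (delta y) x"
    unfolding C by (simp add: Q_def distrib_left)
  finally show ?case by (simp add: \<sigma>_def \<gamma>_def)
qed simp

lemma Green_eq:
  assumes \<alpha>: "0 < \<alpha>" "\<alpha> < 1" and c: "c \<ge> 1" and x: "x \<in> V" and y: "y \<in> V"
  shows "Green V (P \<alpha>) (2 * c * sqrt (\<alpha> * (1 - \<alpha>))) x y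
     = sqrt ((1 - \<alpha>) / \<alpha>) powi (ht x - ht y) * g c y x"
proof -
  have gen: "\<sigma> ^ n * G * X / (2 * c * \<sigma>) ^ n = G * (X / (2 * c) ^ n)" if "\<sigma> > 0" for \<sigma> G X :: real and n
    using that by (simp add: power_mult_distrib)
  have "sqrt (\<alpha> * (1 - \<alpha>)) > 0" using \<alpha> by simp
  then have "nstep V (P \<alpha>) n x y / (2 * c * sqrt (\<alpha> * (1 - \<alpha>))) ^ n
      = sqrt ((1 - \<alpha>) / \<alpha>) powi (ht x - ht y) * ((Q ^^ n) (delta y) x / (2 * c) ^ n)" for n
    unfolding nstep_eq[OF \<alpha> x] by (rule gen)
  then show ?thesis unfolding Green_def
    using sums_mult[OF g_sums[OF c y x], of "sqrt ((1 - \<alpha>) / \<alpha>) powi (ht x - ht y)"]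
    by (simp add: sums_iff)
qed

lemma quotient_cancel:
  fixes c :: real
  shows "a = e * b \<Longrightarrow> b > 0 \<Longrightarrow> K > 0 \<Longrightarrow> c \<ge> 1 \<Longrightarrow> a * (2 * c * X / K) / (b * (2 * c * Y / K)) = e * (X / Y)"
  by simp

text \<open>All factors depending on \<open>y\<close> cancel. The conjugation leaves a nonzero
  factor depending on \<open>x\<close> alone, which affects neither convergence nor
  separation.\<close>

lemma Martin_kernel_eq:
  assumes \<alpha>: "0 < \<alpha>" "\<alpha> < 1" and c: "c \<ge> 1" and x: "x \<in> V" and y: "y \<in> V" and o: "o' \<in> V" "ht o' = 0"
  shows "Martin_kernel V (P \<alpha>) o' (2 * c * sqrt (\<alpha> * (1 - \<alpha>))) x y
     = sqrt ((1 - \<alpha>) / \<alpha>) powi ht x * (PsiV c y x / PsiV c y o')"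
proof -
  define \<gamma> where "\<gamma> = sqrt ((1 - \<alpha>) / \<alpha>)"
  have \<gamma>: "\<gamma> > 0" using \<alpha> by (simp add: \<gamma>_def)
  have K: "real q powi ht y * real r powi (- ht y) > 0" using q1 r1 by simp
  have "\<gamma> powi (ht x - ht y) = \<gamma> powi ht x * \<gamma> powi (- ht y)"
    using \<gamma> power_int_add[of \<gamma> "ht x" "- ht y"] by simp
  moreover have "\<gamma> powi (- ht y) > 0" using \<gamma> by simp
  ultimately show ?thesis
    unfolding Martin_kernel_def Green_eq[OF \<alpha> c x y] Green_eq[OF \<alpha> c o(1) y] g_def o(2) \<gamma>_def[symmetric]
    using K c by (intro quotient_cancel) auto
qed

section \<open>The spectral radius\<close>

lemma irreducible:
  assumes "x \<in> V" "y \<in> V" shows "\<exists>n. 0 < (Q ^^ n) (delta y) x"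
proof (rule ccontr)
  assume "\<not> ?thesis"
  then have "(Q ^^ n) (delta y) x = 0" for n using Qn_delta_nonneg[OF assms(1), of n y] by (metis less_le)
  then have "g 1 y x = 0" using g_sums[OF order_refl assms(2,1)] sums_unique2[of "\<lambda>_. 0"] by auto
  then show False using g_pos[OF order_refl assms] by simp
qed

lemma Qn_sum:
  "finite I \<Longrightarrow> (Q ^^ n) (\<lambda>w. \<Sum>z\<in>I. u z w) x = (\<Sum>z\<in>I. (Q ^^ n) (u z) x)"
  by (induction I rule: finite_induct) (auto simp: Qn_add Qn_const)

text \<open>A sine wave in the height, cut off outside a finite horocyclic tetrahedron, is an
  almost eigenfunction.\<close>

lemma Q_subeigenfunction:
  fixes L :: nat
  assumes x: "x \<in> V"
  defines "\<theta> \<equiv> pi / (real L + 2)"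
  obtains I \<phi> where "finite I" "I \<subseteq> V" "x \<in> I" "\<And>z. z \<notin> I \<Longrightarrow> \<phi> z = 0" "\<And>z. 0 \<le> \<phi> z" "\<And>z. \<phi> z \<le> 1"
    "0 < \<phi> x" "\<And>z. z \<in> V \<Longrightarrow> 2 * cos \<theta> * \<phi> z \<le> Q \<phi> z"
proof -
  define b where "b = B.anc (- ht x - int L) (snd x)"
  define I where "I = {z \<in> V. ht x \<le> ht z \<and> ht z \<le> ht x + int L
    \<and> A.anc (ht x) (fst z) = fst x \<and> B.anc (- ht x - int L) (snd z) = b}"
  \<comment> \<open>The frequency makes the sine vanish at the heights \<open>ht x - 1\<close> and
    \<open>ht x + L + 1\<close> next to the cut-off, so truncation costs nothing there.\<close>
  define s where "s = (\<lambda>j. sin (\<theta> * of_int (j - ht x + 1)))"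
  define \<phi> where "\<phi> = (\<lambda>z. if z \<in> I then s (ht z) else 0)"
  have \<theta>: "0 < \<theta>" "\<theta> * (real L + 2) = pi" by (auto simp: \<theta>_def)
  have s_pos: "0 < s j" if "ht x \<le> j" "j \<le> ht x + int L" for j
    unfolding s_def
  proof (rule sin_gt_zero)
    show "0 < \<theta> * of_int (j - ht x + 1)" using \<theta> that by simp
    have "\<theta> * of_int (j - ht x + 1) < \<theta> * (real L + 2)"
      using \<theta> that by (intro mult_strict_left_mono) linarith+
    then show "\<theta> * of_int (j - ht x + 1) < pi" using \<theta> by simp
  qed
  have \<phi>_nonneg: "0 \<le> \<phi> z" for z using s_pos[of "ht z"] by (auto simp: \<phi>_def I_def)
  show thesis
  proof
    \<comment> \<open>First coordinates descend from \<open>fst x\<close> and second ones from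
      \<open>b\<close>, both by at most \<open>L\<close> generations.\<close>
    have "I \<subseteq> (\<Union>n\<in>{..L}. {w. (f1 ^^ n) w = fst x}) \<times> (\<Union>n\<in>{..L}. {w. (f2 ^^ n) w = b})"
    proof
      fix z assume z: "z \<in> I"
      then have 1: "(f1 ^^ nat (ht z - ht x)) (fst z) = fst x"
        "(f2 ^^ nat (h2 (snd z) - (- ht x - int L))) (snd z) = b"
        by (auto simp: I_def A.anc_def B.anc_def)
      have 2: "nat (ht z - ht x) \<in> {..L}" "nat (h2 (snd z) - (- ht x - int L)) \<in> {..L}"
        using z by (auto simp: I_def V_h2)
      show "z \<in> (\<Union>n\<in>{..L}. {w. (f1 ^^ n) w = fst x}) \<times> (\<Union>n\<in>{..L}. {w. (f2 ^^ n) w = b})"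
        unfolding mem_Times_iff by (intro conjI UN_I[OF 2(1)] UN_I[OF 2(2)] CollectI 1)
    qed
    then show "finite I"
      by (rule finite_subset) (auto intro!: finite_cartesian_product A.finite_descendants B.finite_descendants)
    show "I \<subseteq> V" by (auto simp: I_def)
    show xI: "x \<in> I" using x by (auto simp: I_def b_def)
    show "\<phi> z = 0" if "z \<notin> I" for z using that by (simp add: \<phi>_def)
    show "\<phi> z \<le> 1" for z by (simp add: \<phi>_def s_def)
    show "0 < \<phi> x" using xI s_pos[of "ht x"] by (simp add: \<phi>_def)
    show "0 \<le> \<phi> z" for z by (rule \<phi>_nonneg)
    show "2 * cos \<theta> * \<phi> z \<le> Q \<phi> z" if z: "z \<in> V" for z
    proof (cases "z \<in> I")
      case False
      then have "\<phi> z = 0" by (simp add: \<phi>_def)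
      moreover have "0 \<le> Q \<phi> z" unfolding Q_def
        by (intro add_nonneg_nonneg divide_nonneg_nonneg sum_nonneg \<phi>_nonneg) auto
      ultimately show ?thesis by simp
    next
      case True
      then have zI: "ht x \<le> ht z" "ht z \<le> ht x + int L" "A.anc (ht x) (fst z) = fst x"
        "B.anc (- ht x - int L) (snd z) = b" by (auto simp: I_def)
      have up: "s (ht z + 1) \<le> (\<Sum>w\<in>{w. f1 w = fst z}. \<phi> (w, f2 (snd z))) / real q"
      proof (cases "ht z = ht x + int L")
        case True
        then have "s (ht z + 1) = sin (\<theta> * (real L + 2))" by (simp add: s_def algebra_simps)
        then have "s (ht z + 1) = 0" using \<theta> by simp
        then show ?thesis using \<phi>_nonneg by (auto intro!: divide_nonneg_nonneg sum_nonneg)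
      next
        case False
        have "\<phi> (w, f2 (snd z)) = s (ht z + 1)" if w: "f1 w = fst z" for w
        proof -
          have hw: "h1 w = ht z + 1" using A.h_f[of w] w by simp
          have "A.anc (ht x) w = fst x" using A.anc_f[of "ht x" w] w hw zI by simp
          moreover have "B.anc (- ht x - int L) (f2 (snd z)) = b"
            using B.anc_f[of "- ht x - int L" "snd z"] zI False z by (simp add: V_h2)
          ultimately have "(w, f2 (snd z)) \<in> I" using up_in_V[OF z w] zI False hw by (simp add: I_def)
          then show ?thesis by (simp add: \<phi>_def hw)
        qed
        then have "(\<Sum>w\<in>{w. f1 w = fst z}. \<phi> (w, f2 (snd z))) = real q * s (ht z + 1)"
          by (rule A.sum_children_const)
        then show ?thesis using q1 by simp
      qed
      have down: "s (ht z - 1) \<le> (\<Sum>w\<in>{w. f2 w = snd z}. \<phi> (f1 (fst z), w)) / real r"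
      proof (cases "ht z = ht x")
        case True
        then have "s (ht z - 1) = 0" by (simp add: s_def)
        then show ?thesis using \<phi>_nonneg by (auto intro!: divide_nonneg_nonneg sum_nonneg)
      next
        case False
        have "\<phi> (f1 (fst z), w) = s (ht z - 1)" if w: "f2 w = snd z" for w
        proof -
          have hw: "h2 w = - ht z + 1" using B.h_f[of w] w z by (simp add: V_h2)
          have "B.anc (- ht x - int L) w = b" using B.anc_f[of "- ht x - int L" w] w hw zI by simp
          moreover have "A.anc (ht x) (f1 (fst z)) = fst x"
            using A.anc_f[of "ht x" "fst z"] zI False by simp
          ultimately have "(f1 (fst z), w) \<in> I" using down_in_V[OF z w] zI False by (simp add: I_def)
          then show ?thesis by (simp add: \<phi>_def)
        qed
        then have "(\<Sum>w\<in>{w. f2 w = snd z}. \<phi> (f1 (fst z), w)) = real r * s (ht z - 1)"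
          by (rule B.sum_children_const)
        then show ?thesis using r1 by simp
      qed
      have eq: "s (ht z + 1) + s (ht z - 1) = 2 * cos \<theta> * s (ht z)"
      proof -
        define t where "t = \<theta> * of_int (ht z - ht x + 1)"
        have "s (ht z + 1) = sin (t + \<theta>)" "s (ht z - 1) = sin (t - \<theta>)" "s (ht z) = sin t"
          by (simp_all add: s_def t_def algebra_simps)
        then show ?thesis by (simp add: sin_add sin_diff)
      qed
      have "\<phi> z = s (ht z)" using True by (simp add: \<phi>_def)
      then show ?thesis unfolding Q_def using add_mono[OF up down] eq by simp
    qed
  qed
qed

text \<open>The iterates of the cut-off sine wave grow at a rate \<open>\<mu>\<close> that can be
  chosen above \<open>l\<close>. The wave is dominated by finitely many point masses, whose iterates
  are bounded through \<open>Qn_semigroup\<close> and irreducibility by those of the mass at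
  \<open>y\<close>.\<close>

lemma Qn_growth:
  assumes x: "x \<in> V" and y: "y \<in> V" and l: "0 < l" "l < 2"
    and bound: "\<And>n. (Q ^^ n) (delta y) x \<le> K * l ^ n"
  shows False
proof -
  have "(\<lambda>L. 2 * cos (pi / (real L + 2))) \<longlonglongrightarrow> 2 * cos 0"
  proof (intro tendsto_intros)
    show "(\<lambda>L. pi / (real L + 2)) \<longlonglongrightarrow> 0"
      using LIMSEQ_ignore_initial_segment[OF lim_const_over_n[of pi], of 2] by (simp add: add.commute)
  qed
  then have "\<forall>\<^sub>F L in sequentially. l < 2 * cos (pi / (real L + 2))"
    using l by (intro order_tendstoD(1)) auto
  then obtain L :: nat where L: "l < 2 * cos (pi / (real L + 2))"
    by (auto simp: eventually_sequentially)
  define \<mu> where "\<mu> = 2 * cos (pi / (real L + 2))"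
  obtain I \<phi> where I: "finite I" "I \<subseteq> V" "x \<in> I" "\<And>z. z \<notin> I \<Longrightarrow> \<phi> z = 0" "\<And>z. 0 \<le> \<phi> z" "\<And>z. \<phi> z \<le> 1"
    "0 < \<phi> x" "\<And>z. z \<in> V \<Longrightarrow> \<mu> * \<phi> z \<le> Q \<phi> z"
    using Q_subeigenfunction[OF x, of L] unfolding \<mu>_def by metis
  have lower: "\<mu> ^ n * \<phi> z \<le> (Q ^^ n) \<phi> z" if "z \<in> V" for n z
  proof (induction n)
    case (Suc n)
    have "\<mu> ^ Suc n * \<phi> z \<le> \<mu> * (Q ^^ n) \<phi> z"
      using Suc l L by (simp add: \<mu>_def mult.assoc)
    also have "\<dots> = (Q ^^ n) (\<lambda>z. \<mu> * \<phi> z) z" by (simp add: Qn_cmult)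
    also have "\<dots> \<le> (Q ^^ n) (Q \<phi>) z" by (rule Qn_mono[OF that I(8)])
    also have "\<dots> = (Q ^^ Suc n) \<phi> z" by (simp only: funpow_Suc_right comp_def)
    finally show ?case .
  qed simp
  have "\<exists>C. \<forall>n. (Q ^^ n) (delta z) x \<le> C * l ^ n" if "z \<in> I" for z
  proof -
    have z: "z \<in> V" using that I by blast
    obtain k where k: "0 < (Q ^^ k) (delta y) z" using irreducible[OF z y] by blast
    have "(Q ^^ n) (delta z) x \<le> (K * l ^ k / (Q ^^ k) (delta y) z) * l ^ n" for n
    proof -
      have "(Q ^^ n) (delta z) x * (Q ^^ k) (delta y) z \<le> K * l ^ (n + k)"
        using Qn_semigroup[OF x z, of n k y] bound[of "n + k"] by linarith
      then show ?thesis using k by (simp add: field_simps power_add)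
    qed
    then show ?thesis by blast
  qed
  then obtain C where C: "\<And>z n. z \<in> I \<Longrightarrow> (Q ^^ n) (delta z) x \<le> C z * l ^ n" by metis
  have upper: "\<mu> ^ n * \<phi> x \<le> sum C I * l ^ n" for n
  proof -
    have "\<mu> ^ n * \<phi> x \<le> (Q ^^ n) \<phi> x" by (rule lower[OF x])
    also have "\<dots> \<le> (Q ^^ n) (\<lambda>w. \<Sum>z\<in>I. delta z w) x"
    proof (rule Qn_mono[OF x])
      fix w show "\<phi> w \<le> (\<Sum>z\<in>I. delta z w)"
        using I(1) I(4,6)[of w] by (cases "w \<in> I") (auto simp: of_bool_def sum.delta intro!: sum_nonneg)
    qed
    also have "\<dots> = (\<Sum>z\<in>I. (Q ^^ n) (delta z) x)" by (rule Qn_sum[OF I(1)])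
    also have "\<dots> \<le> sum C I * l ^ n" unfolding sum_distrib_right by (rule sum_mono) (rule C)
    finally show ?thesis .
  qed
  have "(\<mu> / l) ^ n \<le> sum C I / \<phi> x" for n
    using upper[of n] I(7) l by (simp add: field_simps power_divide)
  moreover have "1 < \<mu> / l" using l L by (simp add: \<mu>_def)
  ultimately show False using real_arch_pow[of "\<mu> / l" "sum C I / \<phi> x"] by (meson not_less)
qed

lemma spectral_radius_eq:
  assumes \<alpha>: "0 < \<alpha>" "\<alpha> < 1" and x: "x \<in> V" and y: "y \<in> V"
  shows "spectral_radius V (P \<alpha>) x y = ereal (2 * sqrt (\<alpha> * (1 - \<alpha>)))"
proof -
  define \<sigma> where "\<sigma> = sqrt (\<alpha> * (1 - \<alpha>))"
  define C where "C = sqrt ((1 - \<alpha>) / \<alpha>) powi (ht x - ht y)"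
  have \<sigma>: "\<sigma> > 0" using \<alpha> by (simp add: \<sigma>_def)
  have C: "C > 0" using \<alpha> by (simp add: C_def)
  have p: "nstep V (P \<alpha>) n x y = \<sigma> ^ n * C * (Q ^^ n) (delta y) x" for n
    by (simp add: nstep_eq[OF \<alpha> x] \<sigma>_def C_def)
  have "limsup (\<lambda>n. ereal (root n (nstep V (P \<alpha>) n x y))) \<le> limsup (\<lambda>n. ereal (2 * \<sigma> * root n C))"
  proof (rule Limsup_mono)
    show "\<forall>\<^sub>F n in sequentially. ereal (root n (nstep V (P \<alpha>) n x y)) \<le> ereal (2 * \<sigma> * root n C)"
      using eventually_gt_at_top[of 0]
    proof eventually_elim
      case (elim n)
      have "nstep V (P \<alpha>) n x y \<le> (2 * \<sigma>) ^ n * C"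
        unfolding p power_mult_distrib using \<sigma> C Qn_delta_le[OF x, of n y] by simp
      then have "root n (nstep V (P \<alpha>) n x y) \<le> root n ((2 * \<sigma>) ^ n * C)" using elim by simp
      also have "\<dots> = 2 * \<sigma> * root n C" using elim \<sigma> by (simp add: real_root_mult real_root_power_cancel)
      finally show ?case by simp
    qed
  qed
  also have "\<dots> = ereal (2 * \<sigma> * 1)"
    using C by (intro lim_imp_Limsup tendsto_ereal tendsto_mult tendsto_const LIMSEQ_root_const) auto
  finally have le: "limsup (\<lambda>n. ereal (root n (nstep V (P \<alpha>) n x y))) \<le> ereal (2 * \<sigma>)" by simp
  have "\<not> limsup (\<lambda>n. ereal (root n (nstep V (P \<alpha>) n x y))) < ereal (2 * \<sigma>)"
  proof
    assume "limsup (\<lambda>n. ereal (root n (nstep V (P \<alpha>) n x y))) < ereal (2 * \<sigma>)"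
    \<comment> \<open>The maximum with 0 makes the intermediate rate \<open>l\<close> positive, so
      that its powers can be divided by.\<close>
    then have "max 0 (limsup (\<lambda>n. ereal (root n (nstep V (P \<alpha>) n x y)))) < ereal (2 * \<sigma>)" using \<sigma> by simp
    then obtain l where l: "max 0 (limsup (\<lambda>n. ereal (root n (nstep V (P \<alpha>) n x y)))) < ereal l" "l < 2 * \<sigma>"
      using ereal_dense2 by fastforce
    then have l0: "0 < l" by (simp add: zero_ereal_def[symmetric])
    from l have "\<forall>\<^sub>F n in sequentially. ereal (root n (nstep V (P \<alpha>) n x y)) < ereal l"
      by (intro Limsup_lessD) auto
    with eventually_gt_at_top[of 0]
    have "\<forall>\<^sub>F n in sequentially. (Q ^^ n) (delta y) x \<le> inverse C * (l / \<sigma>) ^ n"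
    proof eventually_elim
      case (elim n)
      have "0 \<le> nstep V (P \<alpha>) n x y" unfolding p using \<sigma> C Qn_delta_nonneg[OF x, of n y] by simp
      then have "nstep V (P \<alpha>) n x y = root n (nstep V (P \<alpha>) n x y) ^ n" using elim by simp
      also have "\<dots> \<le> l ^ n" using elim \<open>0 \<le> nstep V (P \<alpha>) n x y\<close> by (intro power_mono) auto
      finally show ?case unfolding p using \<sigma> C by (simp add: field_simps power_divide)
    qed
    then obtain N where N: "\<And>n. n \<ge> N \<Longrightarrow> (Q ^^ n) (delta y) x \<le> inverse C * (l / \<sigma>) ^ n"
      by (auto simp: eventually_sequentially)
    \<comment> \<open>The sum absorbs the finitely many \<open>n\<close> before the eventual bound
      sets in.\<close>
    define K where "K = inverse C + (\<Sum>n<N. (Q ^^ n) (delta y) x / (l / \<sigma>) ^ n)"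
    have pos: "0 < l / \<sigma>" using l0 \<sigma> by simp
    have "(Q ^^ n) (delta y) x \<le> K * (l / \<sigma>) ^ n" for n
    proof (cases "n < N")
      case True
      have "(Q ^^ n) (delta y) x / (l / \<sigma>) ^ n \<le> (\<Sum>n<N. (Q ^^ n) (delta y) x / (l / \<sigma>) ^ n)"
        using True pos Qn_delta_nonneg[OF x] by (intro member_le_sum) auto
      also have "\<dots> \<le> K" using C by (simp add: K_def)
      finally show ?thesis using pos by (simp add: divide_le_eq)
    next
      case False
      have "0 \<le> (\<Sum>n<N. (Q ^^ n) (delta y) x / (l / \<sigma>) ^ n)"
        by (intro sum_nonneg divide_nonneg_nonneg Qn_delta_nonneg x zero_le_power less_imp_le[OF pos])
      then have "inverse C \<le> K" by (simp add: K_def)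
      then have "inverse C * (l / \<sigma>) ^ n \<le> K * (l / \<sigma>) ^ n" using pos by (intro mult_right_mono) auto
      then show ?thesis using N[of n] False by linarith
    qed
    then show False using l \<sigma> pos by (intro Qn_growth[OF x y, of "l / \<sigma>" K]) (auto simp: field_simps)
  qed
  with le show ?thesis unfolding spectral_radius_def \<sigma>_def by (simp add: not_less antisym)
qed

end

section \<open>Limits of the Martin kernels\<close>

lemma eventually_gt_int: "filterlim M at_top F \<Longrightarrow> \<forall>\<^sub>F n in F. M n > (a :: int)"
  using filterlim_at_top[THEN iffD1, rule_format, of M F "a + 1"] by (rule eventually_mono) auto

text \<open>The limits of the summands of \<open>Psi\<close>, normalised, when \<open>M0\<close> tends to infinity and \<open>m0\<close> is
  fixed. The height \<open>k\<close> of \<open>y\<close> is eventually constant (\<open>Some\<close>) or tends to infinity (\<open>None\<close>).\<close>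

definition lam :: "real \<Rightarrow> int option \<Rightarrow> int \<Rightarrow> int \<Rightarrow> int \<Rightarrow> int \<Rightarrow> int \<Rightarrow> real" where
  "lam c \<kappa> b d i m j = (case \<kappa> of
       Some k \<Rightarrow> (ex c powi (1 - k + m) * S c (i - m) + ex c powi (m - i) * S c (k - m + 1)) / S c (k - d)
     | None \<Rightarrow> ex c powi (m - i) * ex c powi (1 - m + d))
     * ex c powi (m - j - b - 1) * ex c powi (m - j - b - 2)"

definition height_limit :: "(nat \<Rightarrow> int) \<Rightarrow> int option \<Rightarrow> bool" where
  "height_limit k \<kappa> = (case \<kappa> of Some k0 \<Rightarrow> \<forall>\<^sub>F n in sequentially. k n = k0 | None \<Rightarrow> filterlim k at_top sequentially)"

context
  fixes c :: real
  assumes c: "c \<ge> 1"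
begin

text \<open>The dominating function for the limits below. Lowering the minimum from \<open>m\<close>
  to \<open>l\<close> costs the numerator a factor \<open>(m - l + 1) * ex c ^ (m - l)\<close>, by
  \<open>cs_le\<close>, and the denominator gains at least one such power. A linear factor remains,
  uniformly in \<open>M\<close>, and it is summable against \<open>q powi l\<close>.\<close>

lemma D_bound:
  assumes "l \<le> m" "m \<le> i" "m \<le> k" "i \<le> M" "k \<le> M" "m < M"
  shows "D c l M i k * (S c (M - m + 1))\<^sup>2 \<le> of_int (m - l + 1) * (S c (k - m + 1) + 2 * c * S c (i - m + 1))"
proof -
  define L where "L = nat (m - l)"
  have L: "m - l = int L" using assms by (simp add: L_def)
  define Y where "Y = S c (M - m + 1)"
  define E where "E = ex c ^ L"
  define A B C where "A = S c (M - l)" and "B = S c (M - l + 1)" and "C = S c (M - l + 2)"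
  have Y: "Y \<ge> 1" using assms c by (simp add: Y_def S_ge_1)
  have E: "E \<ge> 1" using ex_ge_1[OF c] by (simp add: E_def)
  have A0: "A > 0" using assms c by (simp add: A_def S_pos)
  have YB: "Y * E \<le> B" using S_mult_ex[OF c, of "M - m + 1" L] assms L
    by (simp add: Y_def E_def B_def algebra_simps)
  have "S c (M - m + 2) * E \<le> C" using S_mult_ex[OF c, of "M - m + 2" L] assms L
    by (simp add: E_def C_def algebra_simps)
  moreover have "Y \<le> S c (M - m + 2)" using assms c by (simp add: Y_def S_mono)
  ultimately have YC: "Y * E \<le> C" using E by (meson dual_order.trans mult_right_mono zero_le_one order_trans)
  have "Y \<le> Y * E" using Y E by simp
  then have YB': "Y \<le> B" using YB by simp
  have BA: "B \<le> 2 * c * A"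
    using S_rec[of c "M - l"] S_nonneg[OF c, of "M - l - 1"] assms by (simp add: A_def B_def)
  have B0: "B > 0" and C0: "C > 0" using YB' Y YC \<open>Y \<le> Y * E\<close> by linarith+
  have big: "S c (j - l + 1) \<le> real (Suc L) * E * S c (j - m + 1)" if "m \<le> j" for j
  proof -
    have "S c (j - l + 1) = S c (int L + (j - m + 1))" using L by (simp add: algebra_simps)
    also have "\<dots> \<le> S c (int L + 1) * S c (j - m + 1)" using that c by (intro S_add_le) auto
    also have "\<dots> \<le> (real (Suc L) * E) * S c (j - m + 1)"
      using cs_le[OF c, of L] that c S_of_nat[of c "Suc L"]
      by (intro mult_right_mono S_nonneg) (auto simp: E_def add.commute)
    finally show ?thesis .
  qed
  have t1: "S c (M + 1 - k) * S c (i - l) \<le> B * (real (Suc L) * E * S c (i - m + 1))"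
  proof (rule mult_mono)
    show "S c (M + 1 - k) \<le> B" using assms c by (simp add: B_def S_mono)
    have "S c (i - l) \<le> S c (i - l + 1)" using assms c by (intro S_mono) auto
    with big[of i] assms show "S c (i - l) \<le> real (Suc L) * E * S c (i - m + 1)" by simp
  qed (use B0 assms c in \<open>auto intro: S_nonneg\<close>)
  have t2: "S c (M - i) * S c (k - l + 1) \<le> A * (real (Suc L) * E * S c (k - m + 1))"
    using assms c big[of k] A0 by (intro mult_mono) (auto simp: A_def S_mono S_nonneg)
  have i0: "0 \<le> S c (i - m + 1)" "0 \<le> S c (k - m + 1)" using assms c by (auto intro: S_nonneg)
  have 1: "B * (real (Suc L) * E * S c (i - m + 1)) * Y\<^sup>2 \<le> A * B * C * (real (Suc L) * (2 * c * S c (i - m + 1)))"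
  proof -
    have "Y * (Y * E) \<le> (2 * c * A) * C" using YB' BA YC Y E A0 c by (intro mult_mono) auto
    then have "(Y * (Y * E)) * (B * (real (Suc L) * S c (i - m + 1))) \<le> (2 * c * A * C) * (B * (real (Suc L) * S c (i - m + 1)))"
      using B0 i0 by (intro mult_right_mono) auto
    then show ?thesis by (simp add: algebra_simps power2_eq_square)
  qed
  have 2: "A * (real (Suc L) * E * S c (k - m + 1)) * Y\<^sup>2 \<le> A * B * C * (real (Suc L) * S c (k - m + 1))"
  proof -
    have "Y * (Y * E) \<le> B * C" using YB' YC Y E by (intro mult_mono) auto
    then have "(Y * (Y * E)) * (A * (real (Suc L) * S c (k - m + 1))) \<le> (B * C) * (A * (real (Suc L) * S c (k - m + 1)))"
      using A0 i0 by (intro mult_right_mono) auto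
    then show ?thesis by (simp add: algebra_simps power2_eq_square)
  qed
  have 3: "(B * (real (Suc L) * E * S c (i - m + 1)) + A * (real (Suc L) * E * S c (k - m + 1))) * Y\<^sup>2
     \<le> A * B * C * (real (Suc L) * (2 * c * S c (i - m + 1))) + A * B * C * (real (Suc L) * S c (k - m + 1))"
    unfolding distrib_right[of _ _ "Y\<^sup>2"] by (rule add_mono[OF 1 2])
  have "l \<noteq> M" using assms by simp
  then have "D c l M i k * Y\<^sup>2 = (S c (M + 1 - k) * S c (i - l) + S c (M - i) * S c (k - l + 1)) * Y\<^sup>2 / (A * B * C)"
    by (simp add: D_def A_def B_def C_def)
  also have "\<dots> \<le> (B * (real (Suc L) * E * S c (i - m + 1)) + A * (real (Suc L) * E * S c (k - m + 1))) * Y\<^sup>2 / (A * B * C)"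
    using t1 t2 A0 B0 C0 by (intro divide_right_mono mult_right_mono add_mono) auto
  also have "\<dots> \<le> (A * B * C * (real (Suc L) * (2 * c * S c (i - m + 1))) + A * B * C * (real (Suc L) * S c (k - m + 1))) / (A * B * C)"
    using A0 B0 C0 by (intro divide_right_mono[OF 3]) auto
  also have "\<dots> = real (Suc L) * (S c (k - m + 1) + 2 * c * S c (i - m + 1))"
    using A0 B0 C0 by (simp add: add_divide_distrib distrib_left)
  also have "real (Suc L) = of_int (m - l + 1)" by (simp add: L)
  finally show ?thesis by (simp add: Y_def)
qed

text \<open>The denominator of \<open>D\<close> has three factors growing with \<open>M n\<close>.
  The numerator compensates one, the square in the normalisation the other two, and
  \<open>S c (k n - d)\<close> absorbs the growth in \<open>k n\<close>.\<close>

lemma D_limit_up: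
  assumes k: "height_limit k \<kappa>" and M: "filterlim M at_top sequentially"
    and ev: "\<forall>\<^sub>F n in sequentially. m \<le> k n \<and> k n \<le> M n \<and> d < k n" and j: "j \<ge> 0"
  shows "(\<lambda>n. D c m (M n + j) i (k n) * (S c (M n - b))\<^sup>2 / S c (k n - d)) \<longlonglongrightarrow> lam c \<kappa> b d i m j"
proof -
  let ?N = "\<lambda>n. (S c (M n + j + 1 - k n) * S c (i - m) + S c (M n + j - i) * S c (k n - m + 1)) / (S c (M n + j - m) * S c (k n - d))"
  have r1: "(\<lambda>n. S c (M n - b) / S c (M n + j - m + 1)) \<longlonglongrightarrow> ex c powi (m - j - b - 1)"
    using S_shift_ratio[OF c M, of "- b" "j - m + 1"] by (simp add: algebra_simps)
  have r2: "(\<lambda>n. S c (M n - b) / S c (M n + j - m + 2)) \<longlonglongrightarrow> ex c powi (m - j - b - 2)"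
    using S_shift_ratio[OF c M, of "- b" "j - m + 2"] by (simp add: algebra_simps)
  have r3: "(\<lambda>n. S c (M n + j - i) / S c (M n + j - m)) \<longlonglongrightarrow> ex c powi (m - i)"
    using S_shift_ratio[OF c M, of "j - i" "j - m"] by (simp add: algebra_simps)
  define G where "G = (case \<kappa> of
       Some k \<Rightarrow> (ex c powi (1 - k + m) * S c (i - m) + ex c powi (m - i) * S c (k - m + 1)) / S c (k - d)
     | None \<Rightarrow> ex c powi (m - i) * ex c powi (1 - m + d))"
  have N: "?N \<longlonglongrightarrow> G"
  proof (cases \<kappa>)
    case (Some k0)
    have ek: "\<forall>\<^sub>F n in sequentially. k n = k0" using k Some by (simp add: height_limit_def)
    obtain n where "k n = k0" "d < k n" using eventually_happens[OF eventually_conj[OF ek ev]] by auto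
    then have "S c (k0 - d) \<noteq> 0" using S_pos[OF c, of "k0 - d"] by simp
    have "(\<lambda>n. S c (M n + j + 1 - k0) / S c (M n + j - m)) \<longlonglongrightarrow> ex c powi (1 - k0 + m)"
      using S_shift_ratio[OF c M, of "j + 1 - k0" "j - m"] by (simp add: algebra_simps)
    then have "(\<lambda>n. (S c (M n + j + 1 - k0) / S c (M n + j - m) * S c (i - m)
        + S c (M n + j - i) / S c (M n + j - m) * S c (k0 - m + 1)) / S c (k0 - d)) \<longlonglongrightarrow> G"
      unfolding G_def Some option.case
      using r3 \<open>S c (k0 - d) \<noteq> 0\<close> by (intro tendsto_intros)
    moreover have "\<forall>\<^sub>F n in sequentially. (S c (M n + j + 1 - k0) / S c (M n + j - m) * S c (i - m)
        + S c (M n + j - i) / S c (M n + j - m) * S c (k0 - m + 1)) / S c (k0 - d) = ?N n"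
      using ek by eventually_elim (simp add: add_divide_distrib)
    ultimately show ?thesis by (rule Lim_transform_eventually)
  next
    case None
    then have kt: "filterlim k at_top sequentially" using k by (simp add: height_limit_def)
    have a: "(\<lambda>n. S c (k n - m + 1) / S c (k n - d)) \<longlonglongrightarrow> ex c powi (1 - m + d)"
      using S_shift_ratio[OF c kt, of "1 - m" "- d"] by (simp add: algebra_simps)
    have inv: "(\<lambda>n. inverse (S c (k n - d))) \<longlonglongrightarrow> 0"
      using filterlim_S[OF c filterlim_add_int[OF c kt, of "- d"]] by (intro tendsto_inverse_0_at_top) simp
    \<comment> \<open>As \<open>k n > m\<close> eventually, the first quotient is at most 1, so this
      part of the numerator disappears in the limit.\<close>
    have b: "(\<lambda>n. S c (M n + j + 1 - k n) / S c (M n + j - m) * inverse (S c (k n - d))) \<longlonglongrightarrow> 0"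
    proof (rule tendsto_sandwich[OF _ _ tendsto_const inv])
      have kn: "\<forall>\<^sub>F n in sequentially. k n \<ge> m + 1" using kt filterlim_at_top by blast
      show "\<forall>\<^sub>F n in sequentially. 0 \<le> S c (M n + j + 1 - k n) / S c (M n + j - m) * inverse (S c (k n - d))"
        using ev kn by eventually_elim (use j c in \<open>auto intro!: mult_nonneg_nonneg divide_nonneg_nonneg S_nonneg\<close>)
      show "\<forall>\<^sub>F n in sequentially. S c (M n + j + 1 - k n) / S c (M n + j - m) * inverse (S c (k n - d)) \<le> inverse (S c (k n - d))"
        using ev kn
      proof eventually_elim
        case (elim n)
        have "S c (M n + j + 1 - k n) \<le> S c (M n + j - m)" "0 < S c (M n + j - m)" "0 < S c (k n - d)"
          using elim j c by (auto intro: S_mono S_pos)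
        then show ?case using mult_right_mono[of "S c (M n + j + 1 - k n) / S c (M n + j - m)" 1 "inverse (S c (k n - d))"]
          by simp
      qed
    qed
    have "(\<lambda>n. S c (M n + j + 1 - k n) / S c (M n + j - m) * inverse (S c (k n - d)) * S c (i - m)
       + S c (M n + j - i) / S c (M n + j - m) * (S c (k n - m + 1) / S c (k n - d))) \<longlonglongrightarrow> 0 * S c (i - m) + G"
      unfolding G_def None option.case by (intro tendsto_intros a b r3)
    then show ?thesis by (simp add: add_divide_distrib divide_inverse algebra_simps)
  qed
  have "(\<lambda>n. ?N n * (S c (M n - b) / S c (M n + j - m + 1)) * (S c (M n - b) / S c (M n + j - m + 2))) \<longlonglongrightarrow> lam c \<kappa> b d i m j"
    unfolding lam_def G_def[symmetric] by (rule tendsto_mult[OF tendsto_mult[OF N r1] r2])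
  moreover have "\<forall>\<^sub>F n in sequentially. M n > m" by (rule eventually_gt_int[OF M])
  then have "\<forall>\<^sub>F n in sequentially. ?N n * (S c (M n - b) / S c (M n + j - m + 1)) * (S c (M n - b) / S c (M n + j - m + 2))
     = D c m (M n + j) i (k n) * (S c (M n - b))\<^sup>2 / S c (k n - d)"
    by eventually_elim (use j in \<open>simp add: D_def power2_eq_square mult_ac\<close>)
  ultimately show ?thesis by (rule Lim_transform_eventually)
qed

lemma lam_pos:
  assumes "m \<le> i" "case \<kappa> of Some k \<Rightarrow> m \<le> k \<and> d < k | None \<Rightarrow> True"
  shows "0 < lam c \<kappa> b d i m j"
  using assms ex_pos[OF c] unfolding lam_def
  by (cases \<kappa>) (auto intro!: mult_pos_pos divide_pos_pos add_nonneg_pos mult_nonneg_nonneg S_nonneg[OF c] S_pos[OF c])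

end

lemma summable_powi_linear:
  fixes q :: real assumes "q > 1"
  shows "(\<lambda>l. q powi l * of_int (m - l + 1)) summable_on {..m}"
proof -
  have "summable (\<lambda>n. real (Suc n) * inverse q ^ n)"
    using geometric_deriv_sums[of "inverse q"] assms by (auto simp: sums_iff inverse_less_1_iff)
  then have "(\<lambda>n. real (Suc n) * inverse q ^ n) summable_on UNIV"
    using assms by (intro summable_nonneg_imp_summable_on) auto
  then have "(\<lambda>n. q powi m * (real (Suc n) * inverse q ^ n)) summable_on UNIV"
    by (rule summable_on_cmult_right)
  also have "(\<lambda>n. q powi m * (real (Suc n) * inverse q ^ n)) = (\<lambda>n. q powi (m - int n) * of_int (m - (m - int n) + 1))"
  proof
    fix n
    have "q powi (m - int n) = q powi m * inverse q ^ n"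
      using assms by (simp add: power_int_diff power_inverse divide_inverse)
    then show "q powi m * (real (Suc n) * inverse q ^ n) = q powi (m - int n) * of_int (m - (m - int n) + 1)"
      by (simp add: add.commute)
  qed
  also have "\<dots> summable_on UNIV \<longleftrightarrow> (\<lambda>l. q powi l * of_int (m - l + 1)) summable_on {..m}"
    by (rule summable_on_reindex_bij_witness[where i = "\<lambda>l. nat (m - l)" and j = "\<lambda>n. m - int n"]) auto
  finally show ?thesis .
qed

lemma dominated_limit_summable:
  fixes f :: "'n \<Rightarrow> 'i \<Rightarrow> real"
  assumes "\<And>x. x \<in> A \<Longrightarrow> ((\<lambda>n. f n x) \<longlongrightarrow> g x) F"
    and bound: "\<forall>\<^sub>F n in F. \<forall>x\<in>A. \<bar>f n x\<bar> \<le> B x" and "B summable_on A" and F: "F \<noteq> bot"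
  shows "g summable_on A"
proof -
  have bound_x: "\<forall>\<^sub>F n in F. \<bar>f n x\<bar> \<le> B x" if "x \<in> A" for x
    using bound by eventually_elim (use that in blast)
  have g: "\<bar>g x\<bar> \<le> B x" if "x \<in> A" for x
    by (rule tendsto_upperbound[OF tendsto_rabs[OF assms(1)[OF that]] bound_x[OF that] F])
  have "(\<lambda>x. norm (g x)) summable_on A"
    using assms(3) by (rule summable_on_comparison_test) (use g in auto)
  then show ?thesis by (rule abs_summable_summable)
qed

definition Alim :: "real \<Rightarrow> real \<Rightarrow> real \<Rightarrow> int option \<Rightarrow> int \<Rightarrow> int \<Rightarrow> int \<Rightarrow> int \<Rightarrow> real" where
  "Alim c q r \<kappa> b d i m = (\<Sum>\<^sub>\<infinity>(l, j)\<in>{..m} \<times> {0..}. q powi l * r powi (- j) * lam c \<kappa> b d i l j)"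

text \<open>\<open>b\<close> and \<open>d\<close> fix a normalisation common to numerator and
  denominator: \<open>b\<close> at least both minima, \<open>d\<close> below both. Other admissible
  values give the same quotient, which \<open>Rup_strict_mono\<close> exploits.\<close>

definition Rup :: "real \<Rightarrow> real \<Rightarrow> real \<Rightarrow> int option \<Rightarrow> int \<Rightarrow> int \<Rightarrow> int \<Rightarrow> int \<Rightarrow> real" where
  "Rup c q r \<kappa> i m i' m' = (let b = max m m'; d = min m m' - 1 in
     Alim c q r \<kappa> b d i m / Alim c q r \<kappa> b d i' m')"

context
  fixes c q r :: real and k M :: "nat \<Rightarrow> int" and \<kappa> :: "int option"
  assumes c: "c \<ge> 1" and q: "q > 1" and r: "r > 1"
    and k: "height_limit k \<kappa>" and M: "filterlim M at_top sequentially"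
    and kM: "\<forall>\<^sub>F n in sequentially. k n \<le> M n"
begin

lemma Psi_limit_up:
  assumes m: "m \<le> i" "m \<le> b" "d < m" and mk: "\<forall>\<^sub>F n in sequentially. m \<le> k n"
  shows "(\<lambda>n. r powi M n * (S c (M n - b))\<^sup>2 / S c (k n - d) * Psi c q r (k n) i m (M n)) \<longlonglongrightarrow> Alim c q r \<kappa> b d i m"
    and "(\<lambda>(l, j). q powi l * r powi (- j) * lam c \<kappa> b d i l j) summable_on {..m} \<times> {0..}"
proof -
  define f where "f = (\<lambda>n (l, j). q powi l * r powi (- j) * (D c l (M n + j) i (k n) * (S c (M n - b))\<^sup>2 / S c (k n - d)))"
  define C where "C = 1 + 2 * c * S c (i - m + 1)"
  define B where "B = (\<lambda>z. (case z of (l, j) \<Rightarrow> (q powi l * of_int (m - l + 1)) * r powi (- j)) * C)"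
  have f: "r powi M n * (S c (M n - b))\<^sup>2 / S c (k n - d) * Psi c q r (k n) i m (M n) = infsum (f n) ({..m} \<times> {0..})" for n
    unfolding Psi_def infsum_cmult_right'[symmetric]
  \<comment> \<open>Shifting the maximum by \<open>M n\<close> makes the index set independent of
    \<open>n\<close>, as dominated convergence requires.\<close>
  proof (rule infsum_reindex_bij_witness[where i = "\<lambda>(l, j). (l, M n + j)" and j = "\<lambda>(l, M'). (l, M' - M n)"])
    fix z assume "z \<in> {..m} \<times> {M n..}"
    obtain l M' where z: "z = (l, M')" by (cases z)
    have "r powi (- (M' - M n)) = r powi M n * r powi (- M')" using r by (simp flip: power_int_add)
    then show "f n (case z of (l, M') \<Rightarrow> (l, M' - M n)) = r powi M n * (S c (M n - b))\<^sup>2 / S c (k n - d) *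
       (case z of (m, M) \<Rightarrow> q powi m * r powi - M * D c m M i (k n))"
      by (simp add: z f_def)
  qed auto
  have lim: "(\<lambda>n. f n z) \<longlonglongrightarrow> (case z of (l, j) \<Rightarrow> q powi l * r powi (- j) * lam c \<kappa> b d i l j)"
    if "z \<in> {..m} \<times> {0..}" for z
  proof -
    obtain l j where z: "z = (l, j)" by (cases z)
    have "\<forall>\<^sub>F n in sequentially. l \<le> k n \<and> k n \<le> M n \<and> d < k n"
      using mk kM by eventually_elim (use that z m in auto)
    from D_limit_up[OF c k M this, of j i b] that
    have "(\<lambda>n. D c l (M n + j) i (k n) * (S c (M n - b))\<^sup>2 / S c (k n - d)) \<longlonglongrightarrow> lam c \<kappa> b d i l j"
      by (simp add: z)
    then show ?thesis unfolding z f_def prod.case by (rule tendsto_mult_left)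
  qed
  have "\<forall>\<^sub>F n in sequentially. M n > max (max m i) b" by (rule eventually_gt_int[OF M])
  with mk kM have bound: "\<forall>\<^sub>F n in sequentially. \<forall>z\<in>{..m} \<times> {0..}. \<bar>f n z\<bar> \<le> B z"
  proof eventually_elim
    case (elim n)
    show ?case
    proof
      fix z assume "z \<in> {..m} \<times> {0::int..}"
      then obtain l j where z: "z = (l, j)" "l \<le> m" "0 \<le> j" by auto
      \<comment> \<open>Here \<open>d < m\<close> enters; \<open>m \<le> b\<close> is what bounds
        the normalising square by the one in \<open>D_bound\<close>.\<close>
      have Sk: "1 \<le> S c (k n - m + 1)" "S c (k n - m + 1) \<le> S c (k n - d)"
        using elim m c by (auto intro: S_ge_1 S_mono)
      have Si: "0 \<le> S c (i - m + 1)" using m c by (intro S_nonneg) auto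
      have D0: "0 \<le> D c l (M n + j) i (k n)" using elim m z by (intro D_nonneg[OF c]) auto
      have "(S c (M n - b))\<^sup>2 \<le> (S c (M n + j - m + 1))\<^sup>2"
        using elim m z c by (intro power_mono S_mono S_nonneg) auto
      then have "D c l (M n + j) i (k n) * (S c (M n - b))\<^sup>2 \<le> D c l (M n + j) i (k n) * (S c (M n + j - m + 1))\<^sup>2"
        using D0 by (rule mult_left_mono)
      also have "\<dots> \<le> of_int (m - l + 1) * (S c (k n - m + 1) + 2 * c * S c (i - m + 1))"
        using elim m z by (intro D_bound[OF c]) auto
      also have "\<dots> \<le> of_int (m - l + 1) * (C * S c (k n - d))"
      proof (rule mult_left_mono)
        have "2 * c * S c (i - m + 1) * 1 \<le> 2 * c * S c (i - m + 1) * S c (k n - d)"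
          using Sk Si c by (intro mult_left_mono) auto
        then show "S c (k n - m + 1) + 2 * c * S c (i - m + 1) \<le> C * S c (k n - d)"
          using Sk by (simp add: C_def distrib_right)
      qed (use z in auto)
      finally have "D c l (M n + j) i (k n) * (S c (M n - b))\<^sup>2 / S c (k n - d) \<le> of_int (m - l + 1) * C"
        using Sk by (simp add: divide_le_eq mult.assoc)
      then have "f n z \<le> q powi l * r powi (- j) * (of_int (m - l + 1) * C)"
        unfolding f_def z prod.case using q r by (intro mult_left_mono) auto
      moreover have "0 \<le> f n z" unfolding f_def z prod.case using q r D0 Sk
        by (intro mult_nonneg_nonneg divide_nonneg_nonneg) auto
      ultimately show "\<bar>f n z\<bar> \<le> B z" by (simp add: B_def z mult_ac)
    qed
  qed
  have B: "B summable_on {..m} \<times> {0..}" unfolding B_def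
    by (intro summable_on_cmult_left summable_on_times summable_powi_linear summable_powi_atLeast q r)
       (use q r in auto)
  show "(\<lambda>n. r powi M n * (S c (M n - b))\<^sup>2 / S c (k n - d) * Psi c q r (k n) i m (M n)) \<longlonglongrightarrow> Alim c q r \<kappa> b d i m"
    unfolding f Alim_def by (rule infsum_dominated_convergence[OF lim bound B])
  show "(\<lambda>(l, j). q powi l * r powi (- j) * lam c \<kappa> b d i l j) summable_on {..m} \<times> {0..}"
    by (rule dominated_limit_summable[OF lim bound B]) auto
qed

lemma lam_pos':
  assumes m: "l \<le> m" "m \<le> i" "d < m" and mk: "\<forall>\<^sub>F n in sequentially. m \<le> k n"
  shows "0 < lam c \<kappa> b d i l j"
proof (rule lam_pos[OF c])
  show "case \<kappa> of Some k \<Rightarrow> l \<le> k \<and> d < k | None \<Rightarrow> True"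
  proof (cases \<kappa>)
    case (Some k0)
    then have "\<forall>\<^sub>F n in sequentially. k n = k0" using k by (simp add: height_limit_def)
    from eventually_happens[OF eventually_conj[OF this mk]] obtain n where "k n = k0" "m \<le> k n" by auto
    then show ?thesis using m Some by simp
  qed simp
qed (use m in auto)

text \<open>\<open>m\<close> enters \<open>Alim\<close> only through the index set, and all terms
  are positive.\<close>

lemma Alim_strict_mono:
  assumes m: "m1 < m2" "m2 \<le> i" "m2 \<le> b" "d < m1" and mk: "\<forall>\<^sub>F n in sequentially. m2 \<le> k n"
  shows "Alim c q r \<kappa> b d i m1 < Alim c q r \<kappa> b d i m2"
proof -
  let ?f = "\<lambda>(l, j). q powi l * r powi (- j) * lam c \<kappa> b d i l j"
  have s: "?f summable_on {..m2} \<times> {0..}" by (rule Psi_limit_up(2)[OF _ _ _ mk]) (use m in auto)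
  have pos: "0 < ?f (l, j)" if "l \<le> m2" for l j
    using q r lam_pos'[OF that _ _ mk, of i d b j] m by simp
  have "infsum ?f ({..m1} \<times> {0..}) < infsum ?f ({..m1} \<times> {0..}) + infsum ?f {(m2, 0)}"
    using pos[of m2 0] by simp
  also have "\<dots> = infsum ?f ({..m1} \<times> {0..} \<union> {(m2, 0)})"
  proof (rule infsum_Un_disjoint[symmetric])
    show "?f summable_on {..m1} \<times> {0..}" by (rule summable_on_subset[OF s]) (use m in auto)
  qed (use m in auto)
  also have "\<dots> \<le> infsum ?f ({..m2} \<times> {0..})"
  proof (rule infsum_mono2)
    show "?f summable_on {..m1} \<times> {0..} \<union> {(m2, 0)}" by (rule summable_on_subset[OF s]) (use m in auto)
    fix z :: "int \<times> int" assume "z \<in> {..m2} \<times> {0..} - ({..m1} \<times> {0..} \<union> {(m2, 0)})"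
    then show "0 \<le> ?f z" using pos[of "fst z" "snd z"] by (simp add: case_prod_unfold mem_Times_iff)
  qed (use s m in auto)
  finally show ?thesis by (simp add: Alim_def)
qed

lemma Alim_pos:
  assumes m: "m \<le> i" "m \<le> b" "d < m" and mk: "\<forall>\<^sub>F n in sequentially. m \<le> k n"
  shows "0 < Alim c q r \<kappa> b d i m"
proof -
  let ?f = "\<lambda>(l, j). q powi l * r powi (- j) * lam c \<kappa> b d i l j"
  have s: "?f summable_on {..m} \<times> {0..}" by (rule Psi_limit_up(2)[OF m mk])
  have pos: "0 < ?f (l, j)" if "l \<le> m" for l j
    using q r lam_pos'[OF that _ _ mk, of i d b j] m by simp
  have "0 < infsum ?f {(m, 0)}" using pos[of m 0] by simp
  also have "\<dots> \<le> infsum ?f ({..m} \<times> {0..})"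
  proof (rule infsum_mono2)
    fix z :: "int \<times> int" assume "z \<in> {..m} \<times> {0..} - {(m, 0)}"
    then show "0 \<le> ?f z" using pos[of "fst z" "snd z"] by (simp add: case_prod_unfold mem_Times_iff)
  qed (use s in auto)
  finally show ?thesis by (simp add: Alim_def)
qed

lemma Psi_ratio_limit:
  assumes m: "m \<le> i" "m' \<le> i'" and b: "m \<le> b" "m' \<le> b" and d: "d < m" "d < m'"
    and mk: "\<forall>\<^sub>F n in sequentially. m \<le> k n" "\<forall>\<^sub>F n in sequentially. m' \<le> k n"
  shows "(\<lambda>n. Psi c q r (k n) i m (M n) / Psi c q r (k n) i' m' (M n))
    \<longlonglongrightarrow> Alim c q r \<kappa> b d i m / Alim c q r \<kappa> b d i' m'"
proof -
  let ?nu = "\<lambda>n. r powi M n * (S c (M n - b))\<^sup>2 / S c (k n - d)"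
  have "(\<lambda>n. (?nu n * Psi c q r (k n) i m (M n)) / (?nu n * Psi c q r (k n) i' m' (M n)))
    \<longlonglongrightarrow> Alim c q r \<kappa> b d i m / Alim c q r \<kappa> b d i' m'"
    by (intro tendsto_divide Psi_limit_up(1) m b d mk) (use Alim_pos[OF m(2) b(2) d(2) mk(2)] in auto)
  moreover have "\<forall>\<^sub>F n in sequentially. M n > b" by (rule eventually_gt_int[OF M])
  with mk(1) have "\<forall>\<^sub>F n in sequentially. (?nu n * Psi c q r (k n) i m (M n)) / (?nu n * Psi c q r (k n) i' m' (M n))
     = Psi c q r (k n) i m (M n) / Psi c q r (k n) i' m' (M n)"
  proof eventually_elim
    case (elim n)
    then have "?nu n > 0" using r d S_pos[OF c, of "M n - b"] S_pos[OF c, of "k n - d"] by simp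
    then have "?nu n \<noteq> 0" by linarith
    then show ?case by (rule mult_divide_mult_cancel_left)
  qed
  ultimately show ?thesis by (rule Lim_transform_eventually)
qed

lemma Psi_ratio_up:
  assumes "m \<le> i" "m' \<le> i'" "\<forall>\<^sub>F n in sequentially. m \<le> k n" "\<forall>\<^sub>F n in sequentially. m' \<le> k n"
  shows "(\<lambda>n. Psi c q r (k n) i m (M n) / Psi c q r (k n) i' m' (M n)) \<longlonglongrightarrow> Rup c q r \<kappa> i m i' m'"
  unfolding Rup_def Let_def by (rule Psi_ratio_limit) (use assms in auto)

lemma Rup_strict_mono:
  assumes m: "m1 < m2" "m2 \<le> i" "m' \<le> i'"
    and mk: "\<forall>\<^sub>F n in sequentially. m2 \<le> k n" "\<forall>\<^sub>F n in sequentially. m' \<le> k n"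
  shows "Rup c q r \<kappa> i m1 i' m' < Rup c q r \<kappa> i m2 i' m'"
proof -
  define b d where "b = max m2 m'" and "d = min m1 m' - 1"
  have mk1: "\<forall>\<^sub>F n in sequentially. m1 \<le> k n" using mk(1) by eventually_elim (use m in simp)
  \<comment> \<open>The two ratios carry different normalisations in \<open>Rup\<close>; uniqueness
    of limits rewrites both with a single one, admissible for \<open>m1\<close>, \<open>m2\<close>
    and \<open>m'\<close>.\<close>
  have 1: "Rup c q r \<kappa> i m1 i' m' = Alim c q r \<kappa> b d i m1 / Alim c q r \<kappa> b d i' m'"
    by (rule LIMSEQ_unique[OF Psi_ratio_up Psi_ratio_limit]) (use m mk mk1 in \<open>auto simp: b_def d_def\<close>)
  have 2: "Rup c q r \<kappa> i m2 i' m' = Alim c q r \<kappa> b d i m2 / Alim c q r \<kappa> b d i' m'"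
    by (rule LIMSEQ_unique[OF Psi_ratio_up Psi_ratio_limit]) (use m mk mk1 in \<open>auto simp: b_def d_def\<close>)
  have "Alim c q r \<kappa> b d i m1 < Alim c q r \<kappa> b d i m2"
    by (rule Alim_strict_mono) (use m mk in \<open>auto simp: b_def d_def\<close>)
  moreover have "0 < Alim c q r \<kappa> b d i' m'"
    by (rule Alim_pos) (use m mk in \<open>auto simp: b_def d_def\<close>)
  ultimately show ?thesis unfolding 1 2 by (simp add: divide_strict_right_mono)
qed

end

text \<open>Convergence along every choice of indices is convergence uniform in the index.\<close>

lemma infsum_quotient_tendsto:
  fixes a b :: "nat \<Rightarrow> 'i \<Rightarrow> real"
  assumes pos: "\<forall>\<^sub>F n in sequentially. I n \<noteq> {} \<and> (\<forall>z\<in>I n. 0 < b n z) \<and> a n summable_on I n \<and> b n summable_on I n"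
    and lim: "\<And>z. \<forall>\<^sub>F n in sequentially. z n \<in> I n \<Longrightarrow> (\<lambda>n. a n (z n) / b n (z n)) \<longlonglongrightarrow> L"
  shows "(\<lambda>n. infsum (a n) (I n) / infsum (b n) (I n)) \<longlonglongrightarrow> L"
proof (rule LIMSEQ_I)
  fix e :: real assume e: "e > 0"
  define bad where "bad = (\<lambda>n z. z \<in> I n \<and> \<not> \<bar>a n z / b n z - L\<bar> \<le> e / 2)"
  \<comment> \<open>One choice of indices that hits a violation at every \<open>n\<close> having
    one; convergence along it excludes violations eventually.\<close>
  define z where "z = (\<lambda>n. if \<exists>z. bad n z then SOME z. bad n z else SOME z. z \<in> I n)"
  have z: "z n \<in> I n \<and> ((\<exists>z. bad n z) \<longrightarrow> bad n (z n))" if "I n \<noteq> {}" for n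
    using someI_ex[of "bad n"] someI_ex[of "\<lambda>z. z \<in> I n"] that by (auto simp: z_def bad_def)
  have "\<forall>\<^sub>F n in sequentially. z n \<in> I n" using pos by eventually_elim (use z in blast)
  from lim[OF this] have "\<forall>\<^sub>F n in sequentially. \<bar>a n (z n) / b n (z n) - L\<bar> < e / 2"
    using tendstoD[of _ L sequentially "e / 2"] e by (simp add: dist_real_def)
  with pos have "\<forall>\<^sub>F n in sequentially. \<bar>infsum (a n) (I n) / infsum (b n) (I n) - L\<bar> < e"
  proof eventually_elim
    case (elim n)
    then have "\<not> bad n (z n)" by (simp add: bad_def)
    then have "\<not> bad n w" for w using z[of n] elim by blast
    then have close: "\<bar>a n w / b n w - L\<bar> \<le> e / 2" if "w \<in> I n" for w using that by (auto simp: bad_def)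
    have sa: "a n summable_on I n" and sb: "b n summable_on I n" using elim by auto
    have bpos: "0 < infsum (b n) (I n)"
    proof -
      obtain w where w: "w \<in> I n" using elim by blast
      then have "0 < b n w" using elim by blast
      also have "b n w = infsum (b n) {w}" by simp
      also have "\<dots> \<le> infsum (b n) (I n)"
        by (rule infsum_mono2) (use w elim in \<open>auto simp: less_imp_le\<close>)
      finally show ?thesis .
    qed
    have up: "a n w \<le> (L + e / 2) * b n w" and lo: "(L - e / 2) * b n w \<le> a n w" if "w \<in> I n" for w
    proof -
      have "0 < b n w" using elim that by blast
      moreover have "a n w / b n w \<le> L + e / 2" "L - e / 2 \<le> a n w / b n w"
        using close[OF that] by linarith+
      ultimately show "a n w \<le> (L + e / 2) * b n w" "(L - e / 2) * b n w \<le> a n w"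
        by (simp_all add: divide_le_eq le_divide_eq)
    qed
    have "infsum (a n) (I n) \<le> (L + e / 2) * infsum (b n) (I n)"
      unfolding infsum_cmult_right'[symmetric]
      by (rule infsum_mono[OF sa summable_on_cmult_right[OF sb] up])
    moreover have "(L - e / 2) * infsum (b n) (I n) \<le> infsum (a n) (I n)"
      unfolding infsum_cmult_right'[symmetric]
      by (rule infsum_mono[OF summable_on_cmult_right[OF sb] sa lo])
    ultimately have "infsum (a n) (I n) / infsum (b n) (I n) \<le> L + e / 2"
      "L - e / 2 \<le> infsum (a n) (I n) / infsum (b n) (I n)"
      using bpos by (simp_all add: divide_le_eq le_divide_eq)
    then show ?case using e by linarith
  qed
  then show "\<exists>no. \<forall>n\<ge>no. norm (infsum (a n) (I n) / infsum (b n) (I n) - L) < e"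
    by (simp add: eventually_sequentially)
qed

section \<open>Limits when both coordinates tend to the reference ends\<close>

lemma filterlim_uminus_int: "filterlim m at_bot F \<Longrightarrow> filterlim (\<lambda>n. - m n :: int) at_top F"
  unfolding filterlim_at_top filterlim_at_bot
proof
  fix Z assume "\<forall>Z. \<forall>\<^sub>F n in F. m n \<le> Z"
  then have "\<forall>\<^sub>F n in F. m n \<le> - Z" by blast
  then show "\<forall>\<^sub>F n in F. Z \<le> - m n" by eventually_elim simp
qed

lemma ex_gt_1: "c > 1 \<Longrightarrow> ex c > 1"
proof -
  assume c: "c > 1"
  then have "0 \<le> sqrt (c\<^sup>2 - 1)" by (simp add: one_le_power)
  with c show ?thesis unfolding ex_def by linarith
qed

lemma fraction_le:
  fixes x y e :: real
  shows "0 < x \<Longrightarrow> 0 < y \<Longrightarrow> 0 < e \<Longrightarrow> x * e ^ n \<le> y \<Longrightarrow> x / (x + y) \<le> inverse e ^ n"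
  by (simp add: power_inverse field_simps add_increasing)

lemma inverse_ex_power_tendsto:
  assumes c: "c > 1" and k: "filterlim k at_top F"
  shows "((\<lambda>n. inverse (ex c) ^ nat (k n)) \<longlongrightarrow> 0) F"
proof -
  have "ex c > 1" by (rule ex_gt_1[OF c])
  then have "(\<lambda>n. inverse (ex c) ^ n) \<longlonglongrightarrow> 0" by (intro LIMSEQ_power_zero) (simp add: inverse_less_1_iff)
  moreover have "filterlim (\<lambda>n. nat (k n)) sequentially F" unfolding filterlim_at_top
  proof
    fix Z :: nat
    show "\<forall>\<^sub>F n in F. Z \<le> nat (k n)" using eventually_gt_int[OF k, of "int Z"] by eventually_elim simp
  qed
  ultimately show ?thesis by (rule filterlim_compose)
qed

text \<open>The weight of the exponential \<open>e\<^sup>i\<close> in the limit at the end with horocycle index \<open>k\<close>; the other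
  exponential \<open>e\<close> to the power \<open>- i\<close> has the complementary weight.\<close>

fun mid_weight :: "real \<Rightarrow> int extended \<Rightarrow> real" where
  "mid_weight c (Fin k) = 1 / (1 + ex c powi (2 * k))"
| "mid_weight c Pinf = 0"
| "mid_weight c Minf = 1"

text \<open>Since \<open>ex 1 = 1\<close>, this equals 1 for \<open>c = 1\<close> and every
  \<open>K\<close>, so the kernels cannot see the horocycle index at the spectral radius.\<close>

definition mid_limit :: "real \<Rightarrow> int extended \<Rightarrow> int \<Rightarrow> real" where
  "mid_limit c K i = mid_weight c K * ex c powi i + (1 - mid_weight c K) * ex c powi (- i)"

definition ext_limit :: "(nat \<Rightarrow> int) \<Rightarrow> int extended \<Rightarrow> bool" where
  "ext_limit k K = (case K of Fin k0 \<Rightarrow> \<forall>\<^sub>F n in sequentially. k n = k0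
     | Pinf \<Rightarrow> filterlim k at_top sequentially | Minf \<Rightarrow> filterlim k at_bot sequentially)"

context
  fixes c :: real
  assumes c: "c \<ge> 1"
begin

context
  fixes k m M :: "nat \<Rightarrow> int"
  assumes m: "filterlim m at_bot sequentially" and M: "filterlim M at_top sequentially"
    and kmM: "\<forall>\<^sub>F n in sequentially. m n \<le> k n \<and> k n \<le> M n"
begin

lemma uminus_m: "filterlim (\<lambda>n. - m n) at_top sequentially"
  using m by (rule filterlim_uminus_int)

text \<open>This and \<open>mass_down\<close> are the two summands in the numerator of
  \<open>D\<close> at height 0, the height of the root. Normalised, they become the weights of the
  two exponentials.\<close>

definition mass_up where "mass_up n = S c (M n + 1 - k n) * S c (- m n)"
definition mass_down where "mass_down n = S c (M n) * S c (k n - m n + 1)"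

lemma ev_big: "\<forall>\<^sub>F n in sequentially. M n > a \<and> - m n > a \<and> m n \<le> k n \<and> k n \<le> M n"
  using eventually_gt_int[OF M, of a] eventually_gt_int[OF uminus_m, of a] kmM by eventually_elim simp

lemma mass_pos: "\<forall>\<^sub>F n in sequentially. 0 < mass_up n \<and> 0 < mass_down n"
  using ev_big[of 0]
proof eventually_elim
  case (elim n)
  then show ?case unfolding mass_up_def mass_down_def by (intro conjI mult_pos_pos S_pos[OF c]) auto
qed

lemma D_quotient:
  "\<forall>\<^sub>F n in sequentially. D c (m n) (M n) i (k n) / D c (m n) (M n) 0 (k n) =
     mass_up n / (mass_up n + mass_down n) * (S c (i - m n) / S c (- m n)) + mass_down n / (mass_up n + mass_down n) * (S c (M n - i) / S c (M n))"
  using ev_big[of 0] mass_pos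
proof eventually_elim
  case (elim n)
  have frac: "(x * s + t * y) / d / ((x * u + v * y) / d) =
      x * u / (x * u + v * y) * (s / u) + v * y / (x * u + v * y) * (t / v)"
    if "d > 0" "u > 0" "v > 0" "x * u + v * y > 0" for x s t y d u v :: real
  proof -
    have "(x * s + t * y) / d / ((x * u + v * y) / d) = (x * s + t * y) / (x * u + v * y)"
      using that by (metis divide_divide_eq_right less_irrefl nonzero_eq_divide_eq)
    moreover
    have "x * u / (x * u + v * y) * (s / u) = x * s / (x * u + v * y)"
      "v * y / (x * u + v * y) * (t / v) = t * y / (x * u + v * y)" using that by simp_all
    ultimately show ?thesis by (simp add: add_divide_distrib)
  qed
  have "S c (M n - m n) * S c (M n - m n + 1) * S c (M n - m n + 2) > 0"
    using elim by (intro mult_pos_pos S_pos[OF c]) auto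
  from frac[OF this, of "S c (- m n)" "S c (M n)" "S c (M n + 1 - k n)" "S c (k n - m n + 1)" "S c (i - m n)" "S c (M n - i)"]
  show ?case using elim S_pos[OF c, of "- m n"] S_pos[OF c, of "M n"]
    by (simp add: D_def mass_up_def mass_down_def)
qed

lemma ratios:
  "(\<lambda>n. S c (i - m n) / S c (- m n)) \<longlonglongrightarrow> ex c powi i"
  "(\<lambda>n. S c (M n - i) / S c (M n)) \<longlonglongrightarrow> ex c powi (- i)"
  using S_shift_ratio[OF c uminus_m, of i 0] S_shift_ratio[OF c M, of "- i" 0] by simp_all

text \<open>For constant height \<open>k\<close> the quotient \<open>mass_down / mass_up\<close>
  tends to \<open>ex c powi (2 * k)\<close>: the maximum contributes the exponent
  \<open>k - 1\<close>, the minimum \<open>k + 1\<close>. If the height is unbounded, one mass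
  dominates the other geometrically, as \<open>ex c > 1\<close>.\<close>

lemma weight_limit:
  assumes c1: "c > 1" and k: "ext_limit k K"
  shows "(\<lambda>n. mass_up n / (mass_up n + mass_down n)) \<longlonglongrightarrow> mid_weight c K"
proof (cases K)
  case (Fin k0)
  have k0: "\<forall>\<^sub>F n in sequentially. k n = k0" using k Fin by (simp add: ext_limit_def)
  have "(\<lambda>n. S c (M n) / S c (M n + (1 - k0)) * (S c (- m n + (k0 + 1)) / S c (- m n))) \<longlonglongrightarrow> ex c powi (k0 - 1) * ex c powi (k0 + 1)"
    using S_shift_ratio[OF c M, of 0 "1 - k0"] S_shift_ratio[OF c uminus_m, of "k0 + 1" 0]
    by (intro tendsto_mult) simp_all
  also have "ex c powi (k0 - 1) * ex c powi (k0 + 1) = ex c powi (2 * k0)"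
    using ex_pos[OF c] by (simp flip: power_int_add)
  finally have "(\<lambda>n. 1 / (1 + S c (M n) / S c (M n + (1 - k0)) * (S c (- m n + (k0 + 1)) / S c (- m n)))) \<longlonglongrightarrow> 1 / (1 + ex c powi (2 * k0))"
    using ex_pos[OF c] by (intro tendsto_intros) (auto simp: add_nonneg_eq_0_iff)
  moreover have "\<forall>\<^sub>F n in sequentially. 1 / (1 + S c (M n) / S c (M n + (1 - k0)) * (S c (- m n + (k0 + 1)) / S c (- m n))) = mass_up n / (mass_up n + mass_down n)"
    using k0 mass_pos
  proof eventually_elim
    case (elim n)
    have "1 / (1 + mass_down n / mass_up n) = mass_up n / (mass_up n + mass_down n)" using elim by (simp add: field_simps)
    moreover have "S c (M n) / S c (M n + (1 - k0)) * (S c (- m n + (k0 + 1)) / S c (- m n)) = mass_down n / mass_up n"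
      using elim by (simp add: mass_up_def mass_down_def algebra_simps)
    ultimately show ?case by simp
  qed
  ultimately show ?thesis using Fin by (simp add: Lim_transform_eventually)
next
  case Pinf
  then have kt: "filterlim k at_top sequentially" using k by (simp add: ext_limit_def)
  have "(\<lambda>n. mass_up n / (mass_up n + mass_down n)) \<longlonglongrightarrow> 0"
  proof (rule tendsto_sandwich[OF _ _ tendsto_const])
    show "\<forall>\<^sub>F n in sequentially. 0 \<le> mass_up n / (mass_up n + mass_down n)" using mass_pos by eventually_elim simp
    show "\<forall>\<^sub>F n in sequentially. mass_up n / (mass_up n + mass_down n) \<le> inverse (ex c) ^ nat (k n + 1)"
      using ev_big[of 0] mass_pos eventually_gt_int[OF kt, of 0]
    proof eventually_elim
      case (elim n)
      have "S c (- m n) * ex c ^ nat (k n + 1) \<le> S c (k n - m n + 1)"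
        using S_mult_ex[OF c, of "- m n" "nat (k n + 1)"] elim by (simp add: algebra_simps)
      moreover have "S c (M n + 1 - k n) \<le> S c (M n)" using elim c by (intro S_mono) auto
      ultimately have "S c (M n + 1 - k n) * (S c (- m n) * ex c ^ nat (k n + 1)) \<le> S c (M n) * S c (k n - m n + 1)"
        using elim ex_pos[OF c] by (intro mult_mono S_nonneg[OF c] mult_nonneg_nonneg) auto
      then have "mass_up n * ex c ^ nat (k n + 1) \<le> mass_down n" by (simp add: mass_up_def mass_down_def mult.assoc)
      then show ?case using elim ex_pos[OF c] by (intro fraction_le) auto
    qed
    show "(\<lambda>n. inverse (ex c) ^ nat (k n + 1)) \<longlonglongrightarrow> 0"
      by (rule inverse_ex_power_tendsto[OF c1 filterlim_add_int[OF c kt]])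
  qed
  then show ?thesis using Pinf by simp
next
  case Minf
  then have "filterlim k at_bot sequentially" using k by (simp add: ext_limit_def)
  then have kt: "filterlim (\<lambda>n. - k n) at_top sequentially" by (rule filterlim_uminus_int)
  have "(\<lambda>n. mass_down n / (mass_down n + mass_up n)) \<longlonglongrightarrow> 0"
  proof (rule tendsto_sandwich[OF _ _ tendsto_const])
    show "\<forall>\<^sub>F n in sequentially. 0 \<le> mass_down n / (mass_down n + mass_up n)" using mass_pos by eventually_elim simp
    show "\<forall>\<^sub>F n in sequentially. mass_down n / (mass_down n + mass_up n) \<le> inverse (ex c) ^ nat (- k n + 1)"
      using ev_big[of 0] mass_pos eventually_gt_int[OF kt, of 0]
    proof eventually_elim
      case (elim n)
      have "S c (M n) * ex c ^ nat (- k n + 1) \<le> S c (M n + 1 - k n)"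
        using S_mult_ex[OF c, of "M n" "nat (- k n + 1)"] elim by (simp add: algebra_simps)
      moreover have "S c (k n - m n + 1) \<le> S c (- m n)" using elim c by (intro S_mono) auto
      ultimately have "(S c (M n) * ex c ^ nat (- k n + 1)) * S c (k n - m n + 1) \<le> S c (M n + 1 - k n) * S c (- m n)"
        using elim ex_pos[OF c] by (intro mult_mono S_nonneg[OF c] mult_nonneg_nonneg) auto
      then have "mass_down n * ex c ^ nat (- k n + 1) \<le> mass_up n" by (simp add: mass_up_def mass_down_def mult_ac)
      then show ?case using elim ex_pos[OF c] by (intro fraction_le) auto
    qed
    show "(\<lambda>n. inverse (ex c) ^ nat (- k n + 1)) \<longlonglongrightarrow> 0"
      by (rule inverse_ex_power_tendsto[OF c1 filterlim_add_int[OF c kt]])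
  qed
  then have "(\<lambda>n. 1 - mass_down n / (mass_down n + mass_up n)) \<longlonglongrightarrow> 1 - 0" by (intro tendsto_intros)
  moreover have "\<forall>\<^sub>F n in sequentially. 1 - mass_down n / (mass_down n + mass_up n) = mass_up n / (mass_up n + mass_down n)"
    using mass_pos by eventually_elim (simp add: field_simps)
  ultimately have "(\<lambda>n. mass_up n / (mass_up n + mass_down n)) \<longlonglongrightarrow> 1 - 0" by (rule Lim_transform_eventually)
  then show ?thesis using Minf by simp
qed

text \<open>At \<open>c = 1\<close> both ratios tend to 1, hence so does every convex combination of
  them, however the weights behave.\<close>

lemma D_quotient_limit:
  assumes "c = 1 \<or> ext_limit k K"
  shows "(\<lambda>n. D c (m n) (M n) i (k n) / D c (m n) (M n) 0 (k n)) \<longlonglongrightarrow> mid_limit c K i"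
proof -
  let ?w = "\<lambda>n. mass_up n / (mass_up n + mass_down n)"
  let ?u = "\<lambda>n. S c (i - m n) / S c (- m n)" and ?v = "\<lambda>n. S c (M n - i) / S c (M n)"
  have w: "\<forall>\<^sub>F n in sequentially. mass_down n / (mass_up n + mass_down n) = 1 - ?w n"
    using mass_pos by eventually_elim (simp add: field_simps)
  have "(\<lambda>n. ?w n * ?u n + (1 - ?w n) * ?v n) \<longlonglongrightarrow> mid_limit c K i"
  proof (cases "c = 1")
    case True
    have "(\<lambda>n. ?w n * (?u n - ?v n)) \<longlonglongrightarrow> 0"
    proof (rule tendsto_0_le[where K = 1])
      show "(\<lambda>n. ?u n - ?v n) \<longlonglongrightarrow> 0"
        using tendsto_diff[OF ratios[of i]] True by (simp add: ex_def)
      show "\<forall>\<^sub>F n in sequentially. norm (?w n * (?u n - ?v n)) \<le> norm (?u n - ?v n) * 1"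
        using mass_pos
      proof eventually_elim
        case (elim n)
        then have "\<bar>?w n\<bar> \<le> 1" by simp
        then show ?case using mult_right_mono[of "\<bar>?w n\<bar>" 1 "\<bar>?u n - ?v n\<bar>"] by (simp add: abs_mult)
      qed
    qed
    from tendsto_add[OF this ratios(2)[of i]]
    show ?thesis using True by (simp add: mid_limit_def ex_def algebra_simps)
  next
    case False
    then have "c > 1" using c by simp
    moreover have "ext_limit k K" using False assms by simp
    ultimately show ?thesis unfolding mid_limit_def by (intro tendsto_intros weight_limit ratios)
  qed
  moreover from D_quotient[of i] w
  have "\<forall>\<^sub>F n in sequentially. ?w n * ?u n + (1 - ?w n) * ?v n = D c (m n) (M n) i (k n) / D c (m n) (M n) 0 (k n)"
    by eventually_elim simp
  ultimately show ?thesis by (rule Lim_transform_eventually)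
qed

end

text \<open>Every index pair in the sum has its minimum below \<open>m n\<close> and its maximum
  above \<open>M n\<close>. So \<open>D_quotient_limit\<close> applies along any choice of indices,
  and all quotients of terms have one common limit.\<close>

lemma Psi_mid_limit:
  assumes q: "q > 1" and r: "r > 1" and m: "filterlim m at_bot sequentially" and M: "filterlim M at_top sequentially"
    and kmM: "\<forall>\<^sub>F n in sequentially. m n \<le> k n \<and> k n \<le> M n" and K: "c = 1 \<or> ext_limit k K"
  shows "(\<lambda>n. Psi c q r (k n) i (m n) (M n) / Psi c q r (k n) 0 (m n) (M n)) \<longlonglongrightarrow> mid_limit c K i"
  unfolding Psi_def
proof (rule infsum_quotient_tendsto)
  show "\<forall>\<^sub>F n in sequentially. {..m n} \<times> {M n..} \<noteq> {} \<and>
      (\<forall>z\<in>{..m n} \<times> {M n..}. 0 < (case z of (m, M) \<Rightarrow> q powi m * r powi - M * D c m M 0 (k n))) \<and>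
      (\<lambda>(m, M). q powi m * r powi - M * D c m M i (k n)) summable_on {..m n} \<times> {M n..} \<and>
      (\<lambda>(m, M). q powi m * r powi - M * D c m M 0 (k n)) summable_on {..m n} \<times> {M n..}"
    using ev_big[OF m M kmM, of "\<bar>i\<bar>"]
  proof eventually_elim
    case (elim n)
    then have b: "m n \<le> i" "i \<le> M n" "m n \<le> 0" "0 \<le> M n" by auto
    show ?case
    proof (intro conjI ballI)
      fix z assume "z \<in> {..m n} \<times> {M n..}"
      then show "0 < (case z of (m, M) \<Rightarrow> q powi m * r powi - M * D c m M 0 (k n))"
        using b elim q r by (auto intro!: mult_pos_pos D_pos[OF c])
    qed (use wD_summable[OF c q r] b elim in auto)
  qed
  fix z assume z: "\<forall>\<^sub>F n in sequentially. z n \<in> {..m n} \<times> {M n..}"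
  have 1: "filterlim (\<lambda>n. fst (z n)) at_bot sequentially" unfolding filterlim_at_bot
  proof
    fix Z show "\<forall>\<^sub>F n in sequentially. fst (z n) \<le> Z"
      using z m[unfolded filterlim_at_bot, rule_format, of Z] by eventually_elim auto
  qed
  have 2: "filterlim (\<lambda>n. snd (z n)) at_top sequentially" unfolding filterlim_at_top
  proof
    fix Z show "\<forall>\<^sub>F n in sequentially. Z \<le> snd (z n)"
      using z M[unfolded filterlim_at_top, rule_format, of Z] by eventually_elim auto
  qed
  have 3: "\<forall>\<^sub>F n in sequentially. fst (z n) \<le> k n \<and> k n \<le> snd (z n)"
    using z kmM by eventually_elim auto
  have "(case z n of (m, M) \<Rightarrow> q powi m * r powi - M * D c m M i (k n)) /
      (case z n of (m, M) \<Rightarrow> q powi m * r powi - M * D c m M 0 (k n))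
      = D c (fst (z n)) (snd (z n)) i (k n) / D c (fst (z n)) (snd (z n)) 0 (k n)" for n
    using q r by (simp add: case_prod_unfold)
  with D_quotient_limit[OF 1 2 3 K]
  show "(\<lambda>n. (case z n of (m, M) \<Rightarrow> q powi m * r powi - M * D c m M i (k n)) /
      (case z n of (m, M) \<Rightarrow> q powi m * r powi - M * D c m M 0 (k n))) \<longlonglongrightarrow> mid_limit c K i"
    by simp
qed

lemma mid_weight_inj: "c > 1 \<Longrightarrow> mid_weight c K = mid_weight c K' \<Longrightarrow> K = K'"
proof -
  assume c1: "c > 1" and eq: "mid_weight c K = mid_weight c K'"
  have e: "ex c > 1" by (rule ex_gt_1[OF c1])
  have pos: "0 < ex c powi (2 * k)" for k using e by simp
  have inj: "k = k'" if "ex c powi (2 * k) = ex c powi (2 * k')" for k k' :: int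
  proof (rule ccontr)
    assume "k \<noteq> k'"
    then have "2 * k < 2 * k' \<or> 2 * k' < 2 * k" by auto
    then have "ex c powi (2 * k) < ex c powi (2 * k') \<or> ex c powi (2 * k') < ex c powi (2 * k)"
      using e power_int_strict_increasing by blast
    then show False using that by simp
  qed
  have strict: "0 < mid_weight c (Fin k)" "mid_weight c (Fin k) < 1" for k
    using pos[of k] by simp_all
  have fin: "k = k'" if "mid_weight c (Fin k) = mid_weight c (Fin k')" for k k'
  proof (rule inj)
    have "inverse (1 + ex c powi (2 * k)) = inverse (1 + ex c powi (2 * k'))"
      using that by (simp add: divide_inverse)
    then show "ex c powi (2 * k) = ex c powi (2 * k')" by simp
  qed
  have ne: "mid_weight c (Fin k) \<noteq> 0" "mid_weight c (Fin k) \<noteq> 1" for k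
    using strict[of k] by linarith+
  show ?thesis
    using eq fin ne by (cases K; cases K') (simp_all only: mid_weight.simps(2,3) zero_neq_one one_neq_zero, (metis+)?)
qed

text \<open>At height 1 the two exponentials are \<open>ex c\<close> and its inverse, which differ,
  so the value determines the weight.\<close>

lemma mid_limit_inj: "c > 1 \<Longrightarrow> mid_limit c K 1 = mid_limit c K' 1 \<Longrightarrow> K = K'"
proof -
  assume c1: "c > 1" and eq: "mid_limit c K 1 = mid_limit c K' 1"
  have e: "ex c > 1" by (rule ex_gt_1[OF c1])
  then have "inverse (ex c) < 1" by (simp add: inverse_less_1_iff)
  have "(mid_weight c K - mid_weight c K') * (ex c - inverse (ex c)) = 0"
    using eq e by (simp add: mid_limit_def power_int_minus algebra_simps)
  then have "mid_weight c K = mid_weight c K'" using e \<open>inverse (ex c) < 1\<close> by auto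
  then show ?thesis by (rule mid_weight_inj[OF c1])
qed

end

section \<open>Separation and minimality of compactifications\<close>

lemma metrizable_eventually_within:
  assumes "metrizable_space X"
    and "\<And>\<sigma>. (\<And>n. \<sigma> n \<in> A) \<Longrightarrow> limitin X \<sigma> a sequentially \<Longrightarrow> \<forall>\<^sub>F n in sequentially. Q (\<sigma> n)"
  shows "eventually Q (atin_within X a A)"
proof -
  obtain M d where M: "Metric_space M d" "X = Metric_space.mtopology M d"
    using assms(1) by (auto simp: metrizable_space_def)
  interpret Metric_space M d by (rule M(1))
  show ?thesis unfolding M(2) eventually_atin_within_sequentially
    using assms(2) unfolding M(2) by blast
qed

lemma metrizable_closure_sequence:
  assumes "metrizable_space X" "a \<in> X closure_of A"
  obtains \<sigma> where "\<And>n. \<sigma> n \<in> A" "limitin X \<sigma> a sequentially"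
proof -
  obtain M d where M: "Metric_space M d" "X = Metric_space.mtopology M d"
    using assms(1) by (auto simp: metrizable_space_def)
  interpret Metric_space M d by (rule M(1))
  show thesis using assms(2) that unfolding M(2) closure_of_sequentially by blast
qed

lemma compact_metrizable_subsequence:
  fixes \<sigma> :: "nat \<Rightarrow> 'a"
  assumes "metrizable_space X" "compact_space X" "\<And>n. \<sigma> n \<in> topspace X"
  obtains l s where "l \<in> topspace X" "strict_mono s" "limitin X (\<sigma> \<circ> s) l sequentially"
proof -
  obtain M d where M: "Metric_space M d" "X = Metric_space.mtopology M d"
    using assms(1) by (auto simp: metrizable_space_def)
  interpret Metric_space M d by (rule M(1))
  have "range \<sigma> \<subseteq> M" using assms(3) by (auto simp: M(2))
  then obtain l s where "l \<in> M" "strict_mono s" "limitin mtopology (\<sigma> \<circ> s) l sequentially"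
    using assms(2)[unfolded M(2) compact_space_sequentially, rule_format, of \<sigma>] by blast
  then show thesis by (intro that[of l s]) (simp_all add: M(2))
qed

text \<open>A neighbourhood that meets the dense image only in \<open>e v\<close> becomes, after
  removal of this closed point, an open set missing a dense set.\<close>

lemma discrete_compactification_isolated:
  assumes X: "discrete_compactification V X e" and v: "v \<in> V"
  shows "openin X {e v}"
proof -
  have "openin (subtopology X (e ` V)) {e v}"
    using X v by (simp add: discrete_compactification_def)
  then obtain U where U: "openin X U" "{e v} = U \<inter> e ` V" by (auto simp: openin_subtopology)
  have "t1_space X" using X metrizable_imp_t1_space by (auto simp: discrete_compactification_def)
  moreover have "e v \<in> topspace X" using X v by (auto simp: discrete_compactification_def)
  ultimately have "closedin X {e v}" by (simp add: closedin_t1_singleton)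
  then have op: "openin X (U - {e v})" using U(1) by (rule openin_diff[rotated])
  have "U - {e v} = {}"
  proof (rule ccontr)
    assume "U - {e v} \<noteq> {}"
    then obtain z where z: "z \<in> U - {e v}" by blast
    have "z \<in> topspace X" using z openin_subset[OF U(1)] by blast
    then have "z \<in> X closure_of (e ` V)" using X by (simp add: discrete_compactification_def)
    from this[unfolded in_closure_of, THEN conjunct2, rule_format, of "U - {e v}"] z op
    obtain w where w: "w \<in> e ` V" "w \<in> U - {e v}" by blast
    then have "w \<in> {e v}" unfolding U(2) by blast
    then show False using w(2) by blast
  qed
  then have "U \<subseteq> {e v}" by blast
  moreover have "e v \<in> U" using equalityD1[OF U(2)] by blast
  ultimately have "U = {e v}" by blast
  then show ?thesis using U(1) by simp
qed

text \<open>Vertices are isolated, so convergence to a vertex in \<open>X\<close> makes the sequence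
  eventually constant, and it then converges to the same vertex in \<open>Y\<close>.\<close>

lemma limit_not_vertex:
  assumes X: "discrete_compactification V X e" and Y: "discrete_compactification V Y e'"
    and u: "\<And>n. u n \<in> V" and lX: "limitin X (\<lambda>n. e (u n)) \<zeta> sequentially"
    and lY: "limitin Y (\<lambda>n. e' (u n)) y sequentially" and y: "y \<notin> e' ` V"
  shows "\<zeta> \<in> topspace X - e ` V"
proof
  show "\<zeta> \<in> topspace X" using lX by (rule limitin_topspace)
  show "\<zeta> \<notin> e ` V"
  proof
    assume "\<zeta> \<in> e ` V"
    then obtain v where v: "v \<in> V" "\<zeta> = e v" by blast
    then have "\<forall>\<^sub>F n in sequentially. e (u n) \<in> {e v}"
      using lX discrete_compactification_isolated[OF X v(1)] by (auto simp: limitin_def)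
    then have "\<forall>\<^sub>F n in sequentially. e' (u n) = e' v"
    proof eventually_elim
      case (elim n)
      then have "u n = v" using X u[of n] v(1) by (auto simp: discrete_compactification_def dest: inj_onD)
      then show ?case by simp
    qed
    moreover have "e' v \<in> topspace Y" using Y v by (auto simp: discrete_compactification_def)
    ultimately have "limitin Y (\<lambda>n. e' (u n)) (e' v) sequentially"
      by (simp add: limitin_eventually)
    moreover have "Hausdorff_space Y"
      using Y by (auto simp: discrete_compactification_def intro: metrizable_imp_Hausdorff_space)
    ultimately have "y = e' v" using limitin_Hausdorff_unique[OF lY] by simp
    then show False using y v by blast
  qed
qed

text \<open>For minimality, take vertices tending to a boundary point \<open>y\<close> of
  \<open>Y\<close>. Their cluster points in the compact space \<open>X\<close> all have the same
  kernel limits, since the kernels extend to \<open>Y\<close>; by separation there is only one, and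
  it is the value at \<open>y\<close> of the extended identity.\<close>

theorem Martin_criterion:
  assumes X: "discrete_compactification V X e"
    and lim: "\<And>\<zeta>. \<zeta> \<in> topspace X - e ` V \<Longrightarrow> \<exists>L. \<forall>v. (\<forall>n. v n \<in> V) \<longrightarrow>
      limitin X (\<lambda>n. e (v n)) \<zeta> sequentially \<longrightarrow> (\<forall>x\<in>V. (\<lambda>n. Martin_kernel V P x0 t x (v n)) \<longlonglongrightarrow> L x)"
    and sep: "\<And>\<zeta> \<zeta>' u v L. \<zeta> \<in> topspace X - e ` V \<Longrightarrow> \<zeta>' \<in> topspace X - e ` V \<Longrightarrow>
      (\<And>n. u n \<in> V) \<Longrightarrow> (\<And>n. v n \<in> V) \<Longrightarrow>
      limitin X (\<lambda>n. e (u n)) \<zeta> sequentially \<Longrightarrow> limitin X (\<lambda>n. e (v n)) \<zeta>' sequentially \<Longrightarrow>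
      (\<And>x. x \<in> V \<Longrightarrow> (\<lambda>n. Martin_kernel V P x0 t x (u n)) \<longlonglongrightarrow> L x) \<Longrightarrow>
      (\<And>x. x \<in> V \<Longrightarrow> (\<lambda>n. Martin_kernel V P x0 t x (v n)) \<longlonglongrightarrow> L x) \<Longrightarrow> \<zeta> = \<zeta>'"
  shows "is_Martin_compactification TYPE('d) V P x0 t X e"
  unfolding is_Martin_compactification_def
proof (intro conjI ballI allI impI)
  note X' = X[unfolded discrete_compactification_def]
  show "discrete_compactification V X e" by (rule X)
  fix x assume x: "x \<in> V"
  let ?K = "Martin_kernel V P x0 t x"
  let ?f = "\<lambda>z. ?K (inv_into V e z)"
  have f: "?f (e v) = ?K v" if "v \<in> V" for v using X' that by (simp add: inv_into_f_f)
  obtain g where "continuous_map (subtopology X (topspace X)) euclideanreal g" "\<And>z. z \<in> e ` V \<Longrightarrow> g z = ?f z"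
  proof (rule continuous_map_extension_pointwise_alt[of euclideanreal "e ` V" "topspace X" X ?f])
    show "continuous_map (subtopology X (e ` V)) euclideanreal ?f" using X' by simp
    fix \<zeta> assume \<zeta>: "\<zeta> \<in> topspace X - e ` V"
    from lim[OF this] obtain L where L: "\<And>v. (\<And>n. v n \<in> V) \<Longrightarrow> limitin X (\<lambda>n. e (v n)) \<zeta> sequentially
       \<Longrightarrow> (\<lambda>n. ?K (v n)) \<longlonglongrightarrow> L x" using x by blast
    have "limitin euclideanreal ?f (L x) (atin_within X \<zeta> (e ` V))" unfolding limitin_canonical_iff
    proof (rule tendstoI)
      fix \<epsilon> :: real assume \<epsilon>: "\<epsilon> > 0"
      show "\<forall>\<^sub>F z in atin_within X \<zeta> (e ` V). dist (?f z) (L x) < \<epsilon>"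
      proof (rule metrizable_eventually_within)
        fix \<sigma> :: "nat \<Rightarrow> 'b" assume \<sigma>: "\<And>n. \<sigma> n \<in> e ` V" "limitin X \<sigma> \<zeta> sequentially"
        let ?v = "\<lambda>n. inv_into V e (\<sigma> n)"
        have "(\<lambda>n. ?K (?v n)) \<longlonglongrightarrow> L x"
          by (rule L) (use \<sigma> in \<open>auto simp: f_inv_into_f inv_into_into\<close>)
        then show "\<forall>\<^sub>F n in sequentially. dist (?f (\<sigma> n)) (L x) < \<epsilon>" using \<epsilon> by (rule tendstoD)
      qed (use X' in auto)
    qed
    then show "\<exists>l. limitin euclideanreal ?f l (atin_within X \<zeta> (e ` V))" by blast
  qed (use X' regular_space_euclidean in auto)
  then show "extends_continuously V X e ?K"
    unfolding extends_continuously_def using f by (intro exI[of _ g]) auto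
next
  note X' = X[unfolded discrete_compactification_def]
  fix Y :: "'d topology" and e'
  assume "discrete_compactification V Y e' \<and> (\<forall>x\<in>V. extends_continuously V Y e' (Martin_kernel V P x0 t x))"
  then have Y: "discrete_compactification V Y e'"
    and ext: "\<forall>x\<in>V. \<exists>F. continuous_map Y euclideanreal F \<and> (\<forall>y\<in>V. F (e' y) = Martin_kernel V P x0 t x y)"
    by (auto simp: extends_continuously_def)
  note Y' = Y[unfolded discrete_compactification_def]
  from ext obtain F where F: "\<And>x. x \<in> V \<Longrightarrow> continuous_map Y euclideanreal (F x)"
    "\<And>x y. x \<in> V \<Longrightarrow> y \<in> V \<Longrightarrow> F x (e' y) = Martin_kernel V P x0 t x y" by metis
  have FK: "(\<lambda>n. Martin_kernel V P x0 t x (u n)) \<longlonglongrightarrow> F x y"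
    if "x \<in> V" "\<And>n. u n \<in> V" "limitin Y (\<lambda>n. e' (u n)) y sequentially" for x u y
  proof -
    have "limitin euclideanreal (F x \<circ> (\<lambda>n. e' (u n))) (F x y) sequentially"
      by (rule continuous_map_limit[OF F(1)[OF that(1)] that(3)])
    then show ?thesis using F(2)[OF that(1) that(2)] by (simp add: o_def)
  qed
  let ?f = "\<lambda>z. e (inv_into V e' z)"
  have eX: "e v \<in> topspace X" if "v \<in> V" for v using X' that by blast
  have mc: "metrizable_space X" "compact_space X" using X' by blast+
  have f: "?f (e' v) = e v" if "v \<in> V" for v using Y' that by (simp add: inv_into_f_f)
  obtain g where "continuous_map (subtopology Y (topspace Y)) X g" "\<And>z. z \<in> e' ` V \<Longrightarrow> g z = ?f z"
  proof (rule continuous_map_extension_pointwise_alt[of X "e' ` V" "topspace Y" Y ?f])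
    show "regular_space X" using X' by (simp add: metrizable_imp_regular_space)
    show "continuous_map (subtopology Y (e' ` V)) X ?f"
      using X' Y' by (auto simp: continuous_map_from_discrete_topology inv_into_into)
    fix y assume y: "y \<in> topspace Y - e' ` V"
    obtain \<sigma> where \<sigma>: "\<And>n. \<sigma> n \<in> e' ` V" "limitin Y \<sigma> y sequentially"
      using metrizable_closure_sequence[of Y y "e' ` V"] Y' y by auto
    define u where "u = (\<lambda>n. inv_into V e' (\<sigma> n))"
    have u: "u n \<in> V" "e' (u n) = \<sigma> n" for n using \<sigma>(1)[of n] by (auto simp: u_def inv_into_into f_inv_into_f)
    obtain \<zeta> s where s: "strict_mono s" "limitin X ((\<lambda>n. e (u n)) \<circ> s) \<zeta> sequentially"
      using compact_metrizable_subsequence[OF mc, of "\<lambda>n. e (u n)"] eX[OF u(1)] by metis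
    define us where "us = u \<circ> s"
    have us: "us n \<in> V" "limitin X (\<lambda>n. e (us n)) \<zeta> sequentially" "limitin Y (\<lambda>n. e' (us n)) y sequentially" for n
      using u s limitin_subsequence[OF s(1) \<sigma>(2)] by (auto simp: us_def o_def)
    have \<zeta>: "\<zeta> \<in> topspace X - e ` V"
      by (rule limit_not_vertex[OF X Y us(1,2,3)]) (use y in auto)
    have "limitin X ?f \<zeta> (atin_within Y y (e' ` V))" unfolding limitin_def
    proof (intro conjI allI impI)
      fix U assume U: "openin X U \<and> \<zeta> \<in> U"
      show "\<forall>\<^sub>F z in atin_within Y y (e' ` V). ?f z \<in> U"
      proof (rule metrizable_eventually_within, goal_cases)
        case (2 \<tau>)
        show ?case
        proof (rule ccontr)
          \<comment> \<open>A subsequence staying outside \<open>U\<close> has a cluster point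
            \<open>\<zeta>'\<close>, which separation identifies with \<open>\<zeta>\<close>, a
            point of the open set \<open>U\<close>.\<close>
          assume "\<not> (\<forall>\<^sub>F n in sequentially. ?f (\<tau> n) \<in> U)"
          from not_eventually_sequentiallyD[OF this]
          obtain a :: "nat \<Rightarrow> nat" where a: "strict_mono a" "\<And>n. ?f (\<tau> (a n)) \<notin> U" by blast
          define w where "w = (\<lambda>n. inv_into V e' (\<tau> (a n)))"
          have w: "w n \<in> V" "e' (w n) = \<tau> (a n)" "e (w n) \<notin> U" for n
            using 2(1)[of "a n"] a(2)[of n] by (auto simp: w_def inv_into_into f_inv_into_f)
          obtain \<zeta>' b where b: "strict_mono b" "limitin X ((\<lambda>n. e (w n)) \<circ> b) \<zeta>' sequentially"
            using compact_metrizable_subsequence[OF mc, of "\<lambda>n. e (w n)"] eX[OF w(1)] by metis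
          define wb where "wb = w \<circ> b"
          have "limitin Y (\<tau> \<circ> (a \<circ> b)) y sequentially"
            using limitin_subsequence[OF strict_mono_o[OF a(1) b(1)] 2(2)] .
          then have wb: "wb n \<in> V" "limitin X (\<lambda>n. e (wb n)) \<zeta>' sequentially"
            "limitin Y (\<lambda>n. e' (wb n)) y sequentially" "e (wb n) \<notin> U" for n
            using w b by (auto simp: wb_def o_def)
          have \<zeta>': "\<zeta>' \<in> topspace X - e ` V"
            by (rule limit_not_vertex[OF X Y wb(1,2,3)]) (use y in auto)
          have "\<zeta> = \<zeta>'"
            using sep[OF \<zeta> \<zeta>' us(1) wb(1) us(2) wb(2), of "\<lambda>x. F x y"] FK us wb by blast
          then have "\<forall>\<^sub>F n in sequentially. e (wb n) \<in> U" using wb(2) U by (simp add: limitin_def)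
          then show False using wb(4) by simp
        qed
      qed (use Y' in auto)
    qed (use \<zeta> in auto)
    then show "\<exists>l. limitin X ?f l (atin_within Y y (e' ` V))" by blast
  qed (use Y' in auto)
  then show "smaller_compactification V X e Y e'"
    unfolding smaller_compactification_def using f by (intro exI[of _ g]) auto
qed

section \<open>The end topology\<close>

context pointed
begin

definition G :: "'a hat_point \<Rightarrow> 'a set" where "G z = geodesic T (origin T) z"

abbreviation lev :: "'a \<Rightarrow> nat" where "lev u \<equiv> d (origin T) u"

lemma G_Vert: "u \<in> G (Vert v) \<longleftrightarrow> lev u + d u v = lev v"
  by (simp add: G_def geodesic.simps)

lemma G_End: "\<xi> \<in> ends (adj T) \<Longrightarrow> G (End \<xi>) = range (eray \<xi> (origin T))"
  using geodesic_End[of \<xi> "origin T"] by (simp add: G_def geodesic.simps)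

lemma lev_eray: "\<xi> \<in> ends (adj T) \<Longrightarrow> lev (eray \<xi> (origin T) n) = n"
  using ray_gdist[OF eray_rays, of \<xi> 0 n "origin T"] by simp

lemma G_Vert_self [simp]: "v \<in> G (Vert v)"
  by (simp add: G_Vert)

lemma G_Vert_trans: "u \<in> G (Vert v) \<Longrightarrow> v \<in> G (Vert w) \<Longrightarrow> u \<in> G (Vert w)"
  using gdist_triangle[of u w v] gdist_triangle[of "origin T" w u] by (auto simp: G_Vert)

text \<open>By induction on the distance to \<open>v\<close> the next vertices toward
  \<open>v\<close> coincide, and a vertex has only one neighbour closer to the root.\<close>

lemma G_Vert_unique: "u \<in> G (Vert v) \<Longrightarrow> u' \<in> G (Vert v) \<Longrightarrow> lev u = lev u' \<Longrightarrow> u = u'"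
proof (induction "d u v" arbitrary: u u')
  case 0
  then show ?case by (auto simp: G_Vert)
next
  case (Suc n)
  have step: "\<exists>w. adj T w u \<and> w \<in> G (Vert v) \<and> lev w = Suc (lev u) \<and> d w v = n"
    if "u \<in> G (Vert v)" "d u v = Suc n" for u
  proof -
    from that(2) have "d v u = Suc n" by (simp add: gdist_commute)
    then obtain w where w: "adj T w u" "d v w = n" by (rule gdist_Suc_obtain)
    have "lev w \<le> lev u + 1" by (rule gdist_adj_le) (rule adj_sym[OF w(1)])
    moreover have "lev v \<le> lev w + n" using gdist_triangle[of "origin T" v w] w(2) by (simp add: gdist_commute)
    ultimately show ?thesis using w that by (intro exI[of _ w]) (auto simp: G_Vert gdist_commute)
  qed
  have "d u' v = Suc n" using Suc by (auto simp: G_Vert)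
  with step[of u] step[of u'] Suc obtain w w' where w: "adj T w u" "w \<in> G (Vert v)" "lev w = Suc (lev u)" "d w v = n"
    and w': "adj T w' u'" "w' \<in> G (Vert v)" "lev w' = Suc (lev u')" "d w' v = n" by metis
  have "w = w'" using Suc.hyps(1)[of w w'] w w' Suc.prems by simp
  then show ?case using w w' by (intro unique_closer[of w u u' "origin T"]) auto
qed

lemma G_Vert_level: "j \<le> lev v \<Longrightarrow> \<exists>u\<in>G (Vert v). lev u = j"
proof (induction "lev v" arbitrary: v)
  case 0
  then show ?case by (intro bexI[of _ v]) auto
next
  case (Suc n)
  show ?case
  proof (cases "j = lev v")
    case False
    from Suc.hyps(2)[symmetric] obtain y where y: "adj T y v" "lev y = n" by (rule gdist_Suc_obtain)
    then obtain u where u: "u \<in> G (Vert y)" "lev u = j" using Suc False by force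
    have "y \<in> G (Vert v)" using y Suc.hyps(2) gdist_adj[OF y(1)] by (simp add: G_Vert)
    then show ?thesis using u G_Vert_trans by blast
  qed (use G_Vert_self in blast)
qed

lemma hat_cases:
  assumes "z \<in> hat_tree T"
  obtains (Vert) v where "z = Vert v" | (End) \<xi> where "z = End \<xi>" "\<xi> \<in> ends (adj T)"
  using assms by (auto simp: hat_tree_def)

lemma G_unique: "z \<in> hat_tree T \<Longrightarrow> u \<in> G z \<Longrightarrow> u' \<in> G z \<Longrightarrow> lev u = lev u' \<Longrightarrow> u = u'"
  by (erule hat_cases) (auto simp: G_End lev_eray intro: G_Vert_unique)

lemma G_subset:
  assumes z: "z \<in> hat_tree T" and v: "v \<in> G z" and u: "u \<in> G (Vert v)" shows "u \<in> G z"
  using z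
proof (cases rule: hat_cases)
  case (End \<xi>)
  let ?\<pi> = "eray \<xi> (origin T)"
  from v End obtain n where n: "v = ?\<pi> n" by (auto simp: G_End)
  have le: "lev u \<le> n" using u lev_eray[OF End(2), of n] by (simp add: G_Vert n)
  then have "?\<pi> (lev u) \<in> G (Vert v)"
    using ray_gdist[OF eray_rays[OF End(2)] le] lev_eray[OF End(2)] by (simp add: G_Vert n)
  then have "u = ?\<pi> (lev u)" using lev_eray[OF End(2)] by (intro G_Vert_unique[OF u]) auto
  then show ?thesis using End by (auto simp: G_End)
qed (use u v G_Vert_trans in auto)

lemma origin_in_G: "z \<in> hat_tree T \<Longrightarrow> origin T \<in> G z"
proof (erule hat_cases)
  fix \<xi> assume "z = End \<xi>" "\<xi> \<in> ends (adj T)"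
  then show ?thesis using eray_0[of \<xi> "origin T"] by (auto simp: G_End intro: range_eqI[of _ _ 0])
qed (simp add: G_Vert)

text \<open>Points are henceforth handled through their geodesics from the root, which treats
  vertices and ends alike.\<close>

lemma G_inj:
  assumes z: "z \<in> hat_tree T" and w: "w \<in> hat_tree T" and eq: "G z = G w" shows "z = w"
proof -
  have mixed: "G (Vert v) \<noteq> G (End \<xi>)" if "\<xi> \<in> ends (adj T)" for v \<xi>
  proof
    assume "G (Vert v) = G (End \<xi>)"
    then have "eray \<xi> (origin T) (Suc (lev v)) \<in> G (Vert v)" using that by (simp add: G_End)
    then show False using lev_eray[OF that] by (simp add: G_Vert)
  qed
  show ?thesis
    using z
  proof (cases rule: hat_cases)
    case (Vert v)
    show ?thesis using w
    proof (cases rule: hat_cases)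
      case (Vert v')
      have "v \<in> G (Vert v')" "v' \<in> G (Vert v)" using eq G_Vert_self unfolding Vert \<open>z = Vert v\<close> by blast+
      then have "d v v' = 0" unfolding G_Vert by linarith
      then have "v = v'" by simp
      then show ?thesis by (simp add: Vert \<open>z = Vert v\<close>)
    qed (use mixed eq Vert in auto)
  next
    case (End \<xi>)
    show ?thesis using w
    proof (cases rule: hat_cases)
      case (End \<xi>')
      have "eray \<xi> (origin T) n = eray \<xi>' (origin T) n" for n
      proof (rule G_unique[OF w])
        show "eray \<xi> (origin T) n \<in> G w" using eq \<open>z = End \<xi>\<close> \<open>\<xi> \<in> ends (adj T)\<close> by (auto simp: G_End)
        show "eray \<xi>' (origin T) n \<in> G w" using End by (auto simp: G_End)
      qed (use lev_eray End \<open>\<xi> \<in> ends (adj T)\<close> in auto)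
      then have "eray \<xi> (origin T) = eray \<xi>' (origin T)" by (rule ext)
      then have "eray \<xi> (origin T) \<in> \<xi>'" using eray_in[OF End(2), of "origin T"] by simp
      then have "\<xi> = \<xi>'" by (rule end_eqI[OF \<open>\<xi> \<in> ends (adj T)\<close> End(2) eray_in[OF \<open>\<xi> \<in> ends (adj T)\<close>]])
      then show ?thesis using End \<open>z = End \<xi>\<close> by simp
    qed (use mixed[of \<xi>] eq End in auto)
  qed
qed

text \<open>\<open>end_dist_le\<close> translates the end metric into equality of these finite
  initial segments, so confluents can be avoided afterwards.\<close>

definition tr :: "'a hat_point \<Rightarrow> nat \<Rightarrow> 'a set" where "tr z n = {u \<in> G z. lev u \<le> n}"

lemma tr_mono: "tr z n = tr w n \<Longrightarrow> m \<le> n \<Longrightarrow> tr z m = tr w m"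
proof -
  assume eq: "tr z n = tr w n" and "m \<le> n"
  have "tr x m = {u \<in> tr x n. lev u \<le> m}" for x using \<open>m \<le> n\<close> by (auto simp: tr_def)
  then show ?thesis by (simp only: eq)
qed

text \<open>The confluent is the deepest common vertex; it exists because common vertices of
  unbounded depth would make the geodesics equal.\<close>

lemma G_meet:
  assumes z: "z \<in> hat_tree T" and w: "w \<in> hat_tree T" and ne: "z \<noteq> w"
  obtains c where "confluent T z w = c" "\<And>n. tr z n = tr w n \<longleftrightarrow> n \<le> lev c" "c \<in> G z" "c \<in> G w"
proof -
  have half: "u \<in> G w" if "z \<in> hat_tree T" "w \<in> hat_tree T" "u \<in> G z" "v \<in> G z \<inter> G w" "lev u \<le> lev v" for u v z w
  proof -
    note prems = that
    obtain u' where u': "u' \<in> G (Vert v)" "lev u' = lev u" using G_Vert_level[OF prems(5)] by blast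
    then have "u' \<in> G z" "u' \<in> G w" using G_subset[OF prems(1) _ u'(1)] G_subset[OF prems(2) _ u'(1)] prems(4) by blast+
    moreover have "u = u'" using G_unique[OF prems(1,3) \<open>u' \<in> G z\<close>] u' by simp
    ultimately show ?thesis by simp
  qed
  have "\<exists>N. \<forall>v\<in>G z \<inter> G w. lev v \<le> N"
  proof (rule ccontr)
    assume "\<not> ?thesis"
    then have big: "\<exists>v\<in>G z \<inter> G w. N \<le> lev v" for N by (meson nat_le_linear)
    have "G z = G w"
    proof (intro equalityI subsetI)
      fix u assume "u \<in> G z" then show "u \<in> G w" using big[of "lev u"] half[OF z w] by blast
    next
      fix u assume "u \<in> G w" then show "u \<in> G z" using big[of "lev u"] half[OF w z] by blast
    qed
    then show False using G_inj z w ne by blast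
  qed
  then obtain N where N: "\<And>v. v \<in> G z \<inter> G w \<Longrightarrow> lev v \<le> N" by blast
  let ?P = "\<lambda>k. \<exists>v\<in>G z \<inter> G w. lev v = k"
  have "?P (lev (origin T))" using origin_in_G z w by blast
  then have "?P (Greatest ?P)" by (rule GreatestI_nat[where b = N]) (use N in blast)
  then obtain c where c: "c \<in> G z \<inter> G w" "lev c = Greatest ?P" by blast
  have max: "lev v \<le> lev c" if "v \<in> G z \<inter> G w" for v
    unfolding c(2) by (rule Greatest_le_nat[where b = N]) (use N that in blast)+
  have meet: "G z \<inter> G w = G (Vert c)"
  proof (intro equalityI subsetI)
    fix u assume u: "u \<in> G z \<inter> G w"
    obtain u' where u': "u' \<in> G (Vert c)" "lev u' = lev u" using G_Vert_level[OF max[OF u]] by blast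
    then have "u' \<in> G z" using G_subset[OF z] c by blast
    then have "u = u'" using G_unique[OF z, of u u'] u u' by simp
    then show "u \<in> G (Vert c)" using u' by simp
  next
    fix u assume "u \<in> G (Vert c)"
    then show "u \<in> G z \<inter> G w" using G_subset[OF z] G_subset[OF w] c by blast
  qed
  have vert: "Vert v \<in> hat_tree T" for v by (simp add: hat_tree_def)
  have "confluent T z w = c"
    unfolding confluent_def
  proof (rule the_equality)
    show "geodesic T (origin T) z \<inter> geodesic T (origin T) w = geodesic T (origin T) (Vert c)"
      using meet by (simp add: G_def)
    fix c' assume "geodesic T (origin T) z \<inter> geodesic T (origin T) w = geodesic T (origin T) (Vert c')"
    then have "G (Vert c') = G (Vert c)" using meet by (simp add: G_def)
    then have "Vert c' = Vert c" by (rule G_inj[OF vert vert])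
    then show "c' = c" by simp
  qed
  moreover have "tr z n = tr w n \<longleftrightarrow> n \<le> lev c" for n
  proof
    assume "n \<le> lev c"
    have c': "c \<in> G w \<inter> G z" using c(1) by blast
    have "u \<in> G w" if "u \<in> G z" "lev u \<le> n" for u
      using half[OF z w that(1) c(1)] that(2) \<open>n \<le> lev c\<close> by simp
    moreover have "u \<in> G z" if "u \<in> G w" "lev u \<le> n" for u
      using half[OF w z that(1) c'] that(2) \<open>n \<le> lev c\<close> by simp
    ultimately show "tr z n = tr w n" unfolding tr_def by blast
  next
    assume eq: "tr z n = tr w n"
    show "n \<le> lev c"
    proof (rule ccontr)
      assume "\<not> n \<le> lev c"
      then have eq': "tr z (Suc (lev c)) = tr w (Suc (lev c))" by (intro tr_mono[OF eq]) simp
      have no: "\<not> (\<exists>u\<in>G z. lev u = Suc (lev c))" "\<not> (\<exists>u\<in>G w. lev u = Suc (lev c))"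
      proof -
        show "\<not> (\<exists>u\<in>G z. lev u = Suc (lev c))"
        proof
          assume "\<exists>u\<in>G z. lev u = Suc (lev c)"
          then obtain u where u: "u \<in> G z" "lev u = Suc (lev c)" by blast
          then have "u \<in> tr z (Suc (lev c))" by (simp add: tr_def)
          then have "u \<in> tr w (Suc (lev c))" unfolding eq' .
          then show False using max[of u] u by (auto simp: tr_def)
        qed
        show "\<not> (\<exists>u\<in>G w. lev u = Suc (lev c))"
        proof
          assume "\<exists>u\<in>G w. lev u = Suc (lev c)"
          then obtain u where u: "u \<in> G w" "lev u = Suc (lev c)" by blast
          then have "u \<in> tr w (Suc (lev c))" by (simp add: tr_def)
          then have "u \<in> tr z (Suc (lev c))" unfolding eq' .
          then show False using max[of u] u by (auto simp: tr_def)
        qed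
      qed
      \<comment> \<open>Equal traces one level past \<open>c\<close> leave that level empty in both
        geodesics. Both then end at \<open>c\<close>, contrary to
        \<open>z \<noteq> w\<close>.\<close>
      have "x = Vert c" if x: "x \<in> hat_tree T" "c \<in> G x" "\<not> (\<exists>u\<in>G x. lev u = Suc (lev c))" for x
        using x(1)
      proof (cases rule: hat_cases)
        case (Vert v)
        have "lev v \<le> lev c" using G_Vert_level[of "Suc (lev c)" v] x(3) Vert by (meson not_less_eq_eq)
        then have "d c v = 0" using x(2) unfolding Vert G_Vert by linarith
        then show ?thesis by (simp add: Vert)
      next
        case (End \<xi>)
        then show ?thesis using x(3) lev_eray[OF End(2), of "Suc (lev c)"] by (auto simp: G_End)
      qed
      then show False using z w no c(1) ne by blast
    qed
  qed
  ultimately show thesis using c(1) by (intro that[of c]) auto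
qed

lemma p_pos: "real p > 1"
  using p2 by simp

lemma end_dist_le:
  assumes z: "z \<in> hat_tree T" and w: "w \<in> hat_tree T"
  shows "end_dist p T z w \<le> 1 / real p ^ n \<longleftrightarrow> tr z n = tr w n"
proof (cases "z = w")
  case False
  obtain c where c: "confluent T z w = c" "\<And>n. tr z n = tr w n \<longleftrightarrow> n \<le> lev c"
    using G_meet[OF z w False] by metis
  have "end_dist p T z w = 1 / real p ^ lev c"
    using False c(1) by (simp add: end_dist_def gdist_commute)
  moreover have "1 / real p ^ lev c \<le> 1 / real p ^ n \<longleftrightarrow> n \<le> lev c"
    using p_pos by (simp add: divide_simps)
  ultimately show ?thesis using c(2) by simp
qed (use p_pos in \<open>simp add: end_dist_def\<close>)

lemma end_dist_pos: "z \<noteq> w \<Longrightarrow> 0 < end_dist p T z w"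
  using p_pos by (simp add: end_dist_def)

lemma end_dist_level: "z \<noteq> w \<Longrightarrow> \<exists>n. end_dist p T z w = 1 / real p ^ n"
  by (auto simp: end_dist_def)

sublocale hat: Metric_space "hat_tree T" "end_dist p T"
proof
  show "0 \<le> end_dist p T x y" for x y using end_dist_pos[of x y] by (cases "x = y") (auto simp: end_dist_def)
  show "end_dist p T x y = end_dist p T y x" for x y
    by (simp add: end_dist_def confluent_def Int_commute)
  show "end_dist p T x y = 0 \<longleftrightarrow> x = y" for x y
    using end_dist_pos[of x y] by (cases "x = y") (auto simp: end_dist_def)
  fix x y z assume xyz: "x \<in> hat_tree T" "y \<in> hat_tree T" "z \<in> hat_tree T"
  show "end_dist p T x z \<le> end_dist p T x y + end_dist p T y z"
  proof (cases "x = y \<or> y = z")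
    case False
    then obtain m n where mn: "end_dist p T x y = 1 / real p ^ m" "end_dist p T y z = 1 / real p ^ n"
      using end_dist_level by meson
    have 1: "tr x m = tr y m" using end_dist_le[OF xyz(1,2), of m] mn(1) by simp
    have 2: "tr y n = tr z n" using end_dist_le[OF xyz(2,3), of n] mn(2) by simp
    have "tr x (min m n) = tr y (min m n)" by (rule tr_mono[OF 1]) simp
    also have "\<dots> = tr z (min m n)" by (rule tr_mono[OF 2]) simp
    finally have "end_dist p T x z \<le> 1 / real p ^ min m n" using end_dist_le[OF xyz(1,3)] by simp
    also have "\<dots> \<le> 1 / real p ^ m + 1 / real p ^ n" by (auto simp: min_def)
    finally show ?thesis by (simp add: mn)
  qed (auto simp: end_dist_def)
qed

lemma small_power: "e > 0 \<Longrightarrow> \<exists>N. 1 / real p ^ N < e"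
  using real_arch_pow_inv[of e "inverse (real p)"] p_pos
  by (auto simp: inverse_less_1_iff power_inverse divide_inverse)

lemma hat_limit_tr:
  assumes "limitin (hat_topology p T) \<sigma> z sequentially"
  shows "\<forall>\<^sub>F n in sequentially. tr (\<sigma> n) N = tr z N"
proof -
  have z: "z \<in> hat_tree T" "\<forall>\<^sub>F n in sequentially. \<sigma> n \<in> hat_tree T \<and> end_dist p T (\<sigma> n) z < 1 / real p ^ N"
    using assms p_pos unfolding hat_topology_def hat.limitin_metric by auto
  from z(2) show ?thesis
  proof eventually_elim
    case (elim n)
    then show ?case using end_dist_le[OF _ z(1), of "\<sigma> n" N] by simp
  qed
qed

lemma Vert_isolated:
  assumes z: "z \<in> hat_tree T" and eq: "tr z (Suc (lev v)) = tr (Vert v) (Suc (lev v))"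
  shows "z = Vert v"
proof (rule ccontr)
  assume ne: "z \<noteq> Vert v"
  have v: "Vert v \<in> hat_tree T" by (simp add: hat_tree_def)
  obtain c where "\<And>n. tr z n = tr (Vert v) n \<longleftrightarrow> n \<le> lev c" "c \<in> G (Vert v)"
    using G_meet[OF z v ne] by metis
  then have "Suc (lev v) \<le> lev c" "lev c \<le> lev v" using eq by (blast, simp add: G_Vert)
  then show False by simp
qed

section \<open>Confluents relative to the reference end, and their limits\<close>

abbreviation "o' \<equiv> origin T"
abbreviation "ht \<equiv> height T"

lemma con_funpow: "con ((fa ^^ n) x) y = min (con x y) (ht x - int n)"
proof (induction n)
  case 0
  then show ?case using con_le1[of x y] by simp
next
  case (Suc n)
  then show ?case by (simp add: con_f)
qed

lemma funpow_in_G: "(fa ^^ N) o' \<in> G (Vert y) \<longleftrightarrow> con o' y \<le> - int N"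
proof -
  have "int (lev ((fa ^^ N) o')) = int N" using gdist_fa_funpow[of o' N] by simp
  moreover have "int (d ((fa ^^ N) o') y) = - int N + ht y - 2 * min (con o' y) (- int N)"
    by (simp add: gdist_con con_funpow)
  moreover have "int (lev y) = ht y - 2 * con o' y" by (simp add: gdist_con)
  moreover have "lev ((fa ^^ N) o') + d ((fa ^^ N) o') y = lev y
      \<longleftrightarrow> int (lev ((fa ^^ N) o')) + int (d ((fa ^^ N) o') y) = int (lev y)" by linarith
  ultimately show ?thesis by (auto simp: G_Vert min_def)
qed

lemma in_tr: "u \<in> tr z N \<longleftrightarrow> u \<in> G z \<and> lev u \<le> N"
  by (simp add: tr_def)

lemma tr_refend_imp:
  assumes "tr (Vert y) N = tr (End (refend T)) N" shows "con o' y \<le> - int N"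
proof -
  have "(fa ^^ N) o' \<in> tr (End (refend T)) N"
    using gdist_fa_funpow[of o' N] by (simp add: in_tr G_End[OF refend_in] eray_refend[abs_def])
  then have "(fa ^^ N) o' \<in> tr (Vert y) N" by (simp only: assms)
  then have "(fa ^^ N) o' \<in> G (Vert y)" by (simp add: in_tr)
  then show ?thesis by (simp add: funpow_in_G)
qed

text \<open>The ray from the root follows \<open>J\<close> father steps and then leaves the ray to
  the reference end. From there on every step leads to a child, since a father step would
  backtrack.\<close>

lemma end_ray_turns:
  assumes \<xi>: "\<xi> \<in> ends (adj T)" "\<xi> \<noteq> refend T"
  obtains J where "\<And>N. N \<ge> J \<Longrightarrow> ht (eray \<xi> o' N) = int N - 2 * int J"
    "\<And>N. N \<ge> J \<Longrightarrow> con o' (eray \<xi> o' N) = - int J"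
    "\<And>N. N \<ge> J \<Longrightarrow> fa (eray \<xi> o' (Suc N)) = eray \<xi> o' N"
proof -
  let ?\<pi> = "eray \<xi> o'"
  note ray = eray_rays[OF \<xi>(1), of o', unfolded rays_iff]
  let ?P = "\<lambda>j. ?\<pi> (Suc j) \<noteq> fa (?\<pi> j)"
  have "\<exists>j. ?P j"
  proof (rule ccontr)
    assume "\<not> ?thesis"
    then have "?\<pi> n = (fa ^^ n) o'" for n by (induction n) (auto simp: eray_0[OF \<xi>(1)])
    then have "?\<pi> = eray (refend T) o'" by (auto simp: eray_refend)
    then have "?\<pi> \<in> refend T" using eray_in[OF refend_in, of o'] by simp
    then have "\<xi> = refend T" by (rule end_eqI[OF \<xi>(1) refend_in eray_in[OF \<xi>(1)]])
    then show False using \<xi>(2) by simp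
  qed
  define J where "J = (LEAST j. ?P j)"
  have J: "?P J" unfolding J_def by (rule LeastI_ex) fact
  have before: "?\<pi> n = (fa ^^ n) o'" if "n \<le> J" for n
    using that
  proof (induction n)
    case (Suc n)
    then have "\<not> ?P n" unfolding J_def by (intro not_less_Least) simp
    with Suc show ?case by simp
  qed (simp add: eray_0[OF \<xi>(1)])
  have after: "fa (?\<pi> (Suc N)) = ?\<pi> N" if "N \<ge> J" for N
    using that
  proof (induction N rule: dec_induct)
    case base
    then show ?case using J ray adj_fa_iff by metis
  next
    case (step N)
    then show ?case using ray adj_fa_iff by metis
  qed
  have h: "ht (?\<pi> N) = int N - 2 * int J" if "N \<ge> J" for N
    using that
  proof (induction N rule: dec_induct)
    case base
    then show ?case using before[of J] by simp
  next
    case (step N)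
    then show ?case using height_fa[of "?\<pi> (Suc N)"] after[of N] by simp
  qed
  moreover have "con o' (?\<pi> N) = - int J" if "N \<ge> J" for N
    using h[OF that] gdist_con[of o' "?\<pi> N"] lev_eray[OF \<xi>(1), of N] by simp
  ultimately show thesis using after by (rule that)
qed

text \<open>If the ray vertex were not an ancestor of \<open>y\<close>, the distance formula and the
  ultrametric property would make its height equal to its confluent height with the root, which
  happens only at the turn \<open>N = J\<close>.\<close>

lemma end_descendant:
  assumes \<xi>: "\<xi> \<in> ends (adj T)" and J: "\<And>N. N \<ge> J \<Longrightarrow> ht (eray \<xi> o' N) = int N - 2 * int J"
    "\<And>N. N \<ge> J \<Longrightarrow> con o' (eray \<xi> o' N) = - int J"
    and N: "N > J" and y: "eray \<xi> o' N \<in> G (Vert y)"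
  shows "con (eray \<xi> o' N) y = ht (eray \<xi> o' N)"
proof (rule ccontr)
  let ?u = "eray \<xi> o' N"
  assume "con ?u y \<noteq> ht ?u"
  then have lt: "con ?u y < ht ?u" using con_le1[of ?u y] by simp
  have "int (lev ?u) = ht ?u - 2 * con o' ?u" "int (d ?u y) = ht ?u + ht y - 2 * con ?u y"
    "int (lev y) = ht y - 2 * con o' y" by (simp_all add: gdist_con)
  moreover have "lev ?u + d ?u y = lev y" using y by (simp add: G_Vert)
  ultimately have eq: "ht ?u - con ?u y = con o' ?u - con o' y" by linarith
  then have "con o' y < con o' ?u" using lt by simp
  then have "con ?u y = con o' y"
    using con_eqI[of y o' ?u] con_commute by metis
  then show False using eq J(1,2)[of N] N by simp
qed

lemma G_End_gt: "\<xi> \<in> ends (adj T) \<Longrightarrow> tr (Vert y) N = tr (End \<xi>) N \<Longrightarrow> eray \<xi> o' N \<in> G (Vert y)"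
proof -
  assume \<xi>: "\<xi> \<in> ends (adj T)" and eq: "tr (Vert y) N = tr (End \<xi>) N"
  have "eray \<xi> o' N \<in> tr (End \<xi>) N" using lev_eray[OF \<xi>] by (simp add: in_tr G_End[OF \<xi>])
  then have "eray \<xi> o' N \<in> tr (Vert y) N" by (simp only: eq)
  then show ?thesis by (simp add: in_tr)
qed

lemma con_descendant: "con u y = ht u \<Longrightarrow> ht x < ht u \<Longrightarrow> con x y = con x u"
  using con_eqI[of x u y] con_le1[of x u] by simp

text \<open>Vertices approximating \<open>z\<close>, through which confluents with an end are
  defined.\<close>

definition pt :: "'a hat_point \<Rightarrow> nat \<Rightarrow> 'a" where
  "pt z N = (case z of Vert v \<Rightarrow> v | End \<xi> \<Rightarrow> eray \<xi> o' N)"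

text \<open>The height of the confluent of \<open>x\<close> and \<open>z\<close> with respect to the reference end; meaningless if
  \<open>z\<close> is the reference end.\<close>

definition econ :: "'a hat_point \<Rightarrow> 'a \<Rightarrow> int" where
  "econ z x = (THE l. \<forall>\<^sub>F N in sequentially. con x (pt z N) = l)"

abbreviation omega :: "'a hat_point" where "omega \<equiv> End (refend T)"

lemma econ_eqI: "\<forall>\<^sub>F N in sequentially. con x (pt z N) = l \<Longrightarrow> econ z x = l"
  unfolding econ_def
proof (rule the_equality)
  fix l' assume "\<forall>\<^sub>F N in sequentially. con x (pt z N) = l" "\<forall>\<^sub>F N in sequentially. con x (pt z N) = l'"
  from eventually_happens[OF eventually_conj[OF this]] show "l' = l" by auto
qed

lemma econ_End:
  assumes \<xi>: "\<xi> \<in> ends (adj T)" and J: "\<And>N. N \<ge> J \<Longrightarrow> ht (eray \<xi> o' N) = int N - 2 * int J"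
    "\<And>N. N \<ge> J \<Longrightarrow> con o' (eray \<xi> o' N) = - int J"
    and N: "N > J" "ht x < int N - 2 * int J"
  shows "econ (End \<xi>) x = con x (eray \<xi> o' N)"
proof (rule econ_eqI)
  show "\<forall>\<^sub>F n in sequentially. con x (pt (End \<xi>) n) = con x (eray \<xi> o' N)"
    using eventually_ge_at_top[of N]
  proof eventually_elim
    case (elim n)
    have "eray \<xi> o' N \<in> G (Vert (eray \<xi> o' n))"
      using elim lev_eray[OF \<xi>] ray_gdist[OF eray_rays[OF \<xi>] elim] by (simp add: G_Vert)
    from end_descendant[OF \<xi> J N(1) this] have "con x (eray \<xi> o' n) = con x (eray \<xi> o' N)"
    proof (rule con_descendant)
      have "ht (eray \<xi> o' N) = int N - 2 * int J" by (rule J(1)) (use N in simp)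
      then show "ht x < ht (eray \<xi> o' N)" using N(2) by simp
    qed
    then show ?case by (simp add: pt_def)
  qed
qed

text \<open>Once \<open>y n\<close> meets the root lower than \<open>x\<close> does, the ultrametric
  property gives \<open>x\<close> and the root the same confluent height with
  \<open>y n\<close>.\<close>

lemma vertices_to_refend:
  assumes "limitin (hat_topology p T) (\<lambda>n. Vert (y n)) omega sequentially"
  shows "filterlim (\<lambda>n. con x (y n)) at_bot sequentially" "\<forall>\<^sub>F n in sequentially. con x (y n) = con o' (y n)"
proof -
  have o: "\<forall>\<^sub>F n in sequentially. con o' (y n) \<le> A" for A
    using hat_limit_tr[OF assms, of "nat (- A)"]
  proof eventually_elim
    case (elim n)
    from tr_refend_imp[OF elim] show ?case by linarith
  qed
  show eq: "\<forall>\<^sub>F n in sequentially. con x (y n) = con o' (y n)"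
    using o[of "con o' x - 1"]
  proof eventually_elim
    case (elim n)
    then have "con (y n) o' < con o' x" by (simp add: con_commute)
    from con_eqI[OF this] show ?case by (simp add: con_commute)
  qed
  show "filterlim (\<lambda>n. con x (y n)) at_bot sequentially" unfolding filterlim_at_bot
  proof
    fix Z show "\<forall>\<^sub>F n in sequentially. con x (y n) \<le> Z" using eq o[of Z] by eventually_elim simp
  qed
qed

lemma vertices_to_Vert:
  assumes "limitin (hat_topology p T) (\<lambda>n. Vert (y n)) (Vert v) sequentially"
  shows "\<forall>\<^sub>F n in sequentially. y n = v"
  using hat_limit_tr[OF assms, of "Suc (lev v)"]
  by eventually_elim (use Vert_isolated[of "Vert _" v] in \<open>auto simp: hat_tree_def\<close>)

lemma vertices_to_End:
  assumes \<xi>: "\<xi> \<in> ends (adj T)" "\<xi> \<noteq> refend T"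
    and y: "limitin (hat_topology p T) (\<lambda>n. Vert (y n)) (End \<xi>) sequentially"
  shows "filterlim (\<lambda>n. ht (y n)) at_top sequentially" "\<forall>\<^sub>F n in sequentially. con x (y n) = econ (End \<xi>) x"
proof -
  obtain J where J: "\<And>N. N \<ge> J \<Longrightarrow> ht (eray \<xi> o' N) = int N - 2 * int J"
    "\<And>N. N \<ge> J \<Longrightarrow> con o' (eray \<xi> o' N) = - int J" using end_ray_turns[OF \<xi>] by metis
  have desc: "\<forall>\<^sub>F n in sequentially. con (eray \<xi> o' N) (y n) = ht (eray \<xi> o' N)" if "N > J" for N
    using hat_limit_tr[OF y, of N]
    by eventually_elim (rule end_descendant[OF \<xi>(1) J that G_End_gt[OF \<xi>(1)]])
  show "filterlim (\<lambda>n. ht (y n)) at_top sequentially" unfolding filterlim_at_top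
  proof
    fix Z :: int
    define N where "N = nat \<bar>Z\<bar> + 2 * J + 1"
    have "ht (eray \<xi> o' N) \<ge> Z" using J(1)[of N] by (simp add: N_def)
    moreover have "N > J" by (simp add: N_def)
    ultimately show "\<forall>\<^sub>F n in sequentially. Z \<le> ht (y n)"
      using desc[of N] con_le2[of "eray \<xi> o' N"] by (auto elim!: eventually_mono) (metis order.trans)
  qed
  define N where "N = nat \<bar>ht x\<bar> + 2 * J + 1"
  have N: "N > J" "ht x < int N - 2 * int J" by (auto simp: N_def)
  have "ht (eray \<xi> o' N) = int N - 2 * int J" by (rule J(1)) (use N in simp)
  then have lt: "ht x < ht (eray \<xi> o' N)" using N(2) by simp
  show "\<forall>\<^sub>F n in sequentially. con x (y n) = econ (End \<xi>) x"
    using desc[OF N(1)]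
  proof eventually_elim
    case (elim n)
    from con_descendant[OF this lt] econ_End[OF \<xi>(1) J N] show ?case by simp
  qed
qed

lemma vertices_to_non_refend:
  assumes z: "z \<in> hat_tree T" "z \<noteq> omega" and y: "limitin (hat_topology p T) (\<lambda>n. Vert (y n)) z sequentially"
  shows "\<forall>\<^sub>F n in sequentially. con x (y n) = econ z x"
  using z(1)
proof (cases rule: hat_cases)
  case (Vert v)
  have "econ z x = con x v" by (rule econ_eqI) (simp add: Vert pt_def)
  moreover have "\<forall>\<^sub>F n in sequentially. y n = v" by (rule vertices_to_Vert) (use y Vert in simp)
  ultimately show ?thesis by (auto elim: eventually_mono)
next
  case (End \<xi>)
  with vertices_to_End(2)[of \<xi> y x] z y show ?thesis by simp
qed

lemma econ_eventually:
  assumes z: "z \<in> hat_tree T" "z \<noteq> omega"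
  shows "\<forall>\<^sub>F N in sequentially. con x (pt z N) = econ z x"
  using z(1)
proof (cases rule: hat_cases)
  case (Vert v)
  have "econ z x = con x v" by (rule econ_eqI) (simp add: Vert pt_def)
  then show ?thesis by (simp add: Vert pt_def)
next
  case (End \<xi>)
  have \<xi>: "\<xi> \<noteq> refend T" using End z by auto
  obtain J where J: "\<And>N. N \<ge> J \<Longrightarrow> ht (eray \<xi> o' N) = int N - 2 * int J"
    "\<And>N. N \<ge> J \<Longrightarrow> con o' (eray \<xi> o' N) = - int J" using end_ray_turns[OF End(2) \<xi>] by metis
  show ?thesis using eventually_gt_at_top[of "nat \<bar>ht x\<bar> + 2 * J"]
  proof eventually_elim
    case (elim N)
    then have "N > J" "ht x < int N - 2 * int J" by auto
    from econ_End[OF End(2) J this] show ?case by (simp add: End pt_def)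
  qed
qed

text \<open>Replaces \<open>z\<close> by a vertex with the same confluents, so that facts about
  \<open>con\<close> carry over to \<open>econ\<close>.\<close>

lemma econ_common:
  assumes z: "z \<in> hat_tree T" "z \<noteq> omega"
  obtains y where "con x y = econ z x" "con x' y = econ z x'"
  using eventually_happens[OF eventually_conj[OF econ_eventually[OF z, of x] econ_eventually[OF z, of x']]] by auto

lemma econ_le: "z \<in> hat_tree T \<Longrightarrow> z \<noteq> omega \<Longrightarrow> econ z x \<le> ht x"
  using econ_common[of z x x] con_le1 by metis

lemma econ_funpow: "z \<in> hat_tree T \<Longrightarrow> z \<noteq> omega \<Longrightarrow> econ z ((fa ^^ n) x) = min (econ z x) (ht x - int n)"
  using econ_common[of z x "(fa ^^ n) x"] con_funpow by metis

lemma econ_fa: "z \<in> hat_tree T \<Longrightarrow> z \<noteq> omega \<Longrightarrow> econ z (fa x) = min (econ z x) (ht x - 1)"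
  using econ_funpow[of z 1 x] by simp

lemma econ_unique:
  assumes "z \<in> hat_tree T" "z \<noteq> omega" "econ z x = ht x" "econ z x' = ht x'" "ht x = ht x'"
  shows "x = x'"
proof -
  obtain y where "con x y = econ z x" "con x' y = econ z x'" by (rule econ_common[OF assms(1,2)])
  then have "con x y = ht x" "con x' y = ht x'" by (simp_all only: assms(3,4))
  then have "anc (ht x) y = x" "anc (ht x') y = x'" unfolding con_eq_h by blast+
  then show ?thesis by (metis assms(5))
qed

lemma econ_Vert: "econ (Vert v) x = con x v"
  by (rule econ_eqI) (simp add: pt_def)

text \<open>\<open>econ z x = ht x\<close> says that \<open>x\<close> lies on the geodesic from the
  reference end to \<open>z\<close>. These vertices recover \<open>z\<close>: it is the highest of
  them, or the end that they run into.\<close>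

lemma econ_ancestors_inj:
  assumes z: "z \<in> hat_tree T" "z \<noteq> omega" and z': "z' \<in> hat_tree T" "z' \<noteq> omega"
    and eq: "\<And>x. econ z x = ht x \<longleftrightarrow> econ z' x = ht x"
  shows "z = z'"
proof -
  have End_high: "\<exists>J. \<forall>N>2 * J. econ (End \<xi>) (eray \<xi> o' N) = ht (eray \<xi> o' N) \<and> ht (eray \<xi> o' N) = int N - 2 * int J"
    if \<xi>: "\<xi> \<in> ends (adj T)" "\<xi> \<noteq> refend T" for \<xi>
  proof -
    obtain J where J: "\<And>N. N \<ge> J \<Longrightarrow> ht (eray \<xi> o' N) = int N - 2 * int J"
      "\<And>N. N \<ge> J \<Longrightarrow> con o' (eray \<xi> o' N) = - int J" "\<And>N. N \<ge> J \<Longrightarrow> fa (eray \<xi> o' (Suc N)) = eray \<xi> o' N"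
      using end_ray_turns[OF \<xi>] by metis
    have "econ (End \<xi>) (eray \<xi> o' N) = ht (eray \<xi> o' N)" if "N \<ge> J" for N
    proof -
      have "econ (End \<xi>) (eray \<xi> o' N) = con (eray \<xi> o' N) (eray \<xi> o' (Suc N))"
        by (rule econ_End[OF \<xi>(1) J(1,2)]) (use J(1)[OF that] that in auto)
      also have "\<dots> = ht (eray \<xi> o' N)"
        using con_child_self[OF J(3)[OF that]] by (simp add: con_commute)
      finally show ?thesis .
    qed
    with J(1) show ?thesis by (intro exI[of _ J]) auto
  qed
  have mixed: False if \<xi>: "\<xi> \<in> ends (adj T)" "\<xi> \<noteq> refend T"
    and e: "\<And>x. econ (Vert v) x = ht x \<longleftrightarrow> econ (End \<xi>) x = ht x" for v \<xi>
  proof -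
    obtain J where J: "\<And>N. N > 2 * J \<Longrightarrow> econ (End \<xi>) (eray \<xi> o' N) = ht (eray \<xi> o' N) \<and> ht (eray \<xi> o' N) = int N - 2 * int J"
      using End_high[OF \<xi>] by blast
    define N where "N = 2 * J + 1 + nat \<bar>ht v\<bar>"
    have "con (eray \<xi> o' N) v = ht (eray \<xi> o' N)" "ht (eray \<xi> o' N) > ht v"
      using e[of "eray \<xi> o' N"] J[of N] by (auto simp: econ_Vert N_def)
    then show False using con_le2[of "eray \<xi> o' N" v] by simp
  qed
  show ?thesis
    using z(1)
  proof (cases rule: hat_cases)
    case (Vert v)
    show ?thesis using z'(1)
    proof (cases rule: hat_cases)
      case (Vert v')
      have "con v v' = ht v" "con v' v = ht v'"
        using eq[of v] eq[of v'] by (auto simp: Vert \<open>z = Vert v\<close> econ_Vert)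
      then have "econ (Vert v) v = ht v" "econ (Vert v) v' = ht v'" "ht v = ht v'"
        using con_commute[of v v'] by (auto simp: econ_Vert)
      then have "v = v'" by (intro econ_unique[of "Vert v"]) (auto simp: hat_tree_def)
      then show ?thesis by (simp add: Vert \<open>z = Vert v\<close>)
    next
      case (End \<xi>)
      then show ?thesis using mixed[of \<xi> v] eq z' Vert by auto
    qed
  next
    case (End \<xi>)
    note zE = this
    show ?thesis using z'(1)
    proof (cases rule: hat_cases)
      case (Vert v)
      then show ?thesis using mixed[of \<xi> v] eq z zE by auto
    next
      case (End \<xi>')
      have ne: "\<xi> \<noteq> refend T" "\<xi>' \<noteq> refend T" using z z' zE End by auto
      obtain J where J: "\<And>N. N > 2 * J \<Longrightarrow> econ z (eray \<xi> o' N) = ht (eray \<xi> o' N) \<and> ht (eray \<xi> o' N) = int N - 2 * int J"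
        using End_high[OF zE(2) ne(1)] zE(1) by blast
      obtain J' where J': "\<And>N. N > 2 * J' \<Longrightarrow> econ z' (eray \<xi>' o' N) = ht (eray \<xi>' o' N) \<and> ht (eray \<xi>' o' N) = int N - 2 * int J'"
        using End_high[OF End(2) ne(2)] End(1) by blast
      have same: "eray \<xi> o' N = eray \<xi>' o' N" if "N > 2 * J + 2 * J'" for N
      proof -
        \<comment> \<open>The position of height \<open>int N - 2 * int J\<close> on the second ray.
          Both vertices lie below \<open>z'\<close>, so they coincide, and comparing their distances
          from the root gives \<open>N = N'\<close>.\<close>
        define N' where "N' = N - 2 * J + 2 * J'"
        have N': "N' > 2 * J'" "int N' - 2 * int J' = int N - 2 * int J" using that by (auto simp: N'_def)
        have "eray \<xi> o' N = eray \<xi>' o' N'"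
        proof (rule econ_unique[OF z'])
          show "econ z' (eray \<xi> o' N) = ht (eray \<xi> o' N)" using J[of N] that eq by auto
          show "econ z' (eray \<xi>' o' N') = ht (eray \<xi>' o' N')" using J'[OF N'(1)] by blast
          show "ht (eray \<xi> o' N) = ht (eray \<xi>' o' N')" using J[of N] J'[OF N'(1)] N'(2) that by simp
        qed
        moreover have "N = N'" using calculation lev_eray[OF zE(2), of N] lev_eray[OF End(2), of N'] by simp
        ultimately show ?thesis by simp
      qed
      have "eray \<xi>' o' \<in> \<xi>"
      proof (rule end_tailI[OF zE(2) eray_in[OF zE(2)] eray_rays[OF End(2)]])
        show "eray \<xi> o' (2 * J + 2 * J' + 1 + n) = eray \<xi>' o' (2 * J + 2 * J' + 1 + n)" for n
          by (rule same) simp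
      qed
      then have "\<xi> = \<xi>'" using eray_in[OF End(2), of o'] by (rule end_eqI[OF zE(2) End(2)])
      then show ?thesis by (simp add: zE End)
    qed
  qed
qed

text \<open>Go from \<open>x\<close> toward the reference end to the first vertex below
  \<open>z\<close>. Its predecessor \<open>u\<close> lies below \<open>z'\<close> but not below
  \<open>z\<close>. A sibling of \<open>u\<close> has a smaller confluent with \<open>z'\<close>,
  whereas its confluent with \<open>z\<close> is at least that of \<open>u\<close>, since their
  father lies below \<open>z\<close>.\<close>

lemma econ_separates:
  assumes z: "z \<in> hat_tree T" "z \<noteq> omega" and z': "z' \<in> hat_tree T" "z' \<noteq> omega"
    and x: "econ z' x = ht x" "econ z x \<noteq> ht x"
  obtains u u' where "ht u = ht u'" "econ z' u' < econ z' u" "econ z u \<le> econ z u'"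
proof -
  define k where "k = nat (ht x - econ z x)"
  have "econ z ((fa ^^ k) x) = ht ((fa ^^ k) x)"
    using econ_le[OF z, of x] by (simp add: econ_funpow[OF z] k_def)
  then have ex: "\<exists>n. econ z ((fa ^^ n) x) = ht ((fa ^^ n) x)" by blast
  define n where "n = (LEAST n. econ z ((fa ^^ n) x) = ht ((fa ^^ n) x))"
  have n: "econ z ((fa ^^ n) x) = ht ((fa ^^ n) x)" unfolding n_def by (rule LeastI_ex[OF ex])
  then have "n \<noteq> 0" using x(2) by (intro notI) simp
  then obtain j where j: "n = Suc j" by (cases n) auto
  define u where "u = (fa ^^ j) x"
  have u: "econ z u \<noteq> ht u" unfolding u_def
    using not_less_Least[of j "\<lambda>n. econ z ((fa ^^ n) x) = ht ((fa ^^ n) x)"] j by (simp add: n_def)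
  have fu: "econ z (fa u) = ht u - 1" using n by (simp add: j u_def)
  have u': "econ z' u = ht u" using x(1) by (simp add: u_def econ_funpow[OF z'])
  obtain w where w: "w \<noteq> u" "fa w = fa u" using sibling[of u] by blast
  have hw: "ht w = ht u" using height_fa[of w] height_fa[of u] w(2) by simp
  show thesis
  proof (rule that[of u w])
    show "ht u = ht w" using hw by simp
    have "econ z' w \<noteq> ht w" using econ_unique[OF z', of w u] u' hw w(1) by auto
    then show "econ z' w < econ z' u" using econ_le[OF z', of w] u' hw by simp
    have "econ z u < ht u" using econ_le[OF z, of u] u by simp
    moreover have "ht u - 1 \<le> econ z w" using econ_fa[OF z, of w] fu w(2) by simp
    ultimately show "econ z u \<le> econ z w" by simp
  qed
qed

text \<open>Every point of the tree or its boundary other than the reference end lies above some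
  vertex, and hence not above its siblings.\<close>

lemma econ_nonconstant:
  assumes z: "z \<in> hat_tree T" "z \<noteq> omega"
  obtains u u' where "ht u = ht u'" "econ z u' < econ z u"
proof -
  define k where "k = nat (ht o' - econ z o')"
  define u where "u = (fa ^^ k) o'"
  have u: "econ z u = ht u"
    using econ_le[OF z, of o'] by (simp add: u_def econ_funpow[OF z] k_def)
  obtain w where w: "w \<noteq> u" "fa w = fa u" using sibling[of u] by blast
  have hw: "ht w = ht u" using height_fa[of w] height_fa[of u] w(2) by simp
  have "econ z w \<noteq> ht w" using econ_unique[OF z, of w u] u hw w(1) by auto
  then show thesis using that[of u w] econ_le[OF z, of w] u hw by simp
qed

end

section \<open>The horocyclic topology\<close>

lemma squash_bounds: "\<bar>squash K\<bar> \<le> 1"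
  by (cases K) (auto simp: abs_divide field_simps)

lemma abs_squash_Fin: "\<bar>squash (Fin k)\<bar> < 1"
  by (simp add: abs_divide field_simps)

lemma unsquash:
  assumes "\<bar>squash K\<bar> < 1"
  obtains k where "K = Fin k" "real_of_int k = squash K / (1 - \<bar>squash K\<bar>)"
proof (cases K)
  case (Fin k)
  have "1 - \<bar>squash K\<bar> = 1 / (1 + \<bar>real_of_int k\<bar>)"
    by (simp add: Fin abs_divide field_simps)
  then show thesis by (intro that[of k]) (auto simp: Fin)
qed (use assms in auto)

lemma squash_inj: "squash K = squash L \<Longrightarrow> K = L"
proof -
  assume eq: "squash K = squash L"
  show ?thesis
  proof (cases "\<bar>squash K\<bar> < 1")
    case True
    then obtain k where k: "K = Fin k" "real_of_int k = squash K / (1 - \<bar>squash K\<bar>)" by (rule unsquash)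
    obtain l where l: "L = Fin l" "real_of_int l = squash L / (1 - \<bar>squash L\<bar>)"
      using True eq unsquash[of L] by metis
    have "real_of_int k = real_of_int l" using k(2) l(2) eq by simp
    then show ?thesis using k(1) l(1) by simp
  next
    case False
    then have "K \<noteq> Fin k" "L \<noteq> Fin k" for k
      using abs_squash_Fin[of k] eq by (auto simp del: squash.simps)
    then show ?thesis using eq by (cases K; cases L) auto
  qed
qed

lemma squash_minus: "squash (Fin (- k)) = - squash (Fin k)"
  by simp

lemma fraction_mono:
  fixes x y :: real assumes "x \<le> y" shows "x / (1 + \<bar>x\<bar>) \<le> y / (1 + \<bar>y\<bar>)"
proof -
  have "x * (1 + \<bar>y\<bar>) \<le> y * (1 + \<bar>x\<bar>)"
  proof (cases "0 \<le> x \<or> y \<le> 0")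
    case True
    then have "x * \<bar>y\<bar> = y * \<bar>x\<bar>" using assms by (auto simp: abs_if)
    then show ?thesis using assms by (simp add: algebra_simps)
  next
    case False
    then have "x * (1 + \<bar>y\<bar>) \<le> 0" "0 \<le> y * (1 + \<bar>x\<bar>)" by (auto intro: mult_nonpos_nonneg mult_nonneg_nonneg)
    then show ?thesis by linarith
  qed
  then show ?thesis by (simp add: divide_le_eq pos_le_divide_eq mult.commute add_pos_nonneg)
qed

lemma squash_mono: "k \<le> l \<Longrightarrow> squash (Fin k) \<le> squash (Fin l)"
  using fraction_mono[of "real_of_int k" "real_of_int l"] by simp

lemma tendsto_int_eventually_const:
  assumes "(\<lambda>n. real_of_int (k n)) \<longlonglongrightarrow> L"
  shows "\<exists>k0. L = of_int k0 \<and> (\<forall>\<^sub>F n in sequentially. k n = k0)"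
proof -
  have "\<forall>\<^sub>F n in sequentially. dist (real_of_int (k n)) L < 1 / 2"
    using assms by (rule tendstoD) simp
  then obtain N where N: "\<And>n. n \<ge> N \<Longrightarrow> dist (real_of_int (k n)) L < 1 / 2"
    by (auto simp: eventually_sequentially)
  have "k n = k N" if "n \<ge> N" for n
  proof -
    have "\<bar>real_of_int (k n) - real_of_int (k N)\<bar> < 1"
      using N[OF that] N[of N] unfolding dist_real_def by linarith
    then show ?thesis by linarith
  qed
  then have ev: "\<forall>\<^sub>F n in sequentially. k n = k N" unfolding eventually_sequentially by blast
  then have "\<forall>\<^sub>F n in sequentially. real_of_int (k n) = real_of_int (k N)" by eventually_elim simp
  then have "(\<lambda>n. real_of_int (k n)) \<longlonglongrightarrow> real_of_int (k N)" by (rule tendsto_eventually)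
  then have "L = real_of_int (k N)" using assms LIMSEQ_unique by blast
  with ev show ?thesis by blast
qed

text \<open>Inverting the squashing map yields a convergent sequence of integers, which is
  eventually constant.\<close>

lemma squash_limit_interior:
  assumes lim: "(\<lambda>n. squash (K n)) \<longlonglongrightarrow> s" and s: "\<bar>s\<bar> < 1"
  obtains k where "s = squash (Fin k)" "\<forall>\<^sub>F n in sequentially. K n = Fin k"
proof -
  define k where "k = (\<lambda>n. THE j. K n = Fin j)"
  have ev: "\<forall>\<^sub>F n in sequentially. \<bar>squash (K n)\<bar> < 1"
    using order_tendstoD(2)[OF tendsto_rabs[OF lim] s] .
  then have k: "\<forall>\<^sub>F n in sequentially. K n = Fin (k n) \<and> squash (K n) / (1 - \<bar>squash (K n)\<bar>) = real_of_int (k n)"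
  proof eventually_elim
    case (elim n)
    then obtain j where "K n = Fin j" "real_of_int j = squash (K n) / (1 - \<bar>squash (K n)\<bar>)" by (rule unsquash)
    then show ?case by (simp add: k_def)
  qed
  have "(\<lambda>n. squash (K n) / (1 - \<bar>squash (K n)\<bar>)) \<longlonglongrightarrow> s / (1 - \<bar>s\<bar>)"
    using s by (intro tendsto_intros lim) auto
  moreover have "\<forall>\<^sub>F n in sequentially. squash (K n) / (1 - \<bar>squash (K n)\<bar>) = real_of_int (k n)"
    using k by eventually_elim blast
  ultimately have "(\<lambda>n. real_of_int (k n)) \<longlonglongrightarrow> s / (1 - \<bar>s\<bar>)" by (rule Lim_transform_eventually)
  then obtain k0 where k0: "\<forall>\<^sub>F n in sequentially. k n = k0" using tendsto_int_eventually_const by blast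
  with k have K: "\<forall>\<^sub>F n in sequentially. K n = Fin k0" by eventually_elim simp
  then have "\<forall>\<^sub>F n in sequentially. squash (K n) = squash (Fin k0)" by eventually_elim simp
  from LIMSEQ_unique[OF lim tendsto_eventually[OF this]] have "s = squash (Fin k0)" .
  then show thesis using K by (rule that)
qed

text \<open>The squashed extended integers form a closed set: they accumulate only at 1 and
  -1.\<close>

lemma squash_limit:
  assumes lim: "(\<lambda>n. squash (K n)) \<longlonglongrightarrow> s" shows "\<exists>K0. s = squash K0"
proof (cases "\<bar>s\<bar> < 1")
  case True
  then show ?thesis using squash_limit_interior[OF lim] by metis
next
  case False
  have "\<bar>s\<bar> \<le> 1" by (rule tendsto_upperbound[OF tendsto_rabs[OF lim]]) (auto simp: squash_bounds)
  with False have "s = 1 \<or> s = -1" by auto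
  then show ?thesis using squash.simps(2,3) by metis
qed

lemma squash_ext_limit:
  assumes lim: "(\<lambda>n. squash (Fin (k n))) \<longlonglongrightarrow> squash K" shows "ext_limit k K"
proof (cases K)
  case (Fin k0)
  obtain k' where "squash K = squash (Fin k')" "\<forall>\<^sub>F n in sequentially. Fin (k n) = Fin k'"
    by (rule squash_limit_interior[OF lim]) (use abs_squash_Fin Fin in auto)
  then show ?thesis using squash_inj[of K "Fin k'"] Fin by (simp add: ext_limit_def)
next
  case Pinf
  have "\<forall>\<^sub>F n in sequentially. Z \<le> k n" for Z
  proof -
    have "squash (Fin Z) < squash K" using abs_squash_Fin[of Z] Pinf by (simp add: abs_less_iff del: squash.simps(1))
    from order_tendstoD(1)[OF lim this] show ?thesis
    proof eventually_elim
      case (elim n)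
      then show ?case using squash_mono[of "k n" Z] by (meson linorder_not_le nle_le)
    qed
  qed
  then show ?thesis using Pinf by (simp add: ext_limit_def filterlim_at_top)
next
  case Minf
  have "\<forall>\<^sub>F n in sequentially. k n \<le> Z" for Z
  proof -
    have "squash K < squash (Fin Z)" using abs_squash_Fin[of Z] Minf by (simp add: abs_less_iff del: squash.simps(1))
    from order_tendstoD(2)[OF lim this] show ?thesis
    proof eventually_elim
      case (elim n)
      then show ?case using squash_mono[of Z "k n"] by (meson linorder_not_le nle_le)
    qed
  qed
  then show ?thesis using Minf by (simp add: ext_limit_def filterlim_at_bot)
qed

lemma squash_at_top:
  assumes "filterlim k at_top F" shows "((\<lambda>n. squash (Fin (k n))) \<longlongrightarrow> 1) F"
proof (rule order_tendstoI)
  fix a :: real assume "a < 1"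
  have "(\<lambda>n. squash (Fin (int n))) \<longlonglongrightarrow> 1"
  proof -
    have "(\<lambda>n. 1 - 1 / real (n + 1)) \<longlonglongrightarrow> 1 - 0"
      using LIMSEQ_ignore_initial_segment[OF lim_const_over_n[of 1], of 1] by (intro tendsto_intros) simp
    moreover have "1 - 1 / real (n + 1) = squash (Fin (int n))" for n by (simp add: field_simps)
    ultimately show ?thesis by simp
  qed
  from order_tendstoD(1)[OF this \<open>a < 1\<close>] obtain N where N: "a < squash (Fin (int N))"
    by (auto simp: eventually_sequentially simp del: squash.simps)
  show "\<forall>\<^sub>F n in F. a < squash (Fin (k n))"
    using eventually_gt_int[OF assms, of "int N"]
  proof eventually_elim
    case (elim n)
    then show ?case using N squash_mono[of "int N" "k n"] by linarith
  qed
next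
  fix a :: real assume "1 < a"
  then have "squash (Fin (k n)) < a" for n using abs_squash_Fin[of "k n"] by linarith
  then show "\<forall>\<^sub>F n in F. squash (Fin (k n)) < a" by simp
qed

section \<open>The horocyclic metric and its convergent sequences\<close>

context pointed
begin

abbreviation th :: "'a tilde_point \<Rightarrow> 'a hat_point" where "th \<equiv> tilde_to_hat T"
abbreviation sh :: "'a tilde_point \<Rightarrow> real" where "sh z \<equiv> squash (tilde_height T z)"

lemma th_in: "z \<in> tilde_tree T \<Longrightarrow> th z \<in> hat_tree T"
  using refend_in by (auto simp: tilde_tree_def hat_tree_def)

lemma tilde_eqI:
  assumes "z \<in> tilde_tree T" "w \<in> tilde_tree T" "th z = th w" "tilde_height T z = tilde_height T w"
  shows "z = w"
  using assms by (cases z; cases w) (auto simp: tilde_tree_def)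

sublocale tilde: Metric_space "tilde_tree T" "tilde_dist p T"
proof
  show "0 \<le> tilde_dist p T x y" for x y by (simp add: tilde_dist_def)
  show "tilde_dist p T x y = tilde_dist p T y x" for x y
    by (simp add: tilde_dist_def hat.commute abs_minus_commute)
  show "tilde_dist p T x y = 0 \<longleftrightarrow> x = y" if "x \<in> tilde_tree T" "y \<in> tilde_tree T" for x y
  proof
    assume "tilde_dist p T x y = 0"
    then have "end_dist p T (th x) (th y) = 0" "sh x = sh y"
      using hat.nonneg[of "th x" "th y"] by (auto simp: tilde_dist_def add_nonneg_eq_0_iff)
    then show "x = y" using that squash_inj by (intro tilde_eqI) (auto simp: th_in)
  qed (simp add: tilde_dist_def end_dist_def)
  show "tilde_dist p T x z \<le> tilde_dist p T x y + tilde_dist p T y z"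
    if "x \<in> tilde_tree T" "y \<in> tilde_tree T" "z \<in> tilde_tree T" for x y z
    using hat.triangle[of "th x" "th y" "th z"] that th_in by (simp add: tilde_dist_def)
qed

lemma tilde_limit:
  "limitin (tilde_topology p T) \<sigma> z sequentially \<longleftrightarrow> z \<in> tilde_tree T \<and> (\<forall>\<^sub>F n in sequentially. \<sigma> n \<in> tilde_tree T)
    \<and> (\<forall>N. \<forall>\<^sub>F n in sequentially. tr (th (\<sigma> n)) N = tr (th z) N) \<and> (\<lambda>n. sh (\<sigma> n)) \<longlonglongrightarrow> sh z"
  (is "?L \<longleftrightarrow> ?R")
proof
  assume ?L
  then have z: "z \<in> tilde_tree T" and ev: "\<forall>\<^sub>F n in sequentially. \<sigma> n \<in> tilde_tree T"
    and lim: "(\<lambda>n. tilde_dist p T (\<sigma> n) z) \<longlonglongrightarrow> 0"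
    by (auto simp: tilde_topology_def tilde.limitin_metric_dist_null)
  have "\<forall>\<^sub>F n in sequentially. tr (th (\<sigma> n)) N = tr (th z) N" for N
  proof -
    have "0 < 1 / real p ^ N" using p_pos by simp
    from ev order_tendstoD(2)[OF lim this] show ?thesis
    proof eventually_elim
      case (elim n)
      then have "end_dist p T (th (\<sigma> n)) (th z) \<le> 1 / real p ^ N" by (simp add: tilde_dist_def)
      then show ?case using end_dist_le th_in elim z by blast
    qed
  qed
  moreover have "(\<lambda>n. sh (\<sigma> n) - sh z) \<longlonglongrightarrow> 0"
    by (rule Lim_null_comparison[OF _ lim]) (simp add: tilde_dist_def)
  ultimately show ?R using z ev by (simp add: LIM_zero_iff)
next
  assume R: ?R
  have "(\<lambda>n. tilde_dist p T (\<sigma> n) z) \<longlonglongrightarrow> 0"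
  proof (rule tendstoI)
    fix e :: real assume e: "e > 0"
    obtain N where N: "1 / real p ^ N < e / 2" using small_power[of "e / 2"] e by auto
    have "\<forall>\<^sub>F n in sequentially. dist (sh (\<sigma> n)) (sh z) < e / 2" using R e by (intro tendstoD) auto
    moreover have "\<forall>\<^sub>F n in sequentially. tr (th (\<sigma> n)) N = tr (th z) N" "\<forall>\<^sub>F n in sequentially. \<sigma> n \<in> tilde_tree T"
      using R by auto
    ultimately show "\<forall>\<^sub>F n in sequentially. dist (tilde_dist p T (\<sigma> n) z) 0 < e"
    proof eventually_elim
      case (elim n)
      then have "end_dist p T (th (\<sigma> n)) (th z) \<le> 1 / real p ^ N" using end_dist_le th_in R by blast
      then have "tilde_dist p T (\<sigma> n) z < e" using elim(1) N by (simp add: tilde_dist_def dist_real_def)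
      then show ?case by (simp add: dist_real_def)
    qed
  qed
  then show ?L using R by (auto simp: tilde_topology_def tilde.limitin_metric_dist_null)
qed

lemma hat_limit:
  "limitin (hat_topology p T) \<sigma> z sequentially \<longleftrightarrow> z \<in> hat_tree T \<and> (\<forall>\<^sub>F n in sequentially. \<sigma> n \<in> hat_tree T)
    \<and> (\<forall>N. \<forall>\<^sub>F n in sequentially. tr (\<sigma> n) N = tr z N)" (is "?L \<longleftrightarrow> ?R")
proof
  assume L: ?L
  then have "z \<in> hat_tree T" "\<forall>\<^sub>F n in sequentially. \<sigma> n \<in> hat_tree T"
    by (auto simp: hat_topology_def hat.limitin_metric_dist_null)
  then show ?R using hat_limit_tr[OF L] by blast
next
  assume R: ?R
  have "(\<lambda>n. end_dist p T (\<sigma> n) z) \<longlonglongrightarrow> 0"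
  proof (rule tendstoI)
    fix e :: real assume e: "e > 0"
    obtain N where N: "1 / real p ^ N < e" using small_power[OF e] by auto
    have "\<forall>\<^sub>F n in sequentially. tr (\<sigma> n) N = tr z N" "\<forall>\<^sub>F n in sequentially. \<sigma> n \<in> hat_tree T"
      using R by auto
    then show "\<forall>\<^sub>F n in sequentially. dist (end_dist p T (\<sigma> n) z) 0 < e"
    proof eventually_elim
      case (elim n)
      then have "end_dist p T (\<sigma> n) z \<le> 1 / real p ^ N" using end_dist_le R by blast
      then show ?case using N by (simp add: dist_real_def)
    qed
  qed
  then show ?L using R by (auto simp: hat_topology_def hat.limitin_metric_dist_null)
qed

lemma tilde_limit_hat:
  "limitin (tilde_topology p T) \<sigma> z sequentially \<Longrightarrow> limitin (hat_topology p T) (\<lambda>n. th (\<sigma> n)) (th z) sequentially"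
  unfolding tilde_limit hat_limit by (auto intro: th_in elim: eventually_mono)

section \<open>Compactness\<close>

lemma finite_lev: "finite {u. lev u \<le> n}"
proof (induction n)
  case 0
  have "{u. lev u \<le> 0} = {o'}" by auto
  then show ?case by simp
next
  case (Suc n)
  have "{u. lev u \<le> Suc n} \<subseteq> {u. lev u \<le> n} \<union> (\<Union>v\<in>{u. lev u \<le> n}. {u. adj T v u})"
  proof
    fix u assume u: "u \<in> {u. lev u \<le> Suc n}"
    show "u \<in> {u. lev u \<le> n} \<union> (\<Union>v\<in>{u. lev u \<le> n}. {u. adj T v u})"
    proof (cases "lev u = Suc n")
      case True
      then obtain v where "adj T v u" "lev v = n" by (rule gdist_Suc_obtain)
      then show ?thesis by auto
    qed (use u in auto)
  qed
  moreover have "finite {u. adj T v u}" for v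
    using pointed by (simp add: pointed_homogeneous_tree_def homogeneous_tree_def)
  ultimately show ?case using Suc by (auto intro: finite_subset)
qed

lemma finite_tr: "finite (range (\<lambda>z. tr z n))"
  by (rule finite_subset[OF _ finite_Pow_iff[THEN iffD2, OF finite_lev[of n]]]) (auto simp: tr_def)

text \<open>Up to an error \<open>e\<close>, a point is determined by its trace at one level and its
  squashed height rounded down to a grid. Both take finitely many values.\<close>

lemma tilde_totally_bounded: "tilde.mtotally_bounded (tilde_tree T)"
  unfolding tilde.mtotally_bounded_def
proof (intro allI impI)
  fix e :: real assume e: "e > 0"
  obtain N where N: "1 / real p ^ N < e / 2" using small_power[of "e / 2"] e by auto
  obtain L :: nat where L: "L > 0" "1 / real L < e / 2"
    using e by (metis half_gt_zero nat_approx_posE of_nat_0_less_iff inverse_eq_divide zero_less_Suc)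
  define \<Phi> where "\<Phi> = (\<lambda>z. (tr (th z) N, \<lfloor>sh z * real L\<rfloor>))"
  have "\<Phi> ` tilde_tree T \<subseteq> range (\<lambda>z. tr z N) \<times> {- int L..int L}"
  proof (clarsimp simp: \<Phi>_def)
    fix z
    have "\<bar>sh z * real L\<bar> \<le> 1 * real L" unfolding abs_mult using squash_bounds by (intro mult_mono) auto
    then show "- int L \<le> \<lfloor>sh z * real L\<rfloor> \<and> \<lfloor>sh z * real L\<rfloor> \<le> int L"
      by (simp add: le_floor_iff floor_le_iff abs_le_iff)
  qed
  then have fin: "finite (\<Phi> ` tilde_tree T)" by (rule finite_subset) (intro finite_cartesian_product finite_tr finite_atLeastAtMost_int)
  define K where "K = inv_into (tilde_tree T) \<Phi> ` (\<Phi> ` tilde_tree T)"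
  show "\<exists>K. finite K \<and> K \<subseteq> tilde_tree T \<and> tilde_tree T \<subseteq> (\<Union>x\<in>K. tilde.mball x e)"
  proof (intro exI[of _ K] conjI)
    show "finite K" using fin by (simp add: K_def)
    show "K \<subseteq> tilde_tree T" by (auto simp: K_def intro: inv_into_into)
    show "tilde_tree T \<subseteq> (\<Union>x\<in>K. tilde.mball x e)"
    proof
      fix z assume z: "z \<in> tilde_tree T"
      define w where "w = inv_into (tilde_tree T) \<Phi> (\<Phi> z)"
      have w: "w \<in> K" "w \<in> tilde_tree T" "\<Phi> w = \<Phi> z"
        using z by (auto simp: w_def K_def intro: inv_into_into f_inv_into_f)
      then have "tr (th w) N = tr (th z) N" and fl: "\<lfloor>sh w * real L\<rfloor> = \<lfloor>sh z * real L\<rfloor>" by (auto simp: \<Phi>_def)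
      then have "end_dist p T (th w) (th z) \<le> 1 / real p ^ N" using end_dist_le th_in w z by blast
      moreover have "\<bar>sh w - sh z\<bar> < e / 2"
      proof -
        have "\<bar>sh w * real L - sh z * real L\<bar> < 1" using fl by linarith
        then have "\<bar>sh w - sh z\<bar> * real L < 1" by (simp add: abs_mult flip: left_diff_distrib)
        then have "\<bar>sh w - sh z\<bar> < 1 / real L" using L by (simp add: pos_less_divide_eq)
        then show ?thesis using L by linarith
      qed
      ultimately have "tilde_dist p T w z < e" using N by (simp add: tilde_dist_def)
      then show "z \<in> (\<Union>x\<in>K. tilde.mball x e)" using w z by auto
    qed
  qed
qed

text \<open>The union of consistent traces is a geodesic from the root. It ends at a vertex if its
  levels are bounded, and otherwise is a ray, whose end is the required point.\<close>

lemma hat_point_of_traces: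
  assumes ex: "\<And>N. \<exists>z\<in>hat_tree T. tr z N = B N" and cons: "\<And>M N. M \<le> N \<Longrightarrow> B M = {u \<in> B N. lev u \<le> M}"
  obtains z where "z \<in> hat_tree T" "\<And>N. tr z N = B N"
proof -
  define U where "U = (\<Union>N. B N)"
  have B: "B N = {u \<in> U. lev u \<le> N}" for N
  proof -
    have "u \<in> B N" if "u \<in> B M" "lev u \<le> N" for u M
      using cons[of "min M N" M] cons[of "min M N" N] that ex[of M]
      by (cases "M \<le> N") (auto simp: min_def)
    moreover have "lev u \<le> N" if "u \<in> B N" for u using ex[of N] that by (auto simp: tr_def)
    ultimately show ?thesis by (auto simp: U_def)
  qed
  have near: "\<exists>z\<in>hat_tree T. \<forall>u. lev u \<le> N \<longrightarrow> (u \<in> U \<longleftrightarrow> u \<in> G z)" for N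
    using ex[of N] B[of N] by (auto simp: tr_def set_eq_iff)
  have uniq: "u = v" if "u \<in> U" "v \<in> U" "lev u = lev v" for u v
    using near[of "lev u"] that G_unique by (metis order_refl)
  have down: "u \<in> U" if "v \<in> U" "u \<in> G (Vert v)" for u v
  proof -
    have "lev u \<le> lev v" using that(2) by (simp add: G_Vert)
    then show ?thesis using near[of "lev v"] that G_subset by (metis order_refl)
  qed
  have org: "o' \<in> U" using near[of 0] origin_in_G by (metis gdist_self order_refl)
  have "\<exists>z\<in>hat_tree T. G z = U"
  proof (cases "\<exists>N. \<forall>u\<in>U. lev u \<le> N")
    case True
    then obtain N where N: "\<And>u. u \<in> U \<Longrightarrow> lev u \<le> N" by blast
    obtain z where "z \<in> hat_tree T" "\<forall>u. lev u \<le> Suc N \<longrightarrow> (u \<in> U \<longleftrightarrow> u \<in> G z)" using near by blast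
    moreover have "lev u \<le> N" if "u \<in> G z" for u
    proof (rule ccontr)
      assume "\<not> lev u \<le> N"
      then obtain v where v: "v \<in> G (Vert u)" "lev v = Suc N" using G_Vert_level[of "Suc N" u] by auto
      then have "v \<in> G z" using G_subset[OF \<open>z \<in> hat_tree T\<close> that] by blast
      then have "v \<in> U" using calculation(2) v by simp
      then show False using N v by fastforce
    qed
    ultimately show ?thesis using N by (metis le_SucI subsetI subset_antisym)
  next
    case False
    have all: "\<exists>u\<in>U. lev u = n" for n
    proof -
      obtain v where "v \<in> U" "n \<le> lev v" using False by (meson nat_le_linear)
      then show ?thesis using G_Vert_level[of n v] down by blast
    qed
    then obtain \<pi> where \<pi>: "\<And>n. \<pi> n \<in> U" "\<And>n. lev (\<pi> n) = n" by metis
    have adj: "adj T (\<pi> n) (\<pi> (Suc n))" for n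
    proof -
      obtain u where u: "u \<in> G (Vert (\<pi> (Suc n)))" "lev u = n" using G_Vert_level[of n "\<pi> (Suc n)"] \<pi>(2) by auto
      then have "u = \<pi> n" using uniq[OF down[OF \<pi>(1) u(1)] \<pi>(1)] \<pi>(2) by simp
      then have "d (\<pi> n) (\<pi> (Suc n)) = 1" using u \<pi>(2) by (simp add: G_Vert)
      then show ?thesis by (simp add: adj_iff_gdist)
    qed
    have "\<pi> (Suc (Suc n)) \<noteq> \<pi> n" for n using \<pi>(2)[of "Suc (Suc n)"] \<pi>(2)[of n] by (metis n_not_Suc_n Suc_n_not_le_n le_SucI order_refl)
    then have ray: "\<pi> \<in> rays (adj T)" using adj by (simp add: rays_iff)
    define \<xi> where "\<xi> = ray_equiv (adj T) `` {\<pi>}"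
    have \<xi>: "\<xi> \<in> ends (adj T)" "\<pi> \<in> \<xi>" using end_of_ray[OF ray] by (auto simp: \<xi>_def)
    have "\<pi> 0 = o'" using \<pi>(2)[of 0] by simp
    then have "eray \<xi> o' = \<pi>" by (rule eray_eqI[OF \<xi>])
    then have "G (End \<xi>) = range \<pi>" by (simp add: G_End[OF \<xi>(1)])
    moreover have "range \<pi> = U"
    proof (intro equalityI subsetI)
      fix u assume "u \<in> U"
      then have "u = \<pi> (lev u)" using uniq[of u "\<pi> (lev u)"] \<pi> by simp
      then show "u \<in> range \<pi>" by blast
    qed (use \<pi>(1) in auto)
    ultimately show ?thesis using \<xi>(1) by (intro bexI[of _ "End \<xi>"]) (auto simp: hat_tree_def)
  qed
  then obtain z where "z \<in> hat_tree T" "G z = U" by blast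
  then show thesis by (intro that[of z]) (simp_all add: tr_def B)
qed

lemma squash_near_1: "a < 1 \<Longrightarrow> \<exists>m0. \<forall>m\<ge>m0. a < squash (Fin (int m - j))"
proof -
  assume a: "a < 1"
  have "filterlim (\<lambda>m. int m - j) at_top sequentially" unfolding filterlim_at_top
  proof
    fix Z show "\<forall>\<^sub>F m in sequentially. Z \<le> int m - j"
      using eventually_ge_at_top[of "nat (Z + j)"] by eventually_elim simp
  qed
  from order_tendstoD(1)[OF squash_at_top[OF this] a] show ?thesis by (simp add: eventually_sequentially)
qed

text \<open>Beyond its turn, a vertex of the ray can lie on the geodesic to \<open>y\<close> only if
  \<open>y\<close> descends from it and so is at least as high. The points over the reference end
  never share this trace.\<close>

lemma tilde_limit_HEnd_height:
  assumes \<xi>: "\<xi> \<in> ends (adj T)" "\<xi> \<noteq> refend T"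
    and \<sigma>: "\<And>n. \<sigma> n \<in> tilde_tree T" and tr: "\<And>N. \<forall>\<^sub>F n in sequentially. tr (th (\<sigma> n)) N = tr (End \<xi>) N"
  shows "(\<lambda>n. sh (\<sigma> n)) \<longlonglongrightarrow> 1"
proof (rule order_tendstoI)
  fix a :: real assume "a < 1"
  obtain J where J: "\<And>N. N \<ge> J \<Longrightarrow> ht (eray \<xi> o' N) = int N - 2 * int J"
    "\<And>N. N \<ge> J \<Longrightarrow> con o' (eray \<xi> o' N) = - int J" using end_ray_turns[OF \<xi>] by metis
  obtain m where m: "\<forall>n\<ge>m. a < squash (Fin (int n - 2 * int J))" using squash_near_1[OF \<open>a < 1\<close>] by blast
  define N where "N = max m (Suc J)"
  have N: "N > J" "a < squash (Fin (int N - 2 * int J))" using m by (auto simp: N_def simp del: squash.simps)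
  have hN: "ht (eray \<xi> o' N) = int N - 2 * int J" by (rule J(1)) (use N in simp)
  show "\<forall>\<^sub>F n in sequentially. a < sh (\<sigma> n)"
    using tr[of N]
  proof eventually_elim
    case (elim n)
    have "eray \<xi> o' N \<in> tr (End \<xi>) N" using lev_eray[OF \<xi>(1)] by (simp add: in_tr G_End[OF \<xi>(1)])
    then have "eray \<xi> o' N \<in> tr (th (\<sigma> n)) N" by (simp only: elim)
    then have G: "eray \<xi> o' N \<in> G (th (\<sigma> n))" by (simp add: in_tr)
    show ?case
    proof (cases "\<sigma> n")
      case (HVert y)
      have "con (eray \<xi> o' N) y = ht (eray \<xi> o' N)"
        by (rule end_descendant[OF \<xi>(1) J N(1)]) (use G HVert in auto)
      then have "int N - 2 * int J \<le> ht y" using con_le2[of "eray \<xi> o' N" y] hN by simp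
      from squash_mono[OF this] show ?thesis using N(2) by (simp add: HVert del: squash.simps)
    next
      case (HEnd \<xi>')
      then show ?thesis using \<open>a < 1\<close> by simp
    next
      case (HOmega k)
      then obtain i where i: "eray \<xi> o' N = (fa ^^ i) o'"
        using G by (auto simp: G_End[OF refend_in] eray_refend)
      then have "i = N" using gdist_fa_funpow[of o' i] lev_eray[OF \<xi>(1), of N] by simp
      then show ?thesis using i hN N(1) by simp
    qed
  qed
next
  fix a :: real assume "1 < a"
  then have "sh (\<sigma> n) < a" for n using squash_bounds[of "tilde_height T (\<sigma> n)"] by linarith
  then show "\<forall>\<^sub>F n in sequentially. sh (\<sigma> n) < a" by simp
qed

text \<open>The traces determine the image of the limit in the end compactification. The height
  coordinate is then forced, except over the reference end, where its limit selects one of the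
  points \<open>HOmega k\<close>.\<close>

lemma tilde_complete: "tilde.mcomplete"
  unfolding tilde.mcomplete_def
proof (intro allI impI)
  fix \<sigma> assume "tilde.MCauchy \<sigma>"
  then have \<sigma>: "\<And>n. \<sigma> n \<in> tilde_tree T"
    and cauchy: "\<And>e. e > 0 \<Longrightarrow> \<exists>N. \<forall>n n'. N \<le> n \<longrightarrow> N \<le> n' \<longrightarrow> tilde_dist p T (\<sigma> n) (\<sigma> n') < e"
    by (auto simp: tilde.MCauchy_def)
  have "\<exists>K. \<forall>n\<ge>K. tr (th (\<sigma> n)) N = tr (th (\<sigma> K)) N" for N
  proof -
    obtain K where K: "\<And>n n'. K \<le> n \<Longrightarrow> K \<le> n' \<Longrightarrow> tilde_dist p T (\<sigma> n) (\<sigma> n') < 1 / real p ^ N"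
      using cauchy[of "1 / real p ^ N"] p_pos by auto
    have "tr (th (\<sigma> n)) N = tr (th (\<sigma> K)) N" if "n \<ge> K" for n
    proof -
      have "end_dist p T (th (\<sigma> n)) (th (\<sigma> K)) \<le> 1 / real p ^ N"
        using K[OF that order_refl] by (simp add: tilde_dist_def)
      then show ?thesis using end_dist_le th_in \<sigma> by blast
    qed
    then show ?thesis by blast
  qed
  then obtain K where K: "\<And>N n. n \<ge> K N \<Longrightarrow> tr (th (\<sigma> n)) N = tr (th (\<sigma> (K N))) N" by metis
  define B where "B = (\<lambda>N. tr (th (\<sigma> (K N))) N)"
  obtain z where z: "z \<in> hat_tree T" "\<And>N. tr z N = B N"
  proof (rule hat_point_of_traces)
    show "\<exists>z\<in>hat_tree T. tr z N = B N" for N using th_in[OF \<sigma>] by (auto simp: B_def)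
    show "B M = {u \<in> B N. lev u \<le> M}" if "M \<le> N" for M N
    proof -
      define n where "n = max (K M) (K N)"
      have "B M = tr (th (\<sigma> n)) M" "B N = tr (th (\<sigma> n)) N"
        using K[of M n] K[of N n] by (auto simp: B_def n_def)
      then show ?thesis using that by (auto simp: tr_def)
    qed
  qed blast
  have tr: "\<forall>\<^sub>F n in sequentially. tr (th (\<sigma> n)) N = tr z N" for N
    using eventually_ge_at_top[of "K N"]
  proof eventually_elim
    case (elim n)
    show ?case unfolding z(2) B_def by (rule K[OF elim])
  qed
  have "Cauchy (\<lambda>n. sh (\<sigma> n))" unfolding Cauchy_def
  proof (intro allI impI)
    fix e :: real assume "e > 0"
    then obtain N where N: "\<And>n n'. N \<le> n \<Longrightarrow> N \<le> n' \<Longrightarrow> tilde_dist p T (\<sigma> n) (\<sigma> n') < e" using cauchy by blast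
    have "dist (sh (\<sigma> m)) (sh (\<sigma> n)) < e" if "N \<le> m" "N \<le> n" for m n
      using N[OF that] hat.nonneg[of "th (\<sigma> m)" "th (\<sigma> n)"]
      unfolding tilde_dist_def dist_real_def by linarith
    then show "\<exists>M. \<forall>m\<ge>M. \<forall>n\<ge>M. dist (sh (\<sigma> m)) (sh (\<sigma> n)) < e" by blast
  qed
  then have "convergent (\<lambda>n. sh (\<sigma> n))" by (rule Cauchy_convergent)
  then obtain s where s: "(\<lambda>n. sh (\<sigma> n)) \<longlonglongrightarrow> s" unfolding convergent_def by blast
  then obtain k0 where k0: "s = squash k0" using squash_limit by metis
  have "\<exists>w. w \<in> tilde_tree T \<and> th w = z \<and> (\<lambda>n. sh (\<sigma> n)) \<longlonglongrightarrow> sh w"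
    using z(1)
  proof (cases rule: hat_cases)
    case (Vert v)
    have "\<forall>\<^sub>F n in sequentially. sh (\<sigma> n) = sh (HVert v)"
      using tr[of "Suc (lev v)"]
    proof eventually_elim
      case (elim n)
      then have "th (\<sigma> n) = Vert v" using Vert_isolated[OF th_in[OF \<sigma>]] Vert by simp
      then show ?case by (cases "\<sigma> n") auto
    qed
    then have "(\<lambda>n. sh (\<sigma> n)) \<longlonglongrightarrow> sh (HVert v)" by (rule tendsto_eventually)
    then show ?thesis using Vert by (intro exI[of _ "HVert v"]) (auto simp: tilde_tree_def)
  next
    case (End \<xi>)
    show ?thesis
    proof (cases "\<xi> = refend T")
      case True
      then show ?thesis using s k0 End by (intro exI[of _ "HOmega k0"]) (auto simp: tilde_tree_def)
    next
      case False
      have "(\<lambda>n. sh (\<sigma> n)) \<longlonglongrightarrow> 1"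
        by (rule tilde_limit_HEnd_height[OF End(2) False \<sigma>]) (use tr End in simp)
      then show ?thesis using False End by (intro exI[of _ "HEnd \<xi>"]) (auto simp: tilde_tree_def)
    qed
  qed
  then obtain w where "w \<in> tilde_tree T" "th w = z" "(\<lambda>n. sh (\<sigma> n)) \<longlonglongrightarrow> sh w" by blast
  then have "limitin (tilde_topology p T) \<sigma> w sequentially" unfolding tilde_limit using \<sigma> tr by simp
  then show "\<exists>x. limitin tilde.mtopology \<sigma> x sequentially" unfolding tilde_topology_def by blast
qed

lemma topspace_tilde [simp]: "topspace (tilde_topology p T) = tilde_tree T"
  by (simp add: tilde_topology_def)

lemma topspace_hat [simp]: "topspace (hat_topology p T) = hat_tree T"
  by (simp add: hat_topology_def)

lemma compact_tilde: "compact_space (tilde_topology p T)"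
  unfolding tilde_topology_def tilde.compact_space_eq_mcomplete_mtotally_bounded
  using tilde_complete tilde_totally_bounded by blast

lemma metrizable_tilde: "metrizable_space (tilde_topology p T)"
  unfolding tilde_topology_def by (rule tilde.metrizable_space_mtopology)

lemma metrizable_hat: "metrizable_space (hat_topology p T)"
  unfolding hat_topology_def by (rule hat.metrizable_space_mtopology)

text \<open>The end compactification is the image of the horocyclic one under \<open>th\<close>.
  Lifting the reference end to index \<open>Pinf\<close> is an arbitrary choice.\<close>

lemma compact_hat: "compact_space (hat_topology p T)"
  unfolding hat_topology_def hat.compact_space_sequentially
proof (intro allI impI)
  fix \<sigma> :: "nat \<Rightarrow> 'a hat_point" assume \<sigma>: "range \<sigma> \<subseteq> hat_tree T"
  have "\<exists>w\<in>tilde_tree T. th w = z" if z: "z \<in> hat_tree T" for z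
    using z
  proof (cases rule: hat_cases)
    case (Vert v)
    then show ?thesis by (intro bexI[of _ "HVert v"]) (auto simp: tilde_tree_def)
  next
    case (End \<xi>)
    then show ?thesis
      by (intro bexI[of _ "if \<xi> = refend T then HOmega Pinf else HEnd \<xi>"]) (auto simp: tilde_tree_def)
  qed
  then have "\<exists>w. w \<in> tilde_tree T \<and> th w = \<sigma> n" for n using \<sigma> by blast
  then obtain \<tau> where \<tau>: "\<And>n. \<tau> n \<in> tilde_tree T" "\<And>n. th (\<tau> n) = \<sigma> n" by metis
  obtain l s where ls: "l \<in> tilde_tree T" "strict_mono s" "limitin (tilde_topology p T) (\<tau> \<circ> s) l sequentially"
    using compact_metrizable_subsequence[OF metrizable_tilde compact_tilde, of \<tau>] \<tau>(1) by auto
  have "limitin (hat_topology p T) (\<lambda>n. th ((\<tau> \<circ> s) n)) (th l) sequentially"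
    by (rule tilde_limit_hat[OF ls(3)])
  then have "limitin hat.mtopology (\<sigma> \<circ> s) (th l) sequentially" by (simp add: hat_topology_def \<tau>(2) o_def)
  then show "\<exists>l r. l \<in> hat_tree T \<and> strict_mono r \<and> limitin hat.mtopology (\<sigma> \<circ> r) l sequentially"
    using th_in[OF ls(1)] ls(2) by blast
qed

lemma open_Vert: "openin (hat_topology p T) {Vert v}"
  unfolding hat_topology_def hat.openin_mtopology
proof (intro conjI ballI allI impI)
  show "{Vert v} \<subseteq> hat_tree T" by (simp add: hat_tree_def)
  fix x assume "x \<in> {Vert v}"
  then have x: "x = Vert v" by simp
  have "hat.mball x (1 / real p ^ Suc (lev v)) \<subseteq> {Vert v}"
  proof
    fix w assume "w \<in> hat.mball x (1 / real p ^ Suc (lev v))"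
    then have w: "w \<in> hat_tree T" "Vert v \<in> hat_tree T" "end_dist p T w (Vert v) \<le> 1 / real p ^ Suc (lev v)"
      by (auto simp: x hat.commute)
    then show "w \<in> {Vert v}" using end_dist_le[OF w(1,2)] Vert_isolated[OF w(1)] by blast
  qed
  then show "\<exists>r>0. hat.mball x r \<subseteq> {Vert v}" using p_pos by (intro exI[of _ "1 / real p ^ Suc (lev v)"]) simp
qed

lemma open_HVert: "openin (tilde_topology p T) {HVert v}"
  unfolding tilde_topology_def tilde.openin_mtopology
proof (intro conjI ballI allI impI)
  show "{HVert v} \<subseteq> tilde_tree T" by (simp add: tilde_tree_def)
  fix x assume "x \<in> {HVert v}"
  then have x: "x = HVert v" by simp
  have "tilde.mball x (1 / real p ^ Suc (lev v)) \<subseteq> {HVert v}"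
  proof
    fix w assume "w \<in> tilde.mball x (1 / real p ^ Suc (lev v))"
    then have w: "w \<in> tilde_tree T" "HVert v \<in> tilde_tree T" "tilde_dist p T w (HVert v) < 1 / real p ^ Suc (lev v)"
      by (auto simp: x tilde.commute)
    then have "end_dist p T (th w) (Vert v) \<le> 1 / real p ^ Suc (lev v)" by (simp add: tilde_dist_def)
    then have "tr (th w) (Suc (lev v)) = tr (Vert v) (Suc (lev v))"
      using end_dist_le[OF th_in[OF w(1)], of "Vert v"] by (simp only: hat_tree_def) blast
    then have "th w = Vert v" by (rule Vert_isolated[OF th_in[OF w(1)]])
    then show "w \<in> {HVert v}" by (cases w) auto
  qed
  then show "\<exists>r>0. tilde.mball x r \<subseteq> {HVert v}" using p_pos by (intro exI[of _ "1 / real p ^ Suc (lev v)"]) simp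
qed

end

text \<open>Isolated points in both factors give isolated pairs, so the image of \<open>W\<close> is
  discrete in its closure.\<close>

lemma product_compactification:
  assumes X: "metrizable_space X" "compact_space X" "inj e" "\<And>v. openin X {e v}"
    and Y: "metrizable_space Y" "compact_space Y" "inj e'" "\<And>v. openin Y {e' v}"
  defines "Z \<equiv> prod_topology X Y"
  shows "discrete_compactification W (subtopology Z (Z closure_of (map_prod e e' ` W))) (map_prod e e')"
proof -
  let ?E = "map_prod e e' ` W"
  have open_Z: "openin Z {map_prod e e' v}" for v
  proof -
    have eq: "{map_prod e e' v} = {e (fst v)} \<times> {e' (snd v)}" by (cases v) auto
    show ?thesis unfolding Z_def eq openin_prod_Times_iff using X(4) Y(4) by blast
  qed
  have sub: "?E \<subseteq> topspace Z" using openin_subset[OF open_Z] by auto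
  then have cl: "?E \<subseteq> Z closure_of ?E" by (rule closure_of_subset)
  have "compact_space Z" unfolding Z_def using X Y by (simp add: compact_space_prod_topology)
  moreover have "metrizable_space Z" unfolding Z_def using X Y by (simp add: metrizable_space_prod_topology)
  moreover have "subtopology Z ?E = discrete_topology ?E"
  proof -
    have op: "openin (subtopology Z ?E) {x}" if x: "x \<in> ?E" for x
    proof -
      from x obtain v where "x = map_prod e e' v" by (rule imageE)
      then have "openin Z {x}" using open_Z by simp
      then show ?thesis unfolding openin_subtopology using x by (intro exI[of _ "{x}"]) blast
    qed
    have "topspace (subtopology Z ?E) = ?E" using sub by (simp add: Int_absorb1)
    with op have "discrete_topology ?E = subtopology Z ?E"
      unfolding discrete_topology_unique by blast
    then show ?thesis by simp
  qed
  moreover have "subtopology (subtopology Z (Z closure_of ?E)) ?E = subtopology Z ?E"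
    using cl by (simp add: subtopology_subtopology Int_absorb1)
  moreover have "topspace (subtopology Z (Z closure_of ?E)) = Z closure_of ?E"
    using closure_of_subset_topspace[of Z ?E] by (simp add: Int_absorb1)
  moreover have "subtopology Z (Z closure_of ?E) closure_of ?E = Z closure_of ?E"
    using cl by (simp add: closure_of_subtopology Int_absorb1)
  moreover have "inj_on (map_prod e e') W"
    using X(3) Y(3) by (auto simp: inj_on_def inj_def)
  ultimately show ?thesis
    unfolding discrete_compactification_def using cl
    by (simp add: metrizable_space_subtopology compact_space_subtopology closedin_compact_space)
qed

section \<open>The Diestel-Leader graph\<close>

locale DL_pair = T1: pointed T1 q + T2: pointed T2 r
  for T1 :: "'a pointed_tree" and q and T2 :: "'b pointed_tree" and r
begin

sublocale horocyclic_product T1.fa "height T1" q T2.fa "height T2" r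
  by unfold_locales

lemma V_eq: "V = DL T1 T2"
  by (simp add: V_def DL_def)

lemma P_eq: "P \<alpha> = DL_walk q r T1 T2 \<alpha>"
  by (simp add: P_def DL_walk_def fun_eq_iff T1.father_eq T2.father_eq)

abbreviation "rt \<equiv> DL_root T1 T2"

lemma root_in_V: "rt \<in> V" and root_height [simp]: "ht rt = 0"
  by (simp_all add: V_def DL_root_def)

text \<open>The Martin kernel without the power of
  \<open>sqrt ((1 - \<alpha>) / \<alpha>)\<close>.\<close>

definition kap :: "real \<Rightarrow> 'a \<times> 'b \<Rightarrow> 'a \<times> 'b \<Rightarrow> real" where
  "kap c x y = PsiV c y x / PsiV c y rt"

text \<open>The last clause excludes sequences that are eventually constant.\<close>

definition converges :: "(nat \<Rightarrow> 'a \<times> 'b) \<Rightarrow> 'a hat_point \<Rightarrow> 'b hat_point \<Rightarrow> bool" where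
  "converges v z1 z2 \<longleftrightarrow> (\<forall>n. v n \<in> V) \<and> limitin (hat_topology q T1) (\<lambda>n. Vert (fst (v n))) z1 sequentially
     \<and> limitin (hat_topology r T2) (\<lambda>n. Vert (snd (v n))) z2 sequentially
     \<and> (\<forall>w\<in>V. (z1, z2) \<noteq> (Vert (fst w), Vert (snd w)))"

definition hat_height :: "'a hat_point \<Rightarrow> int option" where
  "hat_height z = (case z of Vert v \<Rightarrow> Some (height T1 v) | End \<xi> \<Rightarrow> None)"

definition Rlim :: "real \<Rightarrow> 'a hat_point \<Rightarrow> 'a \<times> 'b \<Rightarrow> real" where
  "Rlim c z x = Rup c (real q) (real r) (hat_height z) (ht x) (T1.econ z (fst x)) 0 (T1.econ z (origin T1))"

lemma converges_hat: "converges v z1 z2 \<Longrightarrow> z1 \<in> hat_tree T1" "converges v z1 z2 \<Longrightarrow> z2 \<in> hat_tree T2"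
  unfolding converges_def using limitin_topspace by fastforce+

lemma M0_to_infinity:
  assumes "limitin (hat_topology r T2) (\<lambda>n. Vert (snd (v n))) T2.omega sequentially"
  shows "filterlim (\<lambda>n. M0 x (v n)) at_top sequentially" "\<forall>\<^sub>F n in sequentially. M0 x (v n) = M0 rt (v n)"
  using T2.vertices_to_refend[OF assms, of "snd x"]
  by (auto simp: M0_def DL_root_def intro: filterlim_uminus_int)

lemma m0_to_minus_infinity:
  assumes "limitin (hat_topology q T1) (\<lambda>n. Vert (fst (v n))) T1.omega sequentially"
  shows "filterlim (\<lambda>n. m0 x (v n)) at_bot sequentially" "\<forall>\<^sub>F n in sequentially. m0 x (v n) = m0 rt (v n)"
  using T1.vertices_to_refend[OF assms, of "fst x"]
  by (auto simp: m0_def DL_root_def)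

text \<open>A coordinate whose limit is not the reference end is eventually constant or has height
  tending to infinity. Opposite heights allow this in both coordinates only if both are eventually
  constant, which \<open>converges\<close> excludes.\<close>

lemma first_boundary_limit:
  assumes v: "converges v z1 z2" and z1: "z1 \<noteq> T1.omega" and c: "c \<ge> 1"
  shows "z2 = T2.omega"
    and "x \<in> V \<Longrightarrow> (\<lambda>n. kap c x (v n)) \<longlonglongrightarrow> Rlim c z1 x"
    and "x \<in> V \<Longrightarrow> x' \<in> V \<Longrightarrow> ht x = ht x' \<Longrightarrow> T1.econ z1 (fst x') < T1.econ z1 (fst x) \<Longrightarrow> Rlim c z1 x' < Rlim c z1 x"
proof -
  note vV = v[unfolded converges_def, THEN conjunct1, rule_format]
  have l1: "limitin (hat_topology q T1) (\<lambda>n. Vert (fst (v n))) z1 sequentially"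
    and l2: "limitin (hat_topology r T2) (\<lambda>n. Vert (snd (v n))) z2 sequentially"
    using v by (auto simp: converges_def)
  note z1h = converges_hat(1)[OF v] and z2h = converges_hat(2)[OF v]
  let ?k = "\<lambda>n. ht (v n)"
  have h2: "height T2 (snd (v n)) = - ?k n" for n using V_h2[OF vV] .
  have hl: "height_limit ?k (hat_height z1)"
    using z1h
  proof (cases rule: T1.hat_cases)
    case (Vert a)
    have "\<forall>\<^sub>F n in sequentially. fst (v n) = a" by (rule T1.vertices_to_Vert) (use l1 Vert in simp)
    then show ?thesis by (auto simp: height_limit_def hat_height_def Vert elim: eventually_mono)
  next
    case (End \<xi>)
    then have "filterlim ?k at_top sequentially" using T1.vertices_to_End(1)[of \<xi> "\<lambda>n. fst (v n)"] l1 z1 by simp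
    then show ?thesis by (simp add: height_limit_def hat_height_def End)
  qed
  show z2: "z2 = T2.omega"
  proof (rule ccontr)
    assume ne: "z2 \<noteq> T2.omega"
    show False
      using z1h
    proof (cases rule: T1.hat_cases)
      case (Vert a)
      have a: "\<forall>\<^sub>F n in sequentially. fst (v n) = a" by (rule T1.vertices_to_Vert) (use l1 Vert in simp)
      show False using z2h
      proof (cases rule: T2.hat_cases)
        case (Vert b)
        have "\<forall>\<^sub>F n in sequentially. snd (v n) = b" by (rule T2.vertices_to_Vert) (use l2 Vert in simp)
        from eventually_happens[OF eventually_conj[OF a this]] obtain n where "v n = (a, b)"
          by (auto simp: prod_eq_iff)
        then have "(a, b) \<in> V" using vV[of n] by simp
        then show False using v Vert \<open>z1 = Vert a\<close> by (force simp: converges_def)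
      next
        case (End \<xi>)
        then have "filterlim (\<lambda>n. height T2 (snd (v n))) at_top sequentially"
          using T2.vertices_to_End(1)[of \<xi> "\<lambda>n. snd (v n)"] l2 ne by simp
        from eventually_happens[OF eventually_conj[OF a eventually_gt_int[OF this, of "- height T1 a"]]] h2
        show False by auto
      qed
    next
      case (End \<xi>)
      have top: "filterlim ?k at_top sequentially" using hl End by (simp add: height_limit_def hat_height_def)
      show False using z2h
      proof (cases rule: T2.hat_cases)
        case (Vert b)
        have "\<forall>\<^sub>F n in sequentially. snd (v n) = b" by (rule T2.vertices_to_Vert) (use l2 Vert in simp)
        from eventually_happens[OF eventually_conj[OF this eventually_gt_int[OF top, of "- height T2 b"]]] h2
        show False by fastforce
      next
        case (End \<xi>')
        then have "filterlim (\<lambda>n. height T2 (snd (v n))) at_top sequentially"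
          using T2.vertices_to_End(1)[of \<xi>' "\<lambda>n. snd (v n)"] l2 ne by simp
        from eventually_happens[OF eventually_conj[OF eventually_gt_int[OF this, of 0] eventually_gt_int[OF top, of 0]]] h2
        show False by auto
      qed
    qed
  qed
  note l2' = l2[unfolded z2]
  have ev_m: "\<forall>\<^sub>F n in sequentially. m0 x (v n) = T1.econ z1 (fst x)" for x
    using T1.vertices_to_non_refend[OF z1h z1 l1, of "fst x"] by (simp add: m0_def)
  have le: "\<forall>\<^sub>F n in sequentially. T1.econ z1 (fst x) \<le> ?k n" if "x \<in> V" for x
    using ev_m[of x] by eventually_elim (use range(2)[OF that vV] in metis)
  have kM: "\<forall>\<^sub>F n in sequentially. ?k n \<le> M0 rt (v n)" using range(4)[OF root_in_V vV] by simp
  note ctx = c q1 r1 hl M0_to_infinity(1)[OF l2'] kM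
  have le_o: "\<forall>\<^sub>F n in sequentially. T1.econ z1 (origin T1) \<le> ?k n"
    using le[OF root_in_V] by (simp add: DL_root_def)
  have e_o: "T1.econ z1 (origin T1) \<le> 0" using T1.econ_le[OF z1h z1, of "origin T1"] by simp
  show "(\<lambda>n. kap c x (v n)) \<longlonglongrightarrow> Rlim c z1 x" if x: "x \<in> V"
  proof -
    have "(\<lambda>n. Psi c q r (?k n) (ht x) (T1.econ z1 (fst x)) (M0 rt (v n)) /
        Psi c q r (?k n) 0 (T1.econ z1 (origin T1)) (M0 rt (v n))) \<longlonglongrightarrow> Rlim c z1 x"
      unfolding Rlim_def
      by (rule Psi_ratio_up[OF ctx T1.econ_le[OF z1h z1] e_o le[OF x] le_o])
    moreover have "\<forall>\<^sub>F n in sequentially. Psi c q r (?k n) (ht x) (T1.econ z1 (fst x)) (M0 rt (v n)) /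
        Psi c q r (?k n) 0 (T1.econ z1 (origin T1)) (M0 rt (v n)) = kap c x (v n)"
      using ev_m[of x] ev_m[of rt] M0_to_infinity(2)[OF l2', of x]
      by eventually_elim (simp add: kap_def PsiV_def DL_root_def)
    ultimately show ?thesis by (rule Lim_transform_eventually)
  qed
  show "Rlim c z1 x' < Rlim c z1 x"
    if "x \<in> V" "x' \<in> V" "ht x = ht x'" "T1.econ z1 (fst x') < T1.econ z1 (fst x)"
    unfolding Rlim_def \<open>ht x = ht x'\<close>
    by (rule Rup_strict_mono[OF ctx that(4) _ e_o le[OF that(1)] le_o])
       (use T1.econ_le[OF z1h z1, of "fst x"] that(3) in simp)
qed

lemma Rlim_eq: "ht x = ht x' \<Longrightarrow> T1.econ z (fst x) = T1.econ z (fst x') \<Longrightarrow> Rlim c z x = Rlim c z x'"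
  by (simp add: Rlim_def)

lemma both_refends_limit:
  assumes v: "converges v T1.omega T2.omega" and c: "c \<ge> 1" and x: "x \<in> V"
    and K: "c = 1 \<or> ext_limit (\<lambda>n. ht (v n)) K"
  shows "(\<lambda>n. kap c x (v n)) \<longlonglongrightarrow> mid_limit c K (ht x)"
proof -
  note vV = v[unfolded converges_def, THEN conjunct1, rule_format]
  have l1: "limitin (hat_topology q T1) (\<lambda>n. Vert (fst (v n))) T1.omega sequentially"
    and l2: "limitin (hat_topology r T2) (\<lambda>n. Vert (snd (v n))) T2.omega sequentially"
    using v by (auto simp: converges_def)
  have "\<forall>\<^sub>F n in sequentially. m0 rt (v n) \<le> ht (v n) \<and> ht (v n) \<le> M0 rt (v n)"
    using range[OF root_in_V vV] by simp
  from Psi_mid_limit[OF c q1 r1 m0_to_minus_infinity(1)[OF l1] M0_to_infinity(1)[OF l2] this K]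
  have "(\<lambda>n. Psi c q r (ht (v n)) (ht x) (m0 rt (v n)) (M0 rt (v n)) /
      Psi c q r (ht (v n)) 0 (m0 rt (v n)) (M0 rt (v n))) \<longlonglongrightarrow> mid_limit c K (ht x)" .
  moreover have "\<forall>\<^sub>F n in sequentially. Psi c q r (ht (v n)) (ht x) (m0 rt (v n)) (M0 rt (v n)) /
      Psi c q r (ht (v n)) 0 (m0 rt (v n)) (M0 rt (v n)) = kap c x (v n)"
    using m0_to_minus_infinity(2)[OF l1, of x] M0_to_infinity(2)[OF l2, of x]
    by eventually_elim (simp add: kap_def PsiV_def)
  ultimately show ?thesis by (rule Lim_transform_eventually)
qed

text \<open>At fixed height the common limit \<open>L\<close> is strictly increasing in the
  confluent with \<open>z1\<close>, and likewise with \<open>z1'\<close>. If their ancestors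
  differed, \<open>econ_separates\<close> would give two vertices that the two points order
  incompatibly.\<close>

lemma first_boundary_separates:
  assumes c: "c \<ge> 1" and u: "converges u z1 z2" and v: "converges v z1' z2'"
    and z: "z1 \<noteq> T1.omega" "z1' \<noteq> T1.omega"
    and L: "\<And>x. x \<in> V \<Longrightarrow> (\<lambda>n. kap c x (u n)) \<longlonglongrightarrow> L x" "\<And>x. x \<in> V \<Longrightarrow> (\<lambda>n. kap c x (v n)) \<longlonglongrightarrow> L x"
  shows "z1 = z1'"
proof (rule T1.econ_ancestors_inj[OF converges_hat(1)[OF u] z(1) converges_hat(1)[OF v] z(2)])
  have L1: "L x = Rlim c z1 x" and L2: "L x = Rlim c z1' x" if "x \<in> V" for x
    using LIMSEQ_unique[OF L(1)[OF that] first_boundary_limit(2)[OF u z(1) c that]]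
      LIMSEQ_unique[OF L(2)[OF that] first_boundary_limit(2)[OF v z(2) c that]] by auto
  have no: False
    if zz: "\<And>x x'. x \<in> V \<Longrightarrow> x' \<in> V \<Longrightarrow> ht x = ht x' \<Longrightarrow> T1.econ w' (fst x') < T1.econ w' (fst x) \<Longrightarrow> L x' < L x"
      "\<And>x x'. x \<in> V \<Longrightarrow> x' \<in> V \<Longrightarrow> ht x = ht x' \<Longrightarrow> T1.econ w (fst x) \<le> T1.econ w (fst x') \<Longrightarrow> L x \<le> L x'"
      and w: "w \<in> hat_tree T1" "w \<noteq> T1.omega" "w' \<in> hat_tree T1" "w' \<noteq> T1.omega"
      and x: "T1.econ w' x = height T1 x" "T1.econ w x \<noteq> height T1 x" for w w' x
  proof -
    obtain a a' where a: "height T1 a = height T1 a'" "T1.econ w' a' < T1.econ w' a" "T1.econ w a \<le> T1.econ w a'"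
      by (rule T1.econ_separates[OF w x])
    obtain b where "height T2 b = - height T1 a" using T2.exists_height by blast
    then have "(a, b) \<in> V" "(a', b) \<in> V" using a(1) by (auto simp: V_def)
    from zz(1)[OF this] zz(2)[OF this] a show False by simp
  qed
  have mono: "L x' < L x" if "x \<in> V" "x' \<in> V" "ht x = ht x'" "T1.econ z1 (fst x') < T1.econ z1 (fst x)" for x x'
    using first_boundary_limit(3)[OF u z(1) c that] L1 that by simp
  have mono': "L x' < L x" if "x \<in> V" "x' \<in> V" "ht x = ht x'" "T1.econ z1' (fst x') < T1.econ z1' (fst x)" for x x'
    using first_boundary_limit(3)[OF v z(2) c that] L2 that by simp
  have le: "L x \<le> L x'" if "x \<in> V" "x' \<in> V" "ht x = ht x'" "T1.econ z1 (fst x) \<le> T1.econ z1 (fst x')" for x x'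
    using mono[OF that(2,1)] Rlim_eq[OF that(3), of z1 c] L1 that by (cases "T1.econ z1 (fst x) = T1.econ z1 (fst x')") auto
  have le': "L x \<le> L x'" if "x \<in> V" "x' \<in> V" "ht x = ht x'" "T1.econ z1' (fst x) \<le> T1.econ z1' (fst x')" for x x'
    using mono'[OF that(2,1)] Rlim_eq[OF that(3), of z1' c] L2 that by (cases "T1.econ z1' (fst x) = T1.econ z1' (fst x')") auto
  show "T1.econ z1 x = height T1 x \<longleftrightarrow> T1.econ z1' x = height T1 x" for x
    using no[OF mono' le converges_hat(1)[OF u] z(1) converges_hat(1)[OF v] z(2), of x]
      no[OF mono le' converges_hat(1)[OF v] z(2) converges_hat(1)[OF u] z(1), of x] by blast
qed

end

section \<open>Exchanging the two trees\<close>

context DL_pair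
begin

interpretation swap: DL_pair T2 r T1 q
  by unfold_locales

lemma swap_V: "prod.swap x \<in> swap.V \<longleftrightarrow> x \<in> V"
  by (cases x) (auto simp: V_def swap.V_def add.commute)

lemma swap_kap:
  assumes "x \<in> V" "y \<in> V" shows "swap.kap c (prod.swap x) (prod.swap y) = kap c x y"
proof -
  have "swap.PsiV c (prod.swap y) (prod.swap x) = PsiV c y x" if "x \<in> V" for x
    using that assms(2) Psi_reflect[of c q r "ht y" "ht x" "m0 x y" "M0 x y"]
    by (simp add: swap.PsiV_def PsiV_def swap.m0_def swap.M0_def m0_def M0_def V_h2)
  from this[OF assms(1)] this[OF root_in_V] show ?thesis
    by (simp add: swap.kap_def kap_def DL_root_def)
qed

lemma swap_converges: "converges v z1 z2 \<Longrightarrow> swap.converges (\<lambda>n. prod.swap (v n)) z2 z1"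
proof -
  assume v: "converges v z1 z2"
  have "(z2, z1) \<noteq> (Vert (fst w), Vert (snd w))" if "w \<in> swap.V" for w
  proof -
    have "prod.swap w \<in> V" using that swap_V[of "prod.swap w"] by simp
    then show ?thesis using v by (fastforce simp: converges_def)
  qed
  then show ?thesis using v by (simp add: converges_def swap.converges_def swap_V)
qed

definition Rlim2 :: "real \<Rightarrow> 'b hat_point \<Rightarrow> 'a \<times> 'b \<Rightarrow> real" where
  "Rlim2 c z x = swap.Rlim c z (prod.swap x)"

lemma second_boundary_limit:
  assumes v: "converges v z1 z2" and z2: "z2 \<noteq> T2.omega" and c: "c \<ge> 1"
  shows "z1 = T1.omega"
    and "x \<in> V \<Longrightarrow> (\<lambda>n. kap c x (v n)) \<longlonglongrightarrow> Rlim2 c z2 x"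
    and "x \<in> V \<Longrightarrow> x' \<in> V \<Longrightarrow> ht x = ht x' \<Longrightarrow> T2.econ z2 (snd x') < T2.econ z2 (snd x) \<Longrightarrow> Rlim2 c z2 x' < Rlim2 c z2 x"
proof -
  note sv = swap_converges[OF v]
  show "z1 = T1.omega" by (rule swap.first_boundary_limit(1)[OF sv z2 c])
  show "(\<lambda>n. kap c x (v n)) \<longlonglongrightarrow> Rlim2 c z2 x" if x: "x \<in> V"
  proof -
    have "v n \<in> V" for n using v by (simp add: converges_def)
    then have "(\<lambda>n. kap c x (v n)) = (\<lambda>n. swap.kap c (prod.swap x) (prod.swap (v n)))"
      by (simp add: swap_kap x)
    then show ?thesis unfolding Rlim2_def using swap.first_boundary_limit(2)[OF sv z2 c, of "prod.swap x"] x swap_V by simp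
  qed
  show "Rlim2 c z2 x' < Rlim2 c z2 x"
    if "x \<in> V" "x' \<in> V" "ht x = ht x'" "T2.econ z2 (snd x') < T2.econ z2 (snd x)"
    unfolding Rlim2_def
    by (rule swap.first_boundary_limit(3)[OF sv z2 c]) (use that swap_V V_h2 in auto)
qed

lemma Rlim2_eq: "x \<in> V \<Longrightarrow> x' \<in> V \<Longrightarrow> ht x = ht x' \<Longrightarrow> T2.econ z (snd x) = T2.econ z (snd x') \<Longrightarrow> Rlim2 c z x = Rlim2 c z x'"
  unfolding Rlim2_def by (rule swap.Rlim_eq) (simp_all add: V_h2)

section \<open>Separation of boundary points by limit kernels\<close>

lemma first_boundary_nonconstant:
  assumes c: "c \<ge> 1" and u: "converges u z1 z2" and z: "z1 \<noteq> T1.omega"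
    and L: "\<And>x. x \<in> V \<Longrightarrow> (\<lambda>n. kap c x (u n)) \<longlonglongrightarrow> L x"
  obtains x x' where "x \<in> V" "x' \<in> V" "snd x = snd x'" "L x \<noteq> L x'"
proof -
  obtain a a' where a: "height T1 a = height T1 a'" "T1.econ z1 a' < T1.econ z1 a"
    by (rule T1.econ_nonconstant[OF converges_hat(1)[OF u] z])
  obtain b where "height T2 b = - height T1 a" using T2.exists_height by blast
  then have ab: "(a, b) \<in> V" "(a', b) \<in> V" using a(1) by (auto simp: V_def)
  have "L x = Rlim c z1 x" if "x \<in> V" for x
    by (rule LIMSEQ_unique[OF L[OF that] first_boundary_limit(2)[OF u z c that]])
  then have "L (a', b) < L (a, b)" using first_boundary_limit(3)[OF u z c ab] a ab by simp
  then show thesis using that[OF ab] by simp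
qed

text \<open>The counterpart of \<open>first_boundary_nonconstant\<close>: if the first coordinate
  tends to the reference end, the limit kernel depends on \<open>x\<close> only through its height
  and its second coordinate.\<close>

lemma first_refend_constant:
  assumes c: "c \<ge> 1" and u: "converges u T1.omega z2"
    and K: "z2 = T2.omega \<Longrightarrow> c = 1 \<or> ext_limit (\<lambda>n. ht (u n)) K"
    and L: "\<And>x. x \<in> V \<Longrightarrow> (\<lambda>n. kap c x (u n)) \<longlonglongrightarrow> L x" and x: "x \<in> V" "x' \<in> V" "snd x = snd x'"
  shows "L x = L x'"
proof -
  have ht: "ht x = ht x'" using x V_h2[of x] V_h2[of x'] by simp
  show ?thesis
  proof (cases "z2 = T2.omega")
    case True
    have "L y = mid_limit c K (ht y)" if "y \<in> V" for y
      by (rule LIMSEQ_unique[OF L[OF that] both_refends_limit[OF u[unfolded True] c that K[OF True]]])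
    then show ?thesis using x ht by simp
  next
    case False
    have "L y = Rlim2 c z2 y" if "y \<in> V" for y
      by (rule LIMSEQ_unique[OF L[OF that] second_boundary_limit(2)[OF u False c that]])
    then show ?thesis using x ht Rlim2_eq[OF x(1,2) ht, of z2 c] by simp
  qed
qed

lemma second_refend_constant:
  assumes c: "c \<ge> 1" and u: "converges u z1 T2.omega"
    and K: "z1 = T1.omega \<Longrightarrow> c = 1 \<or> ext_limit (\<lambda>n. ht (u n)) K"
    and L: "\<And>x. x \<in> V \<Longrightarrow> (\<lambda>n. kap c x (u n)) \<longlonglongrightarrow> L x" and x: "x \<in> V" "x' \<in> V" "fst x = fst x'"
  shows "L x = L x'"
proof (cases "z1 = T1.omega")
  case True
  have "L y = mid_limit c K (ht y)" if "y \<in> V" for y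
    by (rule LIMSEQ_unique[OF L[OF that] both_refends_limit[OF u[unfolded True] c that K[OF True]]])
  then show ?thesis using x by simp
next
  case False
  have "L y = Rlim c z1 y" if "y \<in> V" for y
    by (rule LIMSEQ_unique[OF L[OF that] first_boundary_limit(2)[OF u False c that]])
  then show ?thesis using x Rlim_eq[of x x' z1 c] by simp
qed

lemma second_boundary_nonconstant:
  assumes c: "c \<ge> 1" and u: "converges u z1 z2" and z: "z2 \<noteq> T2.omega"
    and L: "\<And>x. x \<in> V \<Longrightarrow> (\<lambda>n. kap c x (u n)) \<longlonglongrightarrow> L x"
  obtains x x' where "x \<in> V" "x' \<in> V" "fst x = fst x'" "L x \<noteq> L x'"
proof -
  obtain b b' where b: "height T2 b = height T2 b'" "T2.econ z2 b' < T2.econ z2 b"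
    by (rule T2.econ_nonconstant[OF converges_hat(2)[OF u] z])
  obtain a where "height T1 a = - height T2 b" using T1.exists_height by blast
  then have ab: "(a, b) \<in> V" "(a, b') \<in> V" using b(1) by (auto simp: V_def)
  have "L x = Rlim2 c z2 x" if "x \<in> V" for x
    by (rule LIMSEQ_unique[OF L[OF that] second_boundary_limit(2)[OF u z c that]])
  then have "L (a, b') < L (a, b)" using second_boundary_limit(3)[OF u z c ab] b ab by simp
  then show thesis using that[OF ab] by simp
qed

lemma second_boundary_separates:
  assumes c: "c \<ge> 1" and u: "converges u z1 z2" and v: "converges v z1' z2'"
    and z: "z2 \<noteq> T2.omega" "z2' \<noteq> T2.omega"
    and L: "\<And>x. x \<in> V \<Longrightarrow> (\<lambda>n. kap c x (u n)) \<longlonglongrightarrow> L x" "\<And>x. x \<in> V \<Longrightarrow> (\<lambda>n. kap c x (v n)) \<longlonglongrightarrow> L x"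
  shows "z2 = z2'"
proof (rule swap.first_boundary_separates[OF c swap_converges[OF u] swap_converges[OF v] z, of "\<lambda>x. L (prod.swap x)"])
  have *: "(\<lambda>n. swap.kap c x (prod.swap (w n))) \<longlonglongrightarrow> L (prod.swap x)"
    if x: "x \<in> swap.V" and w: "\<And>n. w n \<in> V" and lim: "\<And>x. x \<in> V \<Longrightarrow> (\<lambda>n. kap c x (w n)) \<longlonglongrightarrow> L x" for w x
  proof -
    have "prod.swap x \<in> V" using x swap_V[of "prod.swap x"] by simp
    from lim[OF this] swap_kap[OF this w] show ?thesis by simp
  qed
  fix x assume x: "x \<in> swap.V"
  show "(\<lambda>n. swap.kap c x (prod.swap (u n))) \<longlonglongrightarrow> L (prod.swap x)"
    by (rule *[OF x _ L(1)]) (use u in \<open>simp_all add: converges_def\<close>)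
  show "(\<lambda>n. swap.kap c x (prod.swap (v n))) \<longlonglongrightarrow> L (prod.swap x)"
    by (rule *[OF x _ L(2)]) (use v in \<open>simp_all add: converges_def\<close>)
qed

lemma kap_limits_separate:
  assumes c: "c \<ge> 1" and u: "converges u z1 z2" and v: "converges v z1' z2'"
    and K: "c = 1 \<or> ext_limit (\<lambda>n. ht (u n)) K" "c = 1 \<or> ext_limit (\<lambda>n. ht (v n)) K'"
    and L: "\<And>x. x \<in> V \<Longrightarrow> (\<lambda>n. kap c x (u n)) \<longlonglongrightarrow> L x" "\<And>x. x \<in> V \<Longrightarrow> (\<lambda>n. kap c x (v n)) \<longlonglongrightarrow> L x"
  shows "z1 = z1' \<and> z2 = z2' \<and> (c \<noteq> 1 \<longrightarrow> z1 = T1.omega \<longrightarrow> z2 = T2.omega \<longrightarrow> K = K')"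
proof -
  \<comment> \<open>A limit kernel cannot both vary and be constant over vertices with a common
    second coordinate. Hence the two sequences agree on whether the first coordinate tends to its
    reference end.\<close>
  have no1: False if "converges w y1 y2" "y1 \<noteq> T1.omega" "\<And>x. x \<in> V \<Longrightarrow> (\<lambda>n. kap c x (w n)) \<longlonglongrightarrow> L x"
    "converges w' T1.omega y2'" "c = 1 \<or> ext_limit (\<lambda>n. ht (w' n)) K0"
    "\<And>x. x \<in> V \<Longrightarrow> (\<lambda>n. kap c x (w' n)) \<longlonglongrightarrow> L x" for w w' y1 y2 y2' K0
    by (rule first_boundary_nonconstant[OF c that(1,2,3)]) (use first_refend_constant[OF c that(4,5,6)] in blast)+
  have no2: False if "converges w y1 y2" "y2 \<noteq> T2.omega" "\<And>x. x \<in> V \<Longrightarrow> (\<lambda>n. kap c x (w n)) \<longlonglongrightarrow> L x"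
    "converges w' y1' T2.omega" "c = 1 \<or> ext_limit (\<lambda>n. ht (w' n)) K0"
    "\<And>x. x \<in> V \<Longrightarrow> (\<lambda>n. kap c x (w' n)) \<longlonglongrightarrow> L x" for w w' y1 y1' y2 K0
    by (rule second_boundary_nonconstant[OF c that(1,2,3)]) (use second_refend_constant[OF c that(4,5,6)] in blast)+
  have z1: "z1 = z1'"
  proof (cases "z1 = T1.omega"; cases "z1' = T1.omega")
    assume "z1 \<noteq> T1.omega" "z1' \<noteq> T1.omega"
    then show ?thesis by (rule first_boundary_separates[OF c u v _ _ L])
  next
    assume "z1 = T1.omega" "z1' \<noteq> T1.omega"
    then show ?thesis using no1[OF v _ L(2) _ K(1) L(1)] u by blast
  next
    assume "z1 \<noteq> T1.omega" "z1' = T1.omega"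
    then show ?thesis using no1[OF u _ L(1) _ K(2) L(2)] v by blast
  qed simp
  have z2: "z2 = z2'"
  proof (cases "z2 = T2.omega"; cases "z2' = T2.omega")
    assume "z2 \<noteq> T2.omega" "z2' \<noteq> T2.omega"
    then show ?thesis by (rule second_boundary_separates[OF c u v _ _ L])
  next
    assume "z2 = T2.omega" "z2' \<noteq> T2.omega"
    then show ?thesis using no2[OF v _ L(2) _ K(1) L(1)] u by blast
  next
    assume "z2 \<noteq> T2.omega" "z2' = T2.omega"
    then show ?thesis using no2[OF u _ L(1) _ K(2) L(2)] v by blast
  qed simp
  have "K = K'" if o: "c \<noteq> 1" "z1 = T1.omega" "z2 = T2.omega"
  proof -
    obtain a where a: "height T1 a = 1" using T1.exists_height by blast
    obtain b where "height T2 b = -1" using T2.exists_height by blast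
    then have x: "(a, b) \<in> V" using a by (simp add: V_def)
    have "L (a, b) = mid_limit c K 1" "L (a, b) = mid_limit c K' 1"
      using LIMSEQ_unique[OF L(1)[OF x] both_refends_limit[OF u[unfolded o(2,3)] c x K(1)]]
        LIMSEQ_unique[OF L(2)[OF x] both_refends_limit[OF v[folded z1 z2, unfolded o(2,3)] c x K(2)]] a by simp_all
    then show ?thesis using mid_limit_inj[of c K K'] c o(1) by simp
  qed
  then show ?thesis using z1 z2 by blast
qed

text \<open>\<open>prl\<close>, \<open>prr\<close> and \<open>Kf\<close> are coordinates on the
  boundary of an abstract \<open>X\<close>: the limits in the two trees and, over the pair of
  reference ends, the horocycle index. Both compactifications are instances.\<close>

theorem Martin_compactification_DL:
  fixes X :: "'z topology"
  assumes \<alpha>: "0 < \<alpha>" "\<alpha> < 1" and c: "c \<ge> 1" and X: "discrete_compactification V X e"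
    and proj: "\<And>\<zeta> v. \<zeta> \<in> topspace X - e ` V \<Longrightarrow> (\<And>n. v n \<in> V) \<Longrightarrow> limitin X (\<lambda>n. e (v n)) \<zeta> sequentially \<Longrightarrow>
      converges v (prl \<zeta>) (prr \<zeta>) \<and> (c = 1 \<or> ext_limit (\<lambda>n. ht (v n)) (Kf \<zeta>))"
    and inj: "\<And>\<zeta> \<zeta>'. \<zeta> \<in> topspace X - e ` V \<Longrightarrow> \<zeta>' \<in> topspace X - e ` V \<Longrightarrow> prl \<zeta> = prl \<zeta>' \<Longrightarrow> prr \<zeta> = prr \<zeta>' \<Longrightarrow>
      (c \<noteq> 1 \<longrightarrow> prl \<zeta> = T1.omega \<longrightarrow> prr \<zeta> = T2.omega \<longrightarrow> Kf \<zeta> = Kf \<zeta>') \<Longrightarrow> \<zeta> = \<zeta>'"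
  shows "is_Martin_compactification TYPE('d) V (P \<alpha>) rt (2 * c * sqrt (\<alpha> * (1 - \<alpha>))) X e"
proof (rule Martin_criterion[OF X])
  let ?t = "2 * c * sqrt (\<alpha> * (1 - \<alpha>))"
  let ?g = "\<lambda>x. sqrt ((1 - \<alpha>) / \<alpha>) powi ht x"
  have g: "?g x \<noteq> 0" for x using \<alpha> by simp
  have ker: "Martin_kernel V (P \<alpha>) rt ?t x y = ?g x * kap c x y" if "x \<in> V" "y \<in> V" for x y
    unfolding kap_def by (rule Martin_kernel_eq[OF \<alpha> c that root_in_V root_height])
  {
    fix \<zeta> assume \<zeta>: "\<zeta> \<in> topspace X - e ` V"
    let ?L = "\<lambda>x. if prl \<zeta> \<noteq> T1.omega then Rlim c (prl \<zeta>) x else if prr \<zeta> \<noteq> T2.omega then Rlim2 c (prr \<zeta>) x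
      else mid_limit c (Kf \<zeta>) (ht x)"
    have "(\<lambda>n. Martin_kernel V (P \<alpha>) rt ?t x (v n)) \<longlonglongrightarrow> ?g x * ?L x"
      if v: "\<forall>n. v n \<in> V" "limitin X (\<lambda>n. e (v n)) \<zeta> sequentially" and x: "x \<in> V" for v x
    proof -
      have v': "v n \<in> V" for n using v(1) by blast
      note p = proj[OF \<zeta> v' v(2)]
      have "(\<lambda>n. kap c x (v n)) \<longlonglongrightarrow> ?L x"
      proof (cases "prl \<zeta> = T1.omega"; cases "prr \<zeta> = T2.omega")
        assume o: "prl \<zeta> = T1.omega" "prr \<zeta> = T2.omega"
        then have "converges v T1.omega T2.omega" using p by simp
        from both_refends_limit[OF this c x conjunct2[OF p]] o show ?thesis by simp
      next
        assume o: "prl \<zeta> = T1.omega" "prr \<zeta> \<noteq> T2.omega"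
        from second_boundary_limit(2)[OF conjunct1[OF p] o(2) c x] o show ?thesis by simp
      next
        assume o: "prl \<zeta> \<noteq> T1.omega"
        from first_boundary_limit(2)[OF conjunct1[OF p] o c x] o show ?thesis by simp
        from first_boundary_limit(2)[OF conjunct1[OF p] o c x] o show ?thesis by simp
      qed
      then have "(\<lambda>n. ?g x * kap c x (v n)) \<longlonglongrightarrow> ?g x * ?L x" by (intro tendsto_intros)
      then show ?thesis using ker[OF x v'] by simp
    qed
    then show "\<exists>L. \<forall>v. (\<forall>n. v n \<in> V) \<longrightarrow> limitin X (\<lambda>n. e (v n)) \<zeta> sequentially \<longrightarrow>
        (\<forall>x\<in>V. (\<lambda>n. Martin_kernel V (P \<alpha>) rt ?t x (v n)) \<longlonglongrightarrow> L x)"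
      by (intro exI[of _ "\<lambda>x. ?g x * ?L x"]) blast
  }
  fix \<zeta> \<zeta>' u v L
  assume \<zeta>: "\<zeta> \<in> topspace X - e ` V" "\<zeta>' \<in> topspace X - e ` V" and u: "\<And>n. u n \<in> V" and v: "\<And>n. v n \<in> V"
    and lim: "limitin X (\<lambda>n. e (u n)) \<zeta> sequentially" "limitin X (\<lambda>n. e (v n)) \<zeta>' sequentially"
    and L: "\<And>x. x \<in> V \<Longrightarrow> (\<lambda>n. Martin_kernel V (P \<alpha>) rt ?t x (u n)) \<longlonglongrightarrow> L x"
      "\<And>x. x \<in> V \<Longrightarrow> (\<lambda>n. Martin_kernel V (P \<alpha>) rt ?t x (v n)) \<longlonglongrightarrow> L x"
  have k: "(\<lambda>n. kap c x (w n)) \<longlonglongrightarrow> L x / ?g x"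
    if x: "x \<in> V" and w: "\<And>n. w n \<in> V" and "(\<lambda>n. Martin_kernel V (P \<alpha>) rt ?t x (w n)) \<longlonglongrightarrow> L x" for w x
  proof -
    have "(\<lambda>n. Martin_kernel V (P \<alpha>) rt ?t x (w n) / ?g x) \<longlonglongrightarrow> L x / ?g x"
      using that(3) g by (intro tendsto_intros)
    then show ?thesis unfolding ker[OF x w] nonzero_mult_div_cancel_left[OF g] .
  qed
  note p = proj[OF \<zeta>(1) u lim(1)] and p' = proj[OF \<zeta>(2) v lim(2)]
  have "prl \<zeta> = prl \<zeta>' \<and> prr \<zeta> = prr \<zeta>' \<and> (c \<noteq> 1 \<longrightarrow> prl \<zeta> = T1.omega \<longrightarrow> prr \<zeta> = T2.omega \<longrightarrow> Kf \<zeta> = Kf \<zeta>')"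
    by (rule kap_limits_separate[OF c conjunct1[OF p] conjunct1[OF p'] conjunct2[OF p] conjunct2[OF p'], of "\<lambda>x. L x / ?g x"])
       (use k[OF _ u L(1)] k[OF _ v L(2)] in auto)
  then show "\<zeta> = \<zeta>'" using inj[OF \<zeta>] by blast
qed

theorem Martin_geometric:
  assumes \<alpha>: "0 < \<alpha>" "\<alpha> < 1"
  shows "is_Martin_compactification TYPE('d) V (P \<alpha>) rt (2 * sqrt (\<alpha> * (1 - \<alpha>))) (geometric_compactification q r T1 T2) hat_embed"
proof -
  let ?Z = "prod_topology (hat_topology q T1) (hat_topology r T2)"
  let ?X = "subtopology ?Z (?Z closure_of (map_prod Vert Vert ` V))"
  have eq: "geometric_compactification q r T1 T2 = ?X" "hat_embed = map_prod Vert Vert"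
    by (simp_all add: geometric_compactification_def hat_embed_def V_eq Let_def)
  have "is_Martin_compactification TYPE('d) V (P \<alpha>) rt (2 * 1 * sqrt (\<alpha> * (1 - \<alpha>))) ?X (map_prod Vert Vert)"
  \<comment> \<open>At \<open>c = 1\<close> no horocycle index is asked for; \<open>Pinf\<close> is
    a placeholder.\<close>
  proof (rule Martin_compactification_DL[where prl = fst and prr = snd and Kf = "\<lambda>_. Pinf", OF \<alpha>])
    show "discrete_compactification V ?X (map_prod Vert Vert)"
      by (rule product_compactification[OF T1.metrizable_hat T1.compact_hat _ T1.open_Vert
            T2.metrizable_hat T2.compact_hat _ T2.open_Vert]) (simp_all add: inj_def)
  next
    fix \<zeta> v assume \<zeta>: "\<zeta> \<in> topspace ?X - map_prod Vert Vert ` V" and v: "\<And>n. v n \<in> V"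
      and lim: "limitin ?X (\<lambda>n. map_prod Vert Vert (v n)) \<zeta> sequentially"
    have "limitin (hat_topology q T1) (\<lambda>n. Vert (fst (v n))) (fst \<zeta>) sequentially"
      "limitin (hat_topology r T2) (\<lambda>n. Vert (snd (v n))) (snd \<zeta>) sequentially"
      using lim by (auto simp: limitin_subtopology limitin_pairwise o_def)
    moreover have "\<zeta> \<noteq> (Vert (fst w), Vert (snd w))" if "w \<in> V" for w
      using \<zeta> that by (force simp: map_prod_def)
    ultimately have "converges v (fst \<zeta>) (snd \<zeta>)" using v by (simp add: converges_def)
    then show "converges v (fst \<zeta>) (snd \<zeta>) \<and> (1 = (1::real) \<or> ext_limit (\<lambda>n. ht (v n)) Pinf)" by simp
  qed (auto simp: prod_eq_iff)
  then show ?thesis by (simp add: eq)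
qed

theorem Martin_horocyclic:
  assumes \<alpha>: "0 < \<alpha>" "\<alpha> < 1" and c: "c > 1"
  shows "is_Martin_compactification TYPE('d) V (P \<alpha>) rt (2 * c * sqrt (\<alpha> * (1 - \<alpha>))) (horocyclic_compactification q r T1 T2) tilde_embed"
proof -
  let ?Z = "prod_topology (tilde_topology q T1) (tilde_topology r T2)"
  let ?E = "map_prod HVert HVert ` V"
  let ?X = "subtopology ?Z (?Z closure_of ?E)"
  have eq: "horocyclic_compactification q r T1 T2 = ?X" "tilde_embed = map_prod HVert HVert"
    by (simp_all add: horocyclic_compactification_def tilde_embed_def V_eq Let_def)
  have X: "discrete_compactification V ?X (map_prod HVert HVert)"
    by (rule product_compactification[OF T1.metrizable_tilde T1.compact_tilde _ T1.open_HVert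
          T2.metrizable_tilde T2.compact_tilde _ T2.open_HVert]) (simp_all add: inj_def)
  have pair: "limitin (tilde_topology q T1) (\<lambda>n. HVert (fst (v n))) (fst \<zeta>) sequentially \<and>
      limitin (tilde_topology r T2) (\<lambda>n. HVert (snd (v n))) (snd \<zeta>) sequentially"
    if "limitin ?X (\<lambda>n. map_prod HVert HVert (v n)) \<zeta> sequentially" for v \<zeta>
    using that by (auto simp: limitin_subtopology limitin_pairwise o_def)
  \<comment> \<open>The vertices have opposite heights, and this passes to the closure; so the index
    in one coordinate determines that in the other.\<close>
  have heights: "T2.sh (snd \<zeta>) = - T1.sh (fst \<zeta>)" "fst \<zeta> \<in> tilde_tree T1" "snd \<zeta> \<in> tilde_tree T2"
    if \<zeta>: "\<zeta> \<in> topspace ?X" for \<zeta>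
  proof -
    have "metrizable_space ?X" and "\<zeta> \<in> ?X closure_of ?E"
      using X \<zeta> by (simp_all add: discrete_compactification_def)
    then obtain \<sigma> where \<sigma>: "\<And>n. \<sigma> n \<in> ?E" "limitin ?X \<sigma> \<zeta> sequentially"
      by (rule metrizable_closure_sequence) (rule that)
    have "\<exists>v. v \<in> V \<and> \<sigma> n = map_prod HVert HVert v" for n using imageE[OF \<sigma>(1)[of n]] by metis
    then obtain v where v: "\<And>n. v n \<in> V" "\<And>n. \<sigma> n = map_prod HVert HVert (v n)" by metis
    have "\<sigma> = (\<lambda>n. map_prod HVert HVert (v n))" by (rule ext) (rule v(2))
    note l = pair[OF \<sigma>(2)[unfolded this]]
    have 1: "(\<lambda>n. T1.sh (HVert (fst (v n)))) \<longlonglongrightarrow> T1.sh (fst \<zeta>)" and "fst \<zeta> \<in> tilde_tree T1"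
      using conjunct1[OF l, unfolded T1.tilde_limit] by simp_all
    have 2: "(\<lambda>n. T2.sh (HVert (snd (v n)))) \<longlonglongrightarrow> T2.sh (snd \<zeta>)" and "snd \<zeta> \<in> tilde_tree T2"
      using conjunct2[OF l, unfolded T2.tilde_limit] by simp_all
    have "T2.sh (HVert (snd (v n))) = - T1.sh (HVert (fst (v n)))" for n
      using V_h2[OF v(1)[of n]] by (simp del: squash.simps add: squash_minus)
    then have "(\<lambda>n. T2.sh (HVert (snd (v n)))) \<longlonglongrightarrow> - T1.sh (fst \<zeta>)"
      using tendsto_minus[OF 1] by simp
    with 2 show "T2.sh (snd \<zeta>) = - T1.sh (fst \<zeta>)" by (rule LIMSEQ_unique)
    show "fst \<zeta> \<in> tilde_tree T1" "snd \<zeta> \<in> tilde_tree T2" by fact+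
  qed
  have "is_Martin_compactification TYPE('d) V (P \<alpha>) rt (2 * c * sqrt (\<alpha> * (1 - \<alpha>))) ?X (map_prod HVert HVert)"
  proof (rule Martin_compactification_DL[where prl = "\<lambda>\<zeta>. T1.th (fst \<zeta>)" and prr = "\<lambda>\<zeta>. T2.th (snd \<zeta>)"
        and Kf = "\<lambda>\<zeta>. tilde_height T1 (fst \<zeta>)", OF \<alpha> _ X])
    show "1 \<le> c" using c by simp
  next
    fix \<zeta> v assume \<zeta>: "\<zeta> \<in> topspace ?X - ?E" and v: "\<And>n. v n \<in> V"
      and lim: "limitin ?X (\<lambda>n. map_prod HVert HVert (v n)) \<zeta> sequentially"
    note l = pair[OF lim]
    have "limitin (hat_topology q T1) (\<lambda>n. Vert (fst (v n))) (T1.th (fst \<zeta>)) sequentially"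
      "limitin (hat_topology r T2) (\<lambda>n. Vert (snd (v n))) (T2.th (snd \<zeta>)) sequentially"
      using l T1.tilde_limit_hat[of "\<lambda>n. HVert (fst (v n))" "fst \<zeta>"] T2.tilde_limit_hat[of "\<lambda>n. HVert (snd (v n))" "snd \<zeta>"]
      by simp_all
    moreover have "(T1.th (fst \<zeta>), T2.th (snd \<zeta>)) \<noteq> (Vert (fst w), Vert (snd w))" if w: "w \<in> V" for w
    proof
      assume a: "(T1.th (fst \<zeta>), T2.th (snd \<zeta>)) = (Vert (fst w), Vert (snd w))"
      have "fst \<zeta> = HVert (fst w)" using a by (cases "fst \<zeta>") auto
      moreover have "snd \<zeta> = HVert (snd w)" using a by (cases "snd \<zeta>") auto
      ultimately have "\<zeta> = map_prod HVert HVert w" by (cases w) (auto simp: prod_eq_iff)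
      then show False using \<zeta> w by blast
    qed
    ultimately have "converges v (T1.th (fst \<zeta>)) (T2.th (snd \<zeta>))" using v by (simp add: converges_def)
    moreover have "(\<lambda>n. squash (Fin (ht (v n)))) \<longlonglongrightarrow> T1.sh (fst \<zeta>)"
      using l T1.tilde_limit[of "\<lambda>n. HVert (fst (v n))" "fst \<zeta>"] by simp
    then have "ext_limit (\<lambda>n. ht (v n)) (tilde_height T1 (fst \<zeta>))" by (rule squash_ext_limit)
    ultimately show "converges v (T1.th (fst \<zeta>)) (T2.th (snd \<zeta>)) \<and>
        (c = 1 \<or> ext_limit (\<lambda>n. ht (v n)) (tilde_height T1 (fst \<zeta>)))" by blast
  next
    fix \<zeta> \<zeta>' assume \<zeta>: "\<zeta> \<in> topspace ?X - ?E" "\<zeta>' \<in> topspace ?X - ?E"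
      and th: "T1.th (fst \<zeta>) = T1.th (fst \<zeta>')" "T2.th (snd \<zeta>) = T2.th (snd \<zeta>')"
      and K: "c \<noteq> 1 \<longrightarrow> T1.th (fst \<zeta>) = T1.omega \<longrightarrow> T2.th (snd \<zeta>) = T2.omega \<longrightarrow>
        tilde_height T1 (fst \<zeta>) = tilde_height T1 (fst \<zeta>')"
    have \<zeta>X: "\<zeta> \<in> topspace ?X" "\<zeta>' \<in> topspace ?X" using \<zeta> by blast+
    note h = heights[OF \<zeta>X(1)] and h' = heights[OF \<zeta>X(2)]
    \<comment> \<open>A point not over the reference end is determined by its image under
      \<open>th\<close>. One such coordinate fixes the heights of both, and otherwise the index
      \<open>Kf\<close> does.\<close>
    have "T1.sh (fst \<zeta>) = T1.sh (fst \<zeta>')"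
    proof -
      consider "T1.th (fst \<zeta>) \<noteq> T1.omega" | "T2.th (snd \<zeta>) \<noteq> T2.omega" | "T1.th (fst \<zeta>) = T1.omega" "T2.th (snd \<zeta>) = T2.omega"
        by blast
      then show ?thesis
      proof cases
        case 1
        then have "fst \<zeta> = fst \<zeta>'" using th(1) by (cases "fst \<zeta>"; cases "fst \<zeta>'") auto
        then show ?thesis by simp
      next
        case 2
        then have "snd \<zeta> = snd \<zeta>'" using th(2) by (cases "snd \<zeta>"; cases "snd \<zeta>'") auto
        then show ?thesis using h(1) h'(1) by simp
      next
        case 3
        then show ?thesis using K c by simp
      qed
    qed
    moreover from this have "T2.sh (snd \<zeta>) = T2.sh (snd \<zeta>')" using h(1) h'(1) by simp
    ultimately have "fst \<zeta> = fst \<zeta>'" "snd \<zeta> = snd \<zeta>'"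
      using T1.tilde_eqI[OF h(2) h'(2) th(1)] T2.tilde_eqI[OF h(3) h'(3) th(2)] squash_inj by blast+
    then show "\<zeta> = \<zeta>'" by (rule prod_eqI)
  qed
  then show ?thesis by (simp add: eq)
qed

theorem Martin_compactifications:
  assumes \<alpha>: "0 < \<alpha>" "\<alpha> < 1"
  shows "\<forall>x\<in>V. \<forall>y\<in>V. spectral_radius V (P \<alpha>) x y = ereal (2 * sqrt (\<alpha> * (1 - \<alpha>)))"
    and "ereal t = spectral_radius V (P \<alpha>) rt rt \<Longrightarrow>
      is_Martin_compactification TYPE('d) V (P \<alpha>) rt t (geometric_compactification q r T1 T2) hat_embed"
    and "ereal t > spectral_radius V (P \<alpha>) rt rt \<Longrightarrow>
      is_Martin_compactification TYPE('d) V (P \<alpha>) rt t (horocyclic_compactification q r T1 T2) tilde_embed"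
proof -
  note rho = spectral_radius_eq[OF \<alpha> root_in_V root_in_V]
  show "\<forall>x\<in>V. \<forall>y\<in>V. spectral_radius V (P \<alpha>) x y = ereal (2 * sqrt (\<alpha> * (1 - \<alpha>)))"
    by (intro ballI spectral_radius_eq[OF \<alpha>])
  show "is_Martin_compactification TYPE('d) V (P \<alpha>) rt t (geometric_compactification q r T1 T2) hat_embed"
    if "ereal t = spectral_radius V (P \<alpha>) rt rt"
    using Martin_geometric[OF \<alpha>] that rho by simp
  show "is_Martin_compactification TYPE('d) V (P \<alpha>) rt t (horocyclic_compactification q r T1 T2) tilde_embed"
    if "ereal t > spectral_radius V (P \<alpha>) rt rt"
  proof -
    let ?s = "sqrt (\<alpha> * (1 - \<alpha>))"
    have s: "?s > 0" using \<alpha> by simp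
    have "t > 2 * ?s" using that rho by simp
    then have "t / (2 * ?s) > 1" using s by (simp add: field_simps)
    moreover have "2 * (t / (2 * ?s)) * ?s = t" using \<alpha> by simp
    ultimately show ?thesis using Martin_horocyclic[OF \<alpha>, of "t / (2 * ?s)"] by metis
  qed
qed

end

theorem corollary6p3:
  fixes q r :: nat and \<alpha> t :: real
    and T1 :: "'a pointed_tree" and T2 :: "'b pointed_tree"
    and V :: "('a \<times> 'b) set" and P :: "'a \<times> 'b \<Rightarrow> 'a \<times> 'b \<Rightarrow> real" and x0 :: "'a \<times> 'b"
  assumes "q \<ge> 2" and "r \<ge> 2"
    and "pointed_homogeneous_tree q T1" and "pointed_homogeneous_tree r T2"
    and "V = DL T1 T2" and "x0 = DL_root T1 T2"
    and "0 < \<alpha>" and "\<alpha> < 1"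
    and "P = DL_walk q r T1 T2 \<alpha>"
    and "ereal t \<ge> spectral_radius V P x0 x0"
  shows "(\<forall>x\<in>V. \<forall>y\<in>V. spectral_radius V P x y = ereal (2 * sqrt (\<alpha> * (1 - \<alpha>)))) \<and>
    (ereal t = spectral_radius V P x0 x0 \<longrightarrow>
       is_Martin_compactification TYPE('c) V P x0 t
         (geometric_compactification q r T1 T2) hat_embed) \<and>
    (ereal t > spectral_radius V P x0 x0 \<longrightarrow>
       is_Martin_compactification TYPE('c) V P x0 t
         (horocyclic_compactification q r T1 T2) tilde_embed)"
proof -
  interpret DL_pair T1 q T2 r
    using assms(1-4) by (simp add: DL_pair_def pointed_def)
  show ?thesis
    using Martin_compactifications[OF assms(7,8), unfolded V_eq P_eq] assms(5,6,9) by blast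
qed

end
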